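(* For any $a>1$ there exists an operator space $X$, belonging to the family $\mathfrak{F}$, such that the canonical basis in any subspace of $X$ is $a$-equivalent to a subsequence of the canonical basis of $X$. Consequently, every $C$-completely unconditional basic sequence in $X$ is $\phi(C)$-equivalent (up to a permutation) to a subsequence of the canonical basis of $X$, with $\phi(C)$ polynomial in $C$.
   Context: Row and column spaces: for a Hilbert space $H$, $H_{\mathbf{R}}$ and $H_{\mathbf{C}}$ denote $H$ with its row and column operator space structures; for an orthonormal system $(\xi_i)$ and finitely many matrices $a_i\in M_n$, $\|\sum a_i\otimes\xi_i\|_{M_n(H_{\mathbf{R}})}=\|\sum a_ia_i^*\|^{1/2}$ and $\|\sum a_i\otimes\xi_i\|_{M_n(H_{\mathbf{C}})}=\|\sum a_i^*a_i\|^{1/2}$. $\oplus$ denotes the $\ell_\infty$-direct sum of operator spaces. For a linear map $u$ between operator spaces, $\|u\|_{cb}=\sup_n\|I_{M_n}\otimes u\|$. For a contraction $A\in B(H,K)$ ($H,K$ separable Hilbert spaces), $X(A)=X(H,K,A)$ is the subspace $\{(e,Ae):e\in H\}$ of $H_{\mathbf{R}}\oplus K_{\mathbf{C}}$. The map $\xi\mapsto(\xi,A\xi)$ is an isometry of $H$ onto $X(A)$, and subspaces of $X(A)$ are identified with subspaces of $H$; a (closed) subspace $Y$ of $X(A)$ is then $X(A|_Y)$. $\mathfrak{F}$ is the set of all operator spaces $X(A)$, where $A\in B(\ell_2)$ is a compact contraction which is not Hilbert–Schmidt. Canonical basis: for a compact contraction $A\in B(H,K)$, let $(\xi_i)_{i\in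 I_1}$ be an orthonormal system of eigenvectors of $|A|=(A^*A)^{1/2}$ corresponding to its positive eigenvalues (with multiplicity), let $(\xi_i)_{i\in I_0}$ be an orthonormal basis of $\ker A$, and $I=I_0\sqcup I_1$. The canonical basis of $X(A)$ is $e_i=(\xi_i,A\xi_i)$, $i\in I$. The canonical basis of a subspace $Y$ of $X(A)$ is the canonical basis of $X(A|_Y)$. A family $(x_i)$ in an operator space $X$ is a $c$-completely unconditional basic sequence ($c\geq1$) if $\|\sum_i\lambda_ia_i\otimes x_i\|_{M_n(X)}\leq c\|\sum_ia_i\otimes x_i\|_{M_n(X)}$ for all finite sequences of matrices $a_i\in M_n$ and scalars $|\lambda_i|\leq1$. Families $(x_i)_{i\in I}$ and $(y_i)_{i\in I}$ are $c$-equivalent if there is a linear map $u$ from the closed span of $(x_i)$ onto the closed span of $(y_i)$ with $ux_i=y_i$ and $\|u\|_{cb}\|u^{-1}\|_{cb}\leq c$. A family $(x_i)_{i\in I}$ is $c$-equivalent (up to a permutation) to a subsequence (subfamily) of $(y_j)_{j\in J}$ if there is an injective map $\pi:I\to J$ such that $(x_i)_{i\in I}$ is $c$-equivalent to $(y_{\pi(i)})_{i\in I}$; families here, including canonical bases, are regarded as indexed by unordered sets.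
   Formalization: The completely unconditional basic sequences in the second claim are assumed normalized (each vector of norm one); without this it fails, since (e_1, t e_2) is 1-completely unconditional for all t>0 but its equivalence constant to canonical basis vectors is at least max(t, 1/t). *)

theory Defs
  imports
    "HOL-Analysis.Analysis"
    "HOL-Computational_Algebra.Polynomial"
    "HOL-Library.Nonpos_Ints"
    "Jordan_Normal_Form.Schur_Decomposition"
begin

section \<open>Complex vector spaces\<close>

class complex_space = real_vector +
  fixes scaleC :: "complex \<Rightarrow> 'a \<Rightarrow> 'a"  (infixr \<open>*\<^sub>C\<close> 75)
  assumes scaleC_add_right: "c *\<^sub>C (x + y) = c *\<^sub>C x + c *\<^sub>C y"
    and scaleC_add_left: "(c + d) *\<^sub>C x = c *\<^sub>C x + d *\<^sub>C x"
    and scaleC_scaleC: "c *\<^sub>C (d *\<^sub>C x) = (c * d) *\<^sub>C x"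
    and scaleC_one: "1 *\<^sub>C x = x"
    and scaleR_scaleC: "r *\<^sub>R x = complex_of_real r *\<^sub>C x"

global_interpretation cvs: vector_space "scaleC :: complex \<Rightarrow> 'a \<Rightarrow> 'a::complex_space"
  by unfold_locales (simp_all add: scaleC_add_right scaleC_add_left scaleC_scaleC scaleC_one)

instantiation prod :: (complex_space, complex_space) complex_space
begin

definition scaleC_prod_def: "c *\<^sub>C x = (c *\<^sub>C fst x, c *\<^sub>C snd x)"

instance
  by standard
    (simp_all add: scaleC_prod_def scaleC_add_right scaleC_add_left scaleC_scaleC scaleC_one
      scaleR_prod_def scaleR_scaleC)

end

definition clinear_on :: "'a::complex_space set \<Rightarrow> ('a \<Rightarrow> 'b::complex_space) \<Rightarrow> bool" where
  "clinear_on E u \<longleftrightarrow>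
     (\<forall>x\<in>E. \<forall>y\<in>E. u (x + y) = u x + u y) \<and> (\<forall>c. \<forall>x\<in>E. u (c *\<^sub>C x) = c *\<^sub>C u x)"


section \<open>The complex Hilbert space of square summable sequences\<close>

typedef ell2 = "{x :: nat \<Rightarrow> complex. summable (\<lambda>k. (cmod (x k))\<^sup>2)}"
  morphisms coord Abs_ell2
  by (rule exI[of _ "\<lambda>_. 0"]) simp

lemma summable_coord: "summable (\<lambda>k. (cmod (coord x k))\<^sup>2)"
  using coord[of x] by simp

lemma ell2_eqI: "(\<And>k. coord x k = coord y k) \<Longrightarrow> x = y"
  by (metis coord_inject ext)

lemma square_summable_add:
  fixes x y :: "nat \<Rightarrow> complex"
  assumes "summable (\<lambda>k. (cmod (x k))\<^sup>2)" "summable (\<lambda>k. (cmod (y k))\<^sup>2)"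
  shows "summable (\<lambda>k. (cmod (x k + y k))\<^sup>2)"
proof (rule summable_comparison_test'[where N = 0])
  show "summable (\<lambda>k. 2 * (cmod (x k))\<^sup>2 + 2 * (cmod (y k))\<^sup>2)"
    using assms by (intro summable_add summable_mult)
  fix k
  have "(cmod (x k + y k))\<^sup>2 \<le> (cmod (x k) + cmod (y k))\<^sup>2"
    by (intro power_mono norm_triangle_ineq) auto
  also have "\<dots> \<le> 2 * (cmod (x k))\<^sup>2 + 2 * (cmod (y k))\<^sup>2"
    using sum_squares_bound[of "cmod (x k)" "cmod (y k)"] by (simp add: power2_sum)
  finally show "norm ((cmod (x k + y k))\<^sup>2) \<le> 2 * (cmod (x k))\<^sup>2 + 2 * (cmod (y k))\<^sup>2"
    by simp
qed

lemma square_summable_scale: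
  fixes x :: "nat \<Rightarrow> complex"
  assumes "summable (\<lambda>k. (cmod (x k))\<^sup>2)"
  shows "summable (\<lambda>k. (cmod (c * x k))\<^sup>2)"
  using summable_mult[OF assms, of "(cmod c)\<^sup>2"] by (simp add: norm_mult power_mult_distrib)

text \<open>The inner product is linear in its first argument.\<close>

definition cinner :: "ell2 \<Rightarrow> ell2 \<Rightarrow> complex" where
  "cinner x y = (\<Sum>k. coord x k * cnj (coord y k))"

lemma summable_cinner_norm: "summable (\<lambda>k. cmod (coord x k * cnj (coord y k)))"
proof (rule summable_comparison_test'[where N = 0])
  show "summable (\<lambda>k. (cmod (coord x k))\<^sup>2 + (cmod (coord y k))\<^sup>2)"
    by (intro summable_add summable_coord)
  fix k
  have "2 * (cmod (coord x k) * cmod (coord y k)) \<le> (cmod (coord x k))\<^sup>2 + (cmod (coord y k))\<^sup>2"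
    using sum_squares_bound[of "cmod (coord x k)" "cmod (coord y k)"] by (simp add: mult.assoc)
  moreover have "0 \<le> cmod (coord x k) * cmod (coord y k)" by simp
  ultimately show "norm (cmod (coord x k * cnj (coord y k)))
      \<le> (cmod (coord x k))\<^sup>2 + (cmod (coord y k))\<^sup>2"
    unfolding norm_mult real_norm_def complex_mod_cnj abs_mult abs_norm_cancel by linarith
qed

lemma summable_cinner: "summable (\<lambda>k. coord x k * cnj (coord y k))"
  by (rule summable_norm_cancel[OF summable_cinner_norm])

instantiation ell2 :: complex_space
begin

definition zero_ell2 :: ell2 where "0 = Abs_ell2 (\<lambda>_. 0)"
definition plus_ell2 :: "ell2 \<Rightarrow> ell2 \<Rightarrow> ell2" where
  "x + y = Abs_ell2 (\<lambda>k. coord x k + coord y k)"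
definition scaleC_ell2 :: "complex \<Rightarrow> ell2 \<Rightarrow> ell2" where
  "c *\<^sub>C x = Abs_ell2 (\<lambda>k. c * coord x k)"
definition uminus_ell2 :: "ell2 \<Rightarrow> ell2" where "- x = (-1) *\<^sub>C (x :: ell2)"
definition minus_ell2 :: "ell2 \<Rightarrow> ell2 \<Rightarrow> ell2" where "x - y = x + (- y :: ell2)"
definition scaleR_ell2 :: "real \<Rightarrow> ell2 \<Rightarrow> ell2" where
  "r *\<^sub>R x = complex_of_real r *\<^sub>C (x :: ell2)"

lemma coord_zero [simp]: "coord 0 k = 0"
  by (simp add: zero_ell2_def Abs_ell2_inverse)

lemma coord_add [simp]: "coord (x + y) k = coord x k + coord y k"
  by (simp add: plus_ell2_def Abs_ell2_inverse square_summable_add summable_coord)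

lemma coord_scaleC [simp]: "coord (c *\<^sub>C x) k = c * coord x k"
  using square_summable_scale[OF summable_coord[of x], of c]
  by (simp add: scaleC_ell2_def Abs_ell2_inverse)

lemma coord_uminus [simp]: "coord (- x) k = - coord x k"
  by (simp add: uminus_ell2_def)

lemma coord_diff [simp]: "coord (x - y) k = coord x k - coord y k"
  by (simp add: minus_ell2_def)

lemma coord_scaleR [simp]: "coord (r *\<^sub>R x) k = complex_of_real r * coord x k"
  by (simp add: scaleR_ell2_def)

instance
  by standard (auto intro!: ell2_eqI simp: algebra_simps)

end

lemma cinner_add_left: "cinner (x + y) z = cinner x z + cinner y z"
  unfolding cinner_def by (simp add: distrib_right suminf_add summable_cinner)

lemma cinner_scaleC_left: "cinner (c *\<^sub>C x) y = c * cinner x y"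
  unfolding cinner_def by (simp add: mult.assoc suminf_mult summable_cinner)

lemma cinner_commute: "cinner x y = cnj (cinner y x)"
proof -
  have "(\<lambda>k. cnj (coord y k * cnj (coord x k))) sums cnj (cinner y x)"
    unfolding cinner_def sums_cnj by (rule summable_sums[OF summable_cinner])
  then show ?thesis
    unfolding cinner_def[of x y] by (simp add: sums_iff mult.commute)
qed

lemma cinner_add_right: "cinner x (y + z) = cinner x y + cinner x z"
  by (metis cinner_add_left cinner_commute complex_cnj_add)

lemma cinner_scaleC_right: "cinner x (c *\<^sub>C y) = cnj c * cinner x y"
  by (metis cinner_scaleC_left cinner_commute complex_cnj_mult)

lemma cinner_zero_left [simp]: "cinner 0 x = 0"
  by (simp add: cinner_def)

lemma cinner_zero_right [simp]: "cinner x 0 = 0"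
  by (simp add: cinner_def)

lemma cinner_sum_left: "cinner (sum f F) x = (\<Sum>i\<in>F. cinner (f i) x)"
  by (induction F rule: infinite_finite_induct) (simp_all add: cinner_add_left)

lemma cinner_sum_right: "cinner x (sum f F) = (\<Sum>i\<in>F. cinner x (f i))"
  by (induction F rule: infinite_finite_induct) (simp_all add: cinner_add_right)

lemma cinner_self: "cinner x x = complex_of_real (\<Sum>k. (cmod (coord x k))\<^sup>2)"
proof -
  have "(\<lambda>k. complex_of_real ((cmod (coord x k))\<^sup>2)) sums
      complex_of_real (\<Sum>k. (cmod (coord x k))\<^sup>2)"
    by (intro sums_of_real summable_sums summable_coord)
  then show ?thesis
    unfolding cinner_def
    by (simp add: sums_iff complex_norm_square[symmetric] del: of_real_power)
qed

instantiation ell2 :: real_inner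
begin

definition inner_ell2 :: "ell2 \<Rightarrow> ell2 \<Rightarrow> real" where "inner x y = Re (cinner x y)"
definition norm_ell2 :: "ell2 \<Rightarrow> real" where "norm x = sqrt (\<Sum>k. (cmod (coord x k))\<^sup>2)"
definition sgn_ell2 :: "ell2 \<Rightarrow> ell2" where "sgn x = x /\<^sub>R norm (x :: ell2)"
definition dist_ell2 :: "ell2 \<Rightarrow> ell2 \<Rightarrow> real" where "dist x y = norm (x - y :: ell2)"
definition uniformity_ell2 :: "(ell2 \<times> ell2) filter" where
  "uniformity_ell2 = (INF e\<in>{0<..}. principal {(x, y). dist x y < e})"
definition open_ell2 :: "ell2 set \<Rightarrow> bool" where
  "open_ell2 U \<longleftrightarrow> (\<forall>x\<in>U. eventually (\<lambda>(x', y). x' = x \<longrightarrow> y \<in> U) uniformity)"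

instance
proof
  fix x y z :: ell2 and r :: real
  show "dist x y = norm (x - y)" by (rule dist_ell2_def)
  show "sgn x = x /\<^sub>R norm x" by (rule sgn_ell2_def)
  show "uniformity = (INF e\<in>{0<..}. principal {(x :: ell2, y). dist x y < e})"
    by (rule uniformity_ell2_def)
  show "open U \<longleftrightarrow> (\<forall>x\<in>U. \<forall>\<^sub>F (x', y) in uniformity. x' = x \<longrightarrow> y \<in> U)" for U :: "ell2 set"
    by (rule open_ell2_def)
  show "inner x y = inner y x"
    unfolding inner_ell2_def by (subst cinner_commute) simp
  show "inner (x + y) z = inner x z + inner y z"
    by (simp add: inner_ell2_def cinner_add_left)
  show "inner (r *\<^sub>R x) y = r * inner x y"
    by (simp add: inner_ell2_def scaleR_scaleC cinner_scaleC_left)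
  have self: "inner x x = (\<Sum>k. (cmod (coord x k))\<^sup>2)"
    by (simp add: inner_ell2_def cinner_self)
  show "0 \<le> inner x x"
    unfolding self by (rule suminf_nonneg[OF summable_coord]) simp
  show "inner x x = 0 \<longleftrightarrow> x = 0"
    unfolding self by (subst suminf_eq_zero_iff[OF summable_coord]) (auto intro: ell2_eqI)
  show "norm x = sqrt (inner x x)"
    by (simp add: norm_ell2_def self)
qed

end

lemma norm_coord_le: "cmod (coord x k) \<le> norm x"
proof -
  have "(\<Sum>j\<in>{k}. (cmod (coord x j))\<^sup>2) \<le> (\<Sum>j. (cmod (coord x j))\<^sup>2)"
    by (rule sum_le_suminf[OF summable_coord]) auto
  then show ?thesis
    unfolding norm_ell2_def by (simp add: real_le_rsqrt)
qed

instance ell2 :: complete_space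
proof
  fix X :: "nat \<Rightarrow> ell2"
  assume X: "Cauchy X"
  have "Cauchy (\<lambda>n. coord (X n) k)" for k
  proof (rule metric_CauchyI)
    fix e :: real assume "e > 0"
    then obtain M where M: "\<forall>m\<ge>M. \<forall>n\<ge>M. dist (X m) (X n) < e"
      using metric_CauchyD[OF X] by blast
    have "dist (coord (X m) k) (coord (X n) k) \<le> dist (X m) (X n)" for m n
      using norm_coord_le[of "X m - X n" k] by (simp add: dist_norm)
    then show "\<exists>M. \<forall>m\<ge>M. \<forall>n\<ge>M. dist (coord (X m) k) (coord (X n) k) < e"
      using M by (meson le_less_trans)
  qed
  then have "\<forall>k. \<exists>l. (\<lambda>n. coord (X n) k) \<longlonglongrightarrow> l"
    by (simp add: Cauchy_convergent_iff convergent_def)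
  then obtain y where y: "\<And>k. (\<lambda>n. coord (X n) k) \<longlonglongrightarrow> y k"
    by metis
  have bound: "\<exists>M. \<forall>n\<ge>M. \<forall>N. (\<Sum>k<N. (cmod (coord (X n) k - y k))\<^sup>2) \<le> e\<^sup>2" if e: "e > 0" for e
  proof -
    obtain M where M: "\<forall>m\<ge>M. \<forall>n\<ge>M. dist (X m) (X n) < e"
      using metric_CauchyD[OF X e] by blast
    have "(\<Sum>k<N. (cmod (coord (X n) k - y k))\<^sup>2) \<le> e\<^sup>2" if "n \<ge> M" for n N
    proof (rule tendsto_upperbound)
      show "(\<lambda>m. \<Sum>k<N. (cmod (coord (X n) k - coord (X m) k))\<^sup>2)
          \<longlonglongrightarrow> (\<Sum>k<N. (cmod (coord (X n) k - y k))\<^sup>2)"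
        by (intro tendsto_intros y)
      show "\<forall>\<^sub>F m in sequentially. (\<Sum>k<N. (cmod (coord (X n) k - coord (X m) k))\<^sup>2) \<le> e\<^sup>2"
      proof (rule eventually_sequentiallyI[of M])
        fix m assume m: "M \<le> m"
        have "(\<Sum>k<N. (cmod (coord (X n - X m) k))\<^sup>2) \<le> (\<Sum>k. (cmod (coord (X n - X m) k))\<^sup>2)"
          by (rule sum_le_suminf[OF summable_coord]) auto
        also have "\<dots> = (norm (X n - X m))\<^sup>2"
          by (simp add: norm_ell2_def suminf_nonneg[OF summable_coord[of "X n - X m", simplified]])
        also have "\<dots> \<le> e\<^sup>2"
          using M m \<open>n \<ge> M\<close> by (intro power_mono) (auto simp: dist_norm less_imp_le)
        finally show "(\<Sum>k<N. (cmod (coord (X n) k - coord (X m) k))\<^sup>2) \<le> e\<^sup>2" by simp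
      qed
    qed simp
    then show ?thesis by blast
  qed
  have summ: "summable (\<lambda>k. (cmod (coord (X n) k - y k))\<^sup>2)"
    if "\<forall>N. (\<Sum>k<N. (cmod (coord (X n) k - y k))\<^sup>2) \<le> B" for n B
  proof (rule bounded_imp_summable[where B = B])
    show "(\<Sum>k\<le>N. (cmod (coord (X n) k - y k))\<^sup>2) \<le> B" for N
      unfolding lessThan_Suc_atMost[symmetric] using that by blast
  qed simp
  obtain M1 where M1: "\<forall>n\<ge>M1. \<forall>N. (\<Sum>k<N. (cmod (coord (X n) k - y k))\<^sup>2) \<le> 1\<^sup>2"
    using bound[of 1] by auto
  have "summable (\<lambda>k. (cmod (coord (X M1) k + - 1 * (coord (X M1) k - y k)))\<^sup>2)"
    using M1 by (intro square_summable_add square_summable_scale summable_coord summ) blast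
  then have "summable (\<lambda>k. (cmod (y k))\<^sup>2)" by simp
  then have coord_Y: "coord (Abs_ell2 y) k = y k" for k
    by (simp add: Abs_ell2_inverse)
  have "X \<longlonglongrightarrow> Abs_ell2 y"
  proof (rule metric_LIMSEQ_I)
    fix e :: real assume "e > 0"
    then obtain M where M: "\<forall>n\<ge>M. \<forall>N. (\<Sum>k<N. (cmod (coord (X n) k - y k))\<^sup>2) \<le> (e/2)\<^sup>2"
      using bound[of "e/2"] by auto
    have "dist (X n) (Abs_ell2 y) < e" if "n \<ge> M" for n
    proof -
      have "(\<Sum>k. (cmod (coord (X n) k - y k))\<^sup>2) \<le> (e/2)\<^sup>2"
        using M that by (intro suminf_le_const[OF summ]) auto
      then have "norm (X n - Abs_ell2 y) \<le> e/2"
        unfolding norm_ell2_def using \<open>e > 0\<close>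
        by (intro real_le_lsqrt) (auto simp: coord_Y)
      then show ?thesis using \<open>e > 0\<close> by (simp add: dist_norm)
    qed
    then show "\<exists>M. \<forall>n\<ge>M. dist (X n) (Abs_ell2 y) < e" by blast
  qed
  then show "convergent X" by (rule convergentI)
qed

definition unit_vec2 :: "nat \<Rightarrow> ell2" where
  "unit_vec2 j = Abs_ell2 (\<lambda>k. if k = j then 1 else 0)"

definition orthonormal_family :: "'i set \<Rightarrow> ('i \<Rightarrow> ell2) \<Rightarrow> bool" where
  "orthonormal_family I \<xi> \<longleftrightarrow>
     (\<forall>i\<in>I. \<forall>j\<in>I. cinner (\<xi> i) (\<xi> j) = (if i = j then 1 else 0))"


section \<open>Row and column norms\<close>

definition euclid_norm :: "complex vec \<Rightarrow> real" where
  "euclid_norm v = sqrt (\<Sum>i<dim_vec v. (cmod (vec_index v i))\<^sup>2)"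

definition mat_norm :: "complex mat \<Rightarrow> real" where
  "mat_norm M =
     Sup {euclid_norm (M *\<^sub>v v) |v. v \<in> carrier_vec (dim_col M) \<and> euclid_norm v \<le> 1}"

text \<open>\<^term>\<open>tensor_sum n F a x\<close> is the element \<open>\<Sum>i\<in>F. a i \<otimes> x i\<close> of \<open>M\<^sub>n(X)\<close>, written
  as an \<open>n \<times> n\<close> matrix of vectors.\<close>

definition tensor_sum ::
  "nat \<Rightarrow> 'i set \<Rightarrow> ('i \<Rightarrow> complex mat) \<Rightarrow> ('i \<Rightarrow> 'a::complex_space) \<Rightarrow> 'a mat" where
  "tensor_sum n F a x = mat n n (\<lambda>(k, l). \<Sum>i\<in>F. (a i $$ (k, l)) *\<^sub>C x i)"

text \<open>The norms of \<open>M\<^sub>n(H\<^sub>R)\<close> and \<open>M\<^sub>n(H\<^sub>C)\<close>. If \<open>x = \<Sum>i. a i \<otimes> \<xi> i\<close> with \<open>\<xi>\<close> orthonormal,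
  the matrices of inner products below are \<open>\<Sum>i. a i (a i)\<^sup>*\<close> and \<open>\<Sum>i. (a i)\<^sup>* a i\<close>, see
  \<open>row_norm_orthonormal\<close> and \<open>col_norm_orthonormal\<close>.\<close>

definition row_norm :: "ell2 mat \<Rightarrow> real" where
  "row_norm x = sqrt (mat_norm (mat (dim_row x) (dim_row x)
     (\<lambda>(k, l). \<Sum>m<dim_col x. cinner (x $$ (k, m)) (x $$ (l, m)))))"

definition col_norm :: "ell2 mat \<Rightarrow> real" where
  "col_norm x = sqrt (mat_norm (mat (dim_col x) (dim_col x)
     (\<lambda>(k, l). \<Sum>m<dim_row x. cinner (x $$ (m, l)) (x $$ (m, k)))))"

lemma cinner_orthonormal_sums:
  assumes "finite F" "orthonormal_family F \<xi>"
  shows "cinner (\<Sum>i\<in>F. c i *\<^sub>C \<xi> i) (\<Sum>i\<in>F. d i *\<^sub>C \<xi> i) = (\<Sum>i\<in>F. c i * cnj (d i))"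
proof -
  have "cinner (\<Sum>i\<in>F. c i *\<^sub>C \<xi> i) (\<Sum>i\<in>F. d i *\<^sub>C \<xi> i)
      = (\<Sum>i\<in>F. \<Sum>j\<in>F. c i * (cnj (d j) * cinner (\<xi> i) (\<xi> j)))"
    unfolding cinner_sum_left by (simp add: cinner_sum_right cinner_scaleC_left cinner_scaleC_right
        sum_distrib_left mult.left_commute)
  also have "\<dots> = (\<Sum>i\<in>F. \<Sum>j\<in>F. if i = j then c i * cnj (d j) else 0)"
    using assms(2) by (intro sum.cong refl) (auto simp: orthonormal_family_def)
  also have "\<dots> = (\<Sum>i\<in>F. c i * cnj (d i))"
    using assms(1) by (simp add: sum.delta')
  finally show ?thesis .
qed

lemma mat_adjoint_index:
  fixes A :: "complex mat"
  assumes "k < dim_col A" "l < dim_row A"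
  shows "mat_adjoint A $$ (k, l) = cnj (A $$ (l, k))"
  using assms by (simp add: mat_adjoint_def mat_of_rows_def)

lemma dim_mat_adjoint:
  fixes A :: "complex mat"
  shows "dim_row (mat_adjoint A) = dim_col A" "dim_col (mat_adjoint A) = dim_row A"
  by (simp_all add: mat_adjoint_def)

lemma row_norm_orthonormal:
  assumes F: "finite F" "orthonormal_family F \<xi>" and a: "\<And>i. i \<in> F \<Longrightarrow> a i \<in> carrier_mat n n"
  shows "row_norm (tensor_sum n F a \<xi>) =
    sqrt (mat_norm (mat n n (\<lambda>kl. \<Sum>i\<in>F. (a i * mat_adjoint (a i)) $$ kl)))"
proof -
  have "mat n n (\<lambda>(k, l). \<Sum>m<n. cinner (tensor_sum n F a \<xi> $$ (k, m)) (tensor_sum n F a \<xi> $$ (l, m)))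
      = mat n n (\<lambda>kl. \<Sum>i\<in>F. (a i * mat_adjoint (a i)) $$ kl)"
  proof (rule eq_matI, goal_cases)
    case (1 k l)
    then have kl: "k < n" "l < n" by auto
    have "(a i * mat_adjoint (a i)) $$ (k, l) = (\<Sum>m<n. (a i $$ (k, m)) * cnj (a i $$ (l, m)))"
      if "i \<in> F" for i
      using a[OF that] kl
      by (auto simp: scalar_prod_def mat_adjoint_index dim_mat_adjoint atLeast0LessThan
          intro!: sum.cong)
    moreover have "cinner (tensor_sum n F a \<xi> $$ (k, m)) (tensor_sum n F a \<xi> $$ (l, m))
        = (\<Sum>i\<in>F. (a i $$ (k, m)) * cnj (a i $$ (l, m)))" if "m < n" for m
      using kl that by (simp add: tensor_sum_def cinner_orthonormal_sums[OF F])
    ultimately show ?case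
      using kl by (simp add: sum.swap[of _ F])
  qed auto
  then show ?thesis
    by (simp add: row_norm_def tensor_sum_def)
qed

lemma col_norm_orthonormal:
  assumes F: "finite F" "orthonormal_family F \<xi>" and a: "\<And>i. i \<in> F \<Longrightarrow> a i \<in> carrier_mat n n"
  shows "col_norm (tensor_sum n F a \<xi>) =
    sqrt (mat_norm (mat n n (\<lambda>kl. \<Sum>i\<in>F. (mat_adjoint (a i) * a i) $$ kl)))"
proof -
  have "mat n n (\<lambda>(k, l). \<Sum>m<n. cinner (tensor_sum n F a \<xi> $$ (m, l)) (tensor_sum n F a \<xi> $$ (m, k)))
      = mat n n (\<lambda>kl. \<Sum>i\<in>F. (mat_adjoint (a i) * a i) $$ kl)"
  proof (rule eq_matI, goal_cases)
    case (1 k l)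
    then have kl: "k < n" "l < n" by auto
    have "(mat_adjoint (a i) * a i) $$ (k, l) = (\<Sum>m<n. (a i $$ (m, l)) * cnj (a i $$ (m, k)))"
      if "i \<in> F" for i
      using a[OF that] kl
      by (auto simp: scalar_prod_def mat_adjoint_index dim_mat_adjoint atLeast0LessThan
          mult.commute intro!: sum.cong)
    moreover have "cinner (tensor_sum n F a \<xi> $$ (m, l)) (tensor_sum n F a \<xi> $$ (m, k))
        = (\<Sum>i\<in>F. (a i $$ (m, l)) * cnj (a i $$ (m, k)))" if "m < n" for m
      using kl that by (simp add: tensor_sum_def cinner_orthonormal_sums[OF F])
    ultimately show ?case
      using kl by (simp add: sum.swap[of _ F])
  qed auto
  then show ?thesis
    by (simp add: col_norm_def tensor_sum_def)
qed


section \<open>Subspaces of \<open>H\<^sub>R \<oplus> K\<^sub>C\<close>\<close>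

text \<open>All operator spaces below are subspaces of \<open>H\<^sub>R \<oplus> K\<^sub>C\<close> with \<open>H = K = \<ell>\<^sub>2\<close>, that is, subsets
  of \<^typ>\<open>ell2 \<times> ell2\<close>; \<^term>\<open>opsp_norm\<close> is the norm of a matrix over this operator space.
  The product norm of the type \<^typ>\<open>ell2 \<times> ell2\<close> itself is only used for its topology.\<close>

definition opsp_norm :: "(ell2 \<times> ell2) mat \<Rightarrow> real" where
  "opsp_norm x = max (row_norm (map_mat fst x)) (col_norm (map_mat snd x))"

definition mats_over :: "nat \<Rightarrow> 'a set \<Rightarrow> 'a mat set" where
  "mats_over n E = {x \<in> carrier_mat n n. \<forall>k<n. \<forall>l<n. x $$ (k, l) \<in> E}"

definition cb_norm :: "(ell2 \<times> ell2) set \<Rightarrow> (ell2 \<times> ell2 \<Rightarrow> ell2 \<times> ell2) \<Rightarrow> ennreal" where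
  "cb_norm E u =
     (SUP n. SUP x \<in> {x \<in> mats_over n E. opsp_norm x \<le> 1}. ennreal (opsp_norm (map_mat u x)))"

definition closed_cspan :: "'i set \<Rightarrow> ('i \<Rightarrow> ell2 \<times> ell2) \<Rightarrow> (ell2 \<times> ell2) set" where
  "closed_cspan I x = closure (cvs.span (x ` I))"

definition equivalent_families ::
  "real \<Rightarrow> 'i set \<Rightarrow> ('i \<Rightarrow> ell2 \<times> ell2) \<Rightarrow> ('i \<Rightarrow> ell2 \<times> ell2) \<Rightarrow> bool" where
  "equivalent_families c I x y \<longleftrightarrow>
     (\<exists>u. clinear_on (closed_cspan I x) u \<and>
          bij_betw u (closed_cspan I x) (closed_cspan I y) \<and>
          (\<forall>i\<in>I. u (x i) = y i) \<and>
          cb_norm (closed_cspan I x) u *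
            cb_norm (closed_cspan I y) (inv_into (closed_cspan I x) u) \<le> ennreal c)"

definition equivalent_to_subfamily ::
  "real \<Rightarrow> 'i set \<Rightarrow> ('i \<Rightarrow> ell2 \<times> ell2) \<Rightarrow> 'j set \<Rightarrow> ('j \<Rightarrow> ell2 \<times> ell2) \<Rightarrow> bool" where
  "equivalent_to_subfamily c I x J y \<longleftrightarrow>
     (\<exists>\<pi>. inj_on \<pi> I \<and> \<pi> ` I \<subseteq> J \<and> equivalent_families c I x (\<lambda>i. y (\<pi> i)))"

definition completely_unconditional ::
  "real \<Rightarrow> 'i set \<Rightarrow> ('i \<Rightarrow> ell2 \<times> ell2) \<Rightarrow> bool" where
  "completely_unconditional c I x \<longleftrightarrow>
     (\<forall>n F a \<mu>. finite F \<and> F \<subseteq> I \<and> (\<forall>i\<in>F. a i \<in> carrier_mat n n \<and> cmod (\<mu> i) \<le> 1) \<longrightarrow>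
        opsp_norm (tensor_sum n F (\<lambda>i. \<mu> i \<cdot>\<^sub>m a i) x) \<le> c * opsp_norm (tensor_sum n F a x))"

text \<open>All vectors have norm one in \<open>H\<^sub>R \<oplus> K\<^sub>C\<close>, i.e. in \<open>M\<^sub>1(H\<^sub>R \<oplus> K\<^sub>C)\<close>. Basic
  sequences are understood to be normalized: canonical bases are, complete unconditionality is
  invariant under rescaling of the vectors, and equivalence is not.\<close>

definition normalized_family :: "'i set \<Rightarrow> ('i \<Rightarrow> ell2 \<times> ell2) \<Rightarrow> bool" where
  "normalized_family I x \<longleftrightarrow> (\<forall>i\<in>I. opsp_norm (mat 1 1 (\<lambda>_. x i)) = 1)"


section \<open>The spaces \<open>X(A)\<close> and their canonical bases\<close>

text \<open>An operator \<open>A \<in> B(Y, \<ell>\<^sub>2)\<close>, for a closed subspace \<open>Y\<close> of \<open>\<ell>\<^sub>2\<close>, is a total function of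
  which only the values on \<open>Y\<close> matter.\<close>

definition compact_contraction :: "ell2 set \<Rightarrow> (ell2 \<Rightarrow> ell2) \<Rightarrow> bool" where
  "compact_contraction Y A \<longleftrightarrow>
     clinear_on Y A \<and> (\<forall>y\<in>Y. norm (A y) \<le> norm y) \<and> compact (closure (A ` (Y \<inter> cball 0 1)))"

definition hilbert_schmidt :: "(ell2 \<Rightarrow> ell2) \<Rightarrow> bool" where
  "hilbert_schmidt A \<longleftrightarrow> summable (\<lambda>k. (norm (A (unit_vec2 k)))\<^sup>2)"

definition X_space :: "ell2 set \<Rightarrow> (ell2 \<Rightarrow> ell2) \<Rightarrow> (ell2 \<times> ell2) set" where
  "X_space Y A = {(e, A e) |e. e \<in> Y}"

definition \<FF> :: "(ell2 \<times> ell2) set set" where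
  "\<FF> = {X_space UNIV A |A. compact_contraction UNIV A \<and> \<not> hilbert_schmidt A}"

text \<open>The value at \<open>z\<close> of the adjoint \<open>A\<^sup>* \<in> B(\<ell>\<^sub>2, Y)\<close> of \<open>A \<in> B(Y, \<ell>\<^sub>2)\<close>.\<close>

definition adjoint_on :: "ell2 set \<Rightarrow> (ell2 \<Rightarrow> ell2) \<Rightarrow> ell2 \<Rightarrow> ell2" where
  "adjoint_on Y A z = (THE w. w \<in> Y \<and> (\<forall>y\<in>Y. cinner (A y) z = cinner y w))"

text \<open>\<open>T\<close> is the positive square root \<open>|A| = (A\<^sup>* A)\<^sup>1\<^sup>/\<^sup>2\<close> in \<open>B(Y)\<close>.\<close>

definition modulus_on :: "ell2 set \<Rightarrow> (ell2 \<Rightarrow> ell2) \<Rightarrow> (ell2 \<Rightarrow> ell2) \<Rightarrow> bool" where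
  "modulus_on Y A T \<longleftrightarrow>
     clinear_on Y T \<and> T ` Y \<subseteq> Y \<and> (\<exists>B. \<forall>y\<in>Y. norm (T y) \<le> B * norm y) \<and>
     (\<forall>y\<in>Y. cinner (T y) y \<in> \<real>\<^sub>\<ge>\<^sub>0) \<and>
     (\<forall>y\<in>Y. T (T y) = adjoint_on Y A (A y))"

text \<open>\<open>\<xi>\<close>, indexed by \<open>I = I0 \<union> I1\<close>, is an orthonormal system of eigenvectors of \<open>|A|\<close>: on \<open>I1\<close> for
  the positive eigenvalues, each eigenspace being exhausted (multiplicity), and on \<open>I0\<close> an
  orthonormal basis of the kernel of \<open>A\<close>.\<close>

definition eigen_system :: "ell2 set \<Rightarrow> (ell2 \<Rightarrow> ell2) \<Rightarrow> 'i set \<Rightarrow> ('i \<Rightarrow> ell2) \<Rightarrow> bool" where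
  "eigen_system Y A I \<xi> \<longleftrightarrow>
     (\<exists>T I0 I1. modulus_on Y A T \<and> I = I0 \<union> I1 \<and> I0 \<inter> I1 = {} \<and>
        orthonormal_family I1 \<xi> \<and>
        (\<forall>i\<in>I1. \<xi> i \<in> Y \<and> (\<exists>s>0. T (\<xi> i) = s *\<^sub>R \<xi> i)) \<and>
        (\<forall>s>0. closure (cvs.span (\<xi> ` {i \<in> I1. T (\<xi> i) = s *\<^sub>R \<xi> i})) =
                 {y \<in> Y. T y = s *\<^sub>R y}) \<and>
        orthonormal_family I0 \<xi> \<and>
        closure (cvs.span (\<xi> ` I0)) = {y \<in> Y. A y = 0})"

text \<open>\<open>x\<close> is a canonical basis of the operator space \<open>Z = X(Y, \<ell>\<^sub>2, A)\<close>. A closed subspace of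
  \<open>X(A)\<close> has this form, with \<open>Y\<close> its first projection and with the restriction of \<open>A\<close> to \<open>Y\<close>;
  \<open>Y\<close>, and \<open>A\<close> on \<open>Y\<close>, are determined by the graph \<open>Z\<close>.\<close>

definition canonical_basis :: "(ell2 \<times> ell2) set \<Rightarrow> 'i set \<Rightarrow> ('i \<Rightarrow> ell2 \<times> ell2) \<Rightarrow> bool" where
  "canonical_basis Z I x \<longleftrightarrow>
     (\<exists>Y A \<xi>. closed Y \<and> cvs.subspace Y \<and> compact_contraction Y A \<and> Z = X_space Y A \<and>
        eigen_system Y A I \<xi> \<and> (\<forall>i\<in>I. x i = (\<xi> i, A (\<xi> i))))"

end

theory Submission
  imports Defs
begin

text \<open>The space is \<open>X(A)\<close> for the diagonal operator \<open>A\<close> with the weights \<open>(j + 1) powr (- \<alpha>)\<close>, where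
\<open>\<alpha> > 0\<close> is so small that \<open>4 powr \<alpha> / sqrt (1 - 2 * \<alpha>) \<le> a\<close>. Both claims are one claim: a normalized
\<open>C\<close>-completely unconditional family in \<open>X(A)\<close> is \<open>a * C ^ 4\<close>-equivalent to a subfamily of the canonical
basis (\<open>cu_family_equivalent\<close>). A canonical basis of a subspace is normalized and 1-completely
unconditional, so \<open>C = 1\<close> settles the subspaces. There are two steps.

First, a family \<open>x i = (\<zeta> i, A (\<zeta> i))\<close> as above is compared with its diagonal model: the square root of
\<open>max (\<parallel>\<Sum>i. a i (a i)\<^sup>*\<parallel>, \<parallel>\<Sum>i. (t i)\<^sup>2 (a i)\<^sup>* a i\<parallel>)\<close>, with \<open>t i = \<parallel>A (\<zeta> i)\<parallel>\<close>.
The idea is to average over signs. In a Hilbert space the average of \<open>\<parallel>\<Sum>i. \<plusminus> h i\<parallel>\<^sup>2\<close> is exactly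
\<open>\<Sum>i. \<parallel>h i\<parallel>\<^sup>2\<close>, while in \<open>M\<^sub>n(K\<^sub>C)\<close> an average over signs cannot be computed in this way. But the norm
of \<open>M\<^sub>n(K\<^sub>C)\<close> at \<open>\<Sum>i. a i \<otimes> k i\<close> is the supremum, over unit vectors \<open>v\<close>, of the Hilbert space norm of
\<open>\<Sum>i. a i v \<otimes> k i\<close>, and for a fixed \<open>v\<close> averaging is exact. This bounds the diagonal model by the
given norm (\<open>lower_estimate\<close>); for the converse, complete unconditionality is applied to matrices whose
only non-zero column is \<open>a i v\<close> (\<open>upper_estimate\<close>).

Second, the numbers \<open>t i\<close> are matched with weights. Averaging makes \<open>\<zeta>\<close> a Riesz sequence with constant
\<open>C\<close>, so \<open>\<Sum>i\<in>F. (t i)\<^sup>2\<close> is at most \<open>C\<^sup>2\<close> times the sum of the squares of the first \<open>N = card F\<close> weights,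
which is at most \<open>N powr (1 - 2 * \<alpha>) / (1 - 2 * \<alpha>)\<close>. Hence the \<open>N\<close>-th largest \<open>t i\<close> is at most
\<open>C / sqrt (1 - 2 * \<alpha>)\<close> times the \<open>N\<close>-th weight. Moving each dyadic block of indices into the following
block gives an injection \<open>\<pi>\<close> for which \<open>t i\<close> and the weight at \<open>\<pi> i\<close> agree up to the factor
\<open>4 powr \<alpha> * C / sqrt (1 - 2 * \<alpha>)\<close> (\<open>dyadic_matching\<close>, \<open>weight_matching\<close>).

What remains is to pass from finite sums to closed spans (\<open>dominates_imp_equivalent\<close>) and to see that
a canonical basis consists of orthogonal vectors with orthogonal images under \<open>A\<close>, and that in a
canonical basis of \<open>X(A)\<close> itself each weight occurs (\<open>canonical_basis_diagonal\<close>,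
\<open>canonical_basis_weights\<close>).\<close>

section \<open>Inner products\<close>

lemma norm_scaleC: "norm (c *\<^sub>C (x :: ell2)) = cmod c * norm x"
proof -
  have "cinner (c *\<^sub>C x) (c *\<^sub>C x) = c * cnj c * cinner x x"
    by (simp add: cinner_scaleC_left cinner_scaleC_right)
  also have "\<dots> = complex_of_real ((cmod c)\<^sup>2) * cinner x x"
    by (simp only: complex_norm_square)
  finally have "inner (c *\<^sub>C x) (c *\<^sub>C x) = (cmod c)\<^sup>2 * inner x x"
    unfolding inner_ell2_def by (metis Re_complex_of_real cinner_self of_real_mult)
  then show ?thesis
    by (simp add: norm_eq_sqrt_inner real_sqrt_mult)
qed

lemma cinner_norm_sq: "cinner x x = complex_of_real ((norm x)\<^sup>2)"
  by (metis Re_complex_of_real cinner_self inner_ell2_def power2_norm_eq_inner)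

lemma cinner_Cauchy_Schwarz: "cmod (cinner x y) \<le> norm x * norm y"
proof -
  \<comment> \<open>A rotation by a unimodular scalar makes the complex inner product real.\<close>
  define c where "c = cnj (sgn (cinner x y))"
  have "cmod c \<le> 1" by (simp add: c_def norm_sgn)
  have "complex_of_real (cmod (cinner x y)) = c * cinner x y"
    by (simp add: c_def sgn_div_norm scaleR_conv_of_real complex_norm_square[symmetric]
        power2_eq_square mult.commute divide_simps flip: of_real_mult)
  then have "cmod (cinner x y) = inner (c *\<^sub>C x) y"
    by (metis Re_complex_of_real cinner_scaleC_left inner_ell2_def)
  also have "\<dots> \<le> norm (c *\<^sub>C x) * norm y" by (rule norm_cauchy_schwarz)
  also have "\<dots> \<le> norm x * norm y"
    using \<open>cmod c \<le> 1\<close> by (simp add: norm_scaleC mult_left_le_one_le mult_right_mono)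
  finally show ?thesis .
qed

section \<open>The matrix norms as suprema over vectors\<close>

definition vec_norm_sq :: "nat \<Rightarrow> (nat \<Rightarrow> complex) \<Rightarrow> real" where
  "vec_norm_sq n v = (\<Sum>k<n. (cmod (v k))\<^sup>2)"

lemma vec_norm_sq_nonneg: "0 \<le> vec_norm_sq n v"
  by (simp add: vec_norm_sq_def sum_nonneg)

lemma sum_mult_le_sqrt:
  fixes f g :: "'i \<Rightarrow> real"
  assumes "\<And>i. i \<in> M \<Longrightarrow> 0 \<le> f i" "\<And>i. i \<in> M \<Longrightarrow> 0 \<le> g i"
  shows "(\<Sum>i\<in>M. f i * g i) \<le> sqrt (\<Sum>i\<in>M. (f i)\<^sup>2) * sqrt (\<Sum>i\<in>M. (g i)\<^sup>2)"
  using L2_set_mult_ineq[of f g M] assms by (simp add: L2_set_def)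

lemma norm_combination_sq_le:
  fixes w :: "nat \<Rightarrow> ell2"
  shows "(norm (\<Sum>l<n. v l *\<^sub>C w l))\<^sup>2 \<le> (\<Sum>l<n. (norm (w l))\<^sup>2) * vec_norm_sq n v"
proof -
  have "norm (\<Sum>l<n. v l *\<^sub>C w l) \<le> (\<Sum>l<n. norm (w l) * cmod (v l))"
    by (intro sum_norm_le) (simp add: norm_scaleC mult.commute)
  also have "\<dots> \<le> sqrt (\<Sum>l<n. (norm (w l))\<^sup>2) * sqrt (vec_norm_sq n v)"
    unfolding vec_norm_sq_def by (rule sum_mult_le_sqrt) auto
  finally have "(norm (\<Sum>l<n. v l *\<^sub>C w l))\<^sup>2
      \<le> (sqrt (\<Sum>l<n. (norm (w l))\<^sup>2) * sqrt (vec_norm_sq n v))\<^sup>2"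
    by (rule power_mono) simp
  then show ?thesis
    by (simp add: power_mult_distrib sum_nonneg vec_norm_sq_nonneg)
qed

lemma gram_mult_vec:
  fixes w :: "nat \<Rightarrow> nat \<Rightarrow> ell2" and n p :: nat
  assumes "k < n"
  shows "vec_index (mat n n (\<lambda>(k, l). \<Sum>m<p. cinner (w m l) (w m k)) *\<^sub>v vec n v) k
    = (\<Sum>m<p. cinner (\<Sum>l<n. v l *\<^sub>C w m l) (w m k))"
proof -
  have "vec_index (mat n n (\<lambda>(k, l). \<Sum>m<p. cinner (w m l) (w m k)) *\<^sub>v vec n v) k
      = (\<Sum>l<n. (\<Sum>m<p. cinner (w m l) (w m k)) * v l)"
    using assms by (simp add: scalar_prod_def atLeast0LessThan)
  also have "\<dots> = (\<Sum>l<n. \<Sum>m<p. v l * cinner (w m l) (w m k))"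
    by (simp add: sum_distrib_left mult.commute)
  also have "\<dots> = (\<Sum>m<p. cinner (\<Sum>l<n. v l *\<^sub>C w m l) (w m k))"
    by (subst sum.swap) (simp add: cinner_sum_left cinner_scaleC_left)
  finally show ?thesis .
qed

lemma euclid_norm_vec: "euclid_norm (vec n v) = sqrt (vec_norm_sq n v)"
  by (simp add: euclid_norm_def vec_norm_sq_def)

lemma vec_carrier_eq: "u \<in> carrier_vec n \<Longrightarrow> vec n (\<lambda>k. vec_index u k) = u"
  by auto

text \<open>The quadratic form of a Gram matrix turns \<open>mat_norm\<close>, which is defined by the lengths of the
vectors \<open>G v\<close>, into a statement about the vectors \<open>\<Sum>l. v l *\<^sub>C w m l\<close> of the Hilbert space.\<close>

lemma gram_form:
  fixes w :: "nat \<Rightarrow> nat \<Rightarrow> ell2" and n p :: nat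
  defines "G \<equiv> mat n n (\<lambda>(k, l). \<Sum>m<p. cinner (w m l) (w m k))"
  shows "(\<Sum>k<n. vec_index (G *\<^sub>v vec n v) k * cnj (u k))
    = (\<Sum>m<p. cinner (\<Sum>l<n. v l *\<^sub>C w m l) (\<Sum>k<n. u k *\<^sub>C w m k))"
proof -
  have "(\<Sum>k<n. vec_index (G *\<^sub>v vec n v) k * cnj (u k))
      = (\<Sum>k<n. \<Sum>m<p. cnj (u k) * cinner (\<Sum>l<n. v l *\<^sub>C w m l) (w m k))"
    unfolding G_def 
    by (intro sum.cong refl, subst gram_mult_vec) (auto simp: sum_distrib_left mult.commute)
  also have "\<dots> = (\<Sum>m<p. cinner (\<Sum>l<n. v l *\<^sub>C w m l) (\<Sum>k<n. u k *\<^sub>C w m k))"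
    by (subst sum.swap) (simp only: cinner_sum_right cinner_scaleC_right)
  finally show ?thesis .
qed

lemma gram_euclid_norm_le:
  fixes w :: "nat \<Rightarrow> nat \<Rightarrow> ell2" and n p :: nat
  defines "G \<equiv> mat n n (\<lambda>(k, l). \<Sum>m<p. cinner (w m l) (w m k))"
  assumes B: "\<And>v. (\<Sum>m<p. (norm (\<Sum>l<n. v l *\<^sub>C w m l))\<^sup>2) \<le> B * vec_norm_sq n v" and "0 \<le> B"
  shows "euclid_norm (G *\<^sub>v vec n v) \<le> B * sqrt (vec_norm_sq n v)"
proof -
  define u where "u k = vec_index (G *\<^sub>v vec n v) k" for k
  define z where "z v m = (\<Sum>l<n. v l *\<^sub>C w m l)" for v m
  have dim: "dim_vec (G *\<^sub>v vec n v) = n" by (simp add: G_def)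
  have en: "euclid_norm (G *\<^sub>v vec n v) = sqrt (vec_norm_sq n u)"
    unfolding euclid_norm_def dim vec_norm_sq_def u_def ..
  have "complex_of_real (vec_norm_sq n u) = (\<Sum>k<n. u k * cnj (u k))"
    unfolding vec_norm_sq_def of_real_sum by (intro sum.cong refl) (simp only: complex_norm_square)
  also have "\<dots> = (\<Sum>m<p. cinner (z v m) (z u m))"
    unfolding z_def using gram_form[where w = w and n = n and p = p and v = v and u = u] by (simp add: u_def G_def)
  finally have "vec_norm_sq n u = cmod (\<Sum>m<p. cinner (z v m) (z u m))"
    using vec_norm_sq_nonneg[of n u] by (metis norm_of_real abs_of_nonneg)
  also have "\<dots> \<le> (\<Sum>m<p. norm (z v m) * norm (z u m))"
    by (intro sum_norm_le cinner_Cauchy_Schwarz)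
  also have "\<dots> \<le> sqrt (\<Sum>m<p. (norm (z v m))\<^sup>2) * sqrt (\<Sum>m<p. (norm (z u m))\<^sup>2)"
    by (rule sum_mult_le_sqrt) auto
  also have "\<dots> \<le> sqrt (B * vec_norm_sq n v) * sqrt (B * vec_norm_sq n u)"
    unfolding z_def by (intro mult_mono real_sqrt_le_mono B) (auto simp: sum_nonneg assms(3) vec_norm_sq_nonneg)
  also have "\<dots> = B * sqrt (vec_norm_sq n v) * sqrt (vec_norm_sq n u)"
    using \<open>0 \<le> B\<close> by (simp add: real_sqrt_mult algebra_simps)
  finally have "sqrt (vec_norm_sq n u) * sqrt (vec_norm_sq n u) \<le> B * sqrt (vec_norm_sq n v) * sqrt (vec_norm_sq n u)"
    by (simp add: vec_norm_sq_nonneg)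
  then have "sqrt (vec_norm_sq n u) \<le> B * sqrt (vec_norm_sq n v) \<or> sqrt (vec_norm_sq n u) = 0"
    using vec_norm_sq_nonneg[of n u] by (metis mult_le_cancel_right order_le_less real_sqrt_ge_zero not_le)
  then show ?thesis
    unfolding en using \<open>0 \<le> B\<close> vec_norm_sq_nonneg[of n v] by auto
qed

text \<open>A Gram matrix is positive, and for positive \<open>G\<close> the norm is the supremum of \<open>\<langle>G v, v\<rangle>\<close> over unit
vectors: one inequality is Cauchy-Schwarz for \<open>\<langle>G v, v\<rangle>\<close>, the other is Cauchy-Schwarz for the
semi-inner product \<open>\<langle>G v, u\<rangle>\<close> with \<open>u = G v\<close>.\<close>

lemma gram_mat_norm:
  fixes w :: "nat \<Rightarrow> nat \<Rightarrow> ell2" and n p :: nat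
  defines "G \<equiv> mat n n (\<lambda>(k, l). \<Sum>m<p. cinner (w m l) (w m k))"
  shows "0 \<le> mat_norm G"
    and "0 \<le> B \<Longrightarrow> mat_norm G \<le> B \<longleftrightarrow>
      (\<forall>v. (\<Sum>m<p. (norm (\<Sum>l<n. v l *\<^sub>C w m l))\<^sup>2) \<le> B * vec_norm_sq n v)"
proof -
  define S where "S = {euclid_norm (G *\<^sub>v u) |u. u \<in> carrier_vec n \<and> euclid_norm u \<le> 1}"
  have mn: "mat_norm G = Sup S"
    unfolding mat_norm_def S_def G_def by simp
  have S_le: "s \<le> B" if "s \<in> S" "0 \<le> B"
    and B: "\<And>v. (\<Sum>m<p. (norm (\<Sum>l<n. v l *\<^sub>C w m l))\<^sup>2) \<le> B * vec_norm_sq n v" for s B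
  proof -
    obtain u where u: "u \<in> carrier_vec n" "euclid_norm u \<le> 1" "s = euclid_norm (G *\<^sub>v u)"
      using \<open>s \<in> S\<close> unfolding S_def by auto
    define v where "v k = vec_index u k" for k
    have uv: "u = vec n v" unfolding v_def using vec_carrier_eq[OF u(1)] by simp
    have "s \<le> B * sqrt (vec_norm_sq n v)"
      unfolding u(3) uv G_def using B \<open>0 \<le> B\<close> by (rule gram_euclid_norm_le)
    also have "\<dots> \<le> B * 1"
      using u(2) \<open>0 \<le> B\<close> unfolding uv euclid_norm_vec by (rule mult_left_mono)
    finally show ?thesis by simp
  qed
  define B0 where "B0 = (\<Sum>m<p. \<Sum>l<n. (norm (w m l))\<^sup>2)"
  have B0: "(\<Sum>m<p. (norm (\<Sum>l<n. v l *\<^sub>C w m l))\<^sup>2) \<le> B0 * vec_norm_sq n v" for v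
    unfolding B0_def sum_distrib_right[of _ "{..<p}"] by (intro sum_mono norm_combination_sq_le)
  have "0 \<le> B0" by (simp add: B0_def sum_nonneg)
  have bdd: "bdd_above S"
    by (rule bdd_aboveI[of _ B0]) (rule S_le[OF _ \<open>0 \<le> B0\<close> B0])
  have mem: "euclid_norm (G *\<^sub>v vec n (\<lambda>_. 0)) \<in> S"
    unfolding S_def by (auto simp: euclid_norm_vec vec_norm_sq_def)
  have "0 \<le> euclid_norm (G *\<^sub>v vec n (\<lambda>_. 0))"
    unfolding euclid_norm_def by (simp add: sum_nonneg)
  then show "0 \<le> mat_norm G"
    unfolding mn using cSup_upper[OF mem bdd] by linarith
  assume "0 \<le> B"
  show "mat_norm G \<le> B \<longleftrightarrow>
      (\<forall>v. (\<Sum>m<p. (norm (\<Sum>l<n. v l *\<^sub>C w m l))\<^sup>2) \<le> B * vec_norm_sq n v)"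
    proof
      assume "\<forall>v. (\<Sum>m<p. (norm (\<Sum>l<n. v l *\<^sub>C w m l))\<^sup>2) \<le> B * vec_norm_sq n v"
      then show "mat_norm G \<le> B"
        unfolding mn by (intro cSup_least[of S B] S_le[OF _ \<open>0 \<le> B\<close>]) (use mem in blast)+
    next
      assume le: "mat_norm G \<le> B"
      show "\<forall>v. (\<Sum>m<p. (norm (\<Sum>l<n. v l *\<^sub>C w m l))\<^sup>2) \<le> B * vec_norm_sq n v"
      proof
        fix v
        define E where "E = (\<Sum>m<p. (norm (\<Sum>l<n. v l *\<^sub>C w m l))\<^sup>2)"
        define r where "r = sqrt (vec_norm_sq n v)"
        have E0: "0 \<le> E" by (simp add: E_def sum_nonneg)
        define g where "g k = vec_index (G *\<^sub>v vec n v) k" for k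
        have r0: "0 \<le> r" "r\<^sup>2 = vec_norm_sq n v" by (auto simp: r_def vec_norm_sq_nonneg)
        note r2 = r0(2)[symmetric]
        show "E \<le> B * vec_norm_sq n v"
        proof (cases "r = 0")
          case True
          then have "vec_norm_sq n v = 0" by (simp add: r_def)
          then show ?thesis using B0[of v] by (simp add: E_def)
        next
          case False
          then have "r > 0" using r0(1) by simp
          have "complex_of_real E = (\<Sum>k<n. g k * cnj (v k))"
            unfolding g_def G_def gram_form E_def by (simp only: cinner_norm_sq of_real_sum)
          then have "E = cmod (\<Sum>k<n. g k * cnj (v k))"
            using E0 by (metis abs_of_nonneg norm_of_real)
          also have "\<dots> \<le> (\<Sum>k<n. cmod (g k) * cmod (v k))"
            by (intro sum_norm_le) (simp add: norm_mult)
          also have "\<dots> \<le> sqrt (vec_norm_sq n g) * r"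
            unfolding r_def vec_norm_sq_def by (rule sum_mult_le_sqrt) auto
          finally have E_le: "E \<le> sqrt (vec_norm_sq n g) * r" .
          define v' where "v' k = v k / complex_of_real r" for k
          have "vec_norm_sq n v' = vec_norm_sq n v / r\<^sup>2"
            by (simp add: vec_norm_sq_def v'_def norm_divide power_divide sum_divide_distrib)
          also have "\<dots> = 1" using \<open>r > 0\<close> by (simp add: r2)
          finally have "vec_norm_sq n v' = 1" .
          then have "euclid_norm (G *\<^sub>v vec n v') \<in> S"
            unfolding S_def by (auto simp: euclid_norm_vec)
          then have "euclid_norm (G *\<^sub>v vec n v') \<le> B"
            by (rule order_trans[OF cSup_upper[OF _ bdd] le[unfolded mn]])
          moreover have "vec_index (G *\<^sub>v vec n v') k = g k / complex_of_real r" if "k < n" for k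
            using that unfolding g_def G_def v'_def
            by (simp add: scalar_prod_def sum_divide_distrib)
          then have "euclid_norm (G *\<^sub>v vec n v') = sqrt (vec_norm_sq n g / r\<^sup>2)"
            unfolding euclid_norm_def vec_norm_sq_def
            by (simp add: norm_divide power_divide sum_divide_distrib G_def)
          ultimately have "sqrt (vec_norm_sq n g) / r \<le> B"
            using \<open>r > 0\<close> by (simp add: real_sqrt_divide)
          then have "sqrt (vec_norm_sq n g) \<le> B * r" using \<open>r > 0\<close> by (simp add: divide_simps)
          then have "sqrt (vec_norm_sq n g) * r \<le> B * r * r" using r0(1) by (rule mult_right_mono)
          then show ?thesis using E_le r2 by (simp add: power2_eq_square mult.assoc)
        qed
      qed
    qed
qed

lemma mat_norm_conj:
  assumes G: "G \<in> carrier_mat n n"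
  shows "mat_norm (map_mat cnj G) = mat_norm G"
proof -
  have eu: "euclid_norm (map_vec cnj v) = euclid_norm v" for v
    by (simp add: euclid_norm_def)
  have gv: "map_mat cnj G *\<^sub>v map_vec cnj v = map_vec cnj (G *\<^sub>v v)" if "v \<in> carrier_vec n" for v
    using G that by (intro eq_vecI) (auto simp: scalar_prod_def)
  have inv: "map_vec cnj (map_vec cnj v) = v" for v by (intro eq_vecI) auto
  have "{euclid_norm (map_mat cnj G *\<^sub>v v) |v. v \<in> carrier_vec n \<and> euclid_norm v \<le> 1}
      = {euclid_norm (G *\<^sub>v v) |v. v \<in> carrier_vec n \<and> euclid_norm v \<le> 1}" (is "?L = ?R")
  proof (intro equalityI subsetI)
    fix s assume "s \<in> ?L"
    then obtain v where "v \<in> carrier_vec n" "euclid_norm v \<le> 1"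
      "s = euclid_norm (map_mat cnj G *\<^sub>v v)" by auto
    then show "s \<in> ?R"
      using gv[of "map_vec cnj v"] by (auto simp: inv eu intro!: exI[of _ "map_vec cnj v"])
  next
    fix s assume "s \<in> ?R"
    then obtain v where "v \<in> carrier_vec n" "euclid_norm v \<le> 1" "s = euclid_norm (G *\<^sub>v v)" by auto
    then show "s \<in> ?L"
      using gv[of v] by (auto simp: eu intro!: exI[of _ "map_vec cnj v"])
  qed
  then show ?thesis using G unfolding mat_norm_def by simp
qed

text \<open>The row norm is the supremum of the lengths of \<open>v\<^sup>T x\<close>, a tuple of vectors, over unit vectors \<open>v\<close>; the
column norm is that of the lengths of \<open>x v\<close>.\<close>

definition row_sq :: "nat \<Rightarrow> (ell2 \<times> ell2) mat \<Rightarrow> (nat \<Rightarrow> complex) \<Rightarrow> real" where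
  "row_sq n x v = (\<Sum>m<n. (norm (\<Sum>k<n. v k *\<^sub>C fst (x $$ (k, m))))\<^sup>2)"

definition col_sq :: "nat \<Rightarrow> (ell2 \<times> ell2) mat \<Rightarrow> (nat \<Rightarrow> complex) \<Rightarrow> real" where
  "col_sq n x v = (\<Sum>m<n. (norm (\<Sum>k<n. v k *\<^sub>C snd (x $$ (m, k))))\<^sup>2)"

lemma
  assumes x: "x \<in> carrier_mat n n"
  shows opsp_norm_nonneg: "0 \<le> opsp_norm x"
    and opsp_norm_le_iff: "0 \<le> B \<Longrightarrow> opsp_norm x \<le> B \<longleftrightarrow>
      (\<forall>v. row_sq n x v \<le> B\<^sup>2 * vec_norm_sq n v) \<and> (\<forall>v. col_sq n x v \<le> B\<^sup>2 * vec_norm_sq n v)"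
proof -
  \<comment> \<open>The matrix in the definition of the row norm is the complex conjugate of this Gram matrix.\<close>
  define R where "R = mat n n (\<lambda>(k, l). \<Sum>m<n. cinner (fst (x $$ (l, m))) (fst (x $$ (k, m))))"
  define K where "K = mat n n (\<lambda>(k, l). \<Sum>m<n. cinner (snd (x $$ (m, l))) (snd (x $$ (m, k))))"
  have "mat n n (\<lambda>(k, l). \<Sum>m<n. cinner (map_mat fst x $$ (k, m)) (map_mat fst x $$ (l, m)))
      = map_mat cnj R"
    unfolding R_def using x by (intro eq_matI) (auto simp: cinner_commute[symmetric] intro!: sum.cong)
  then have row: "row_norm (map_mat fst x) = sqrt (mat_norm R)"
    unfolding row_norm_def using x mat_norm_conj[of R n] by (simp add: R_def)
  have "mat n n (\<lambda>(k, l). \<Sum>m<n. cinner (map_mat snd x $$ (m, l)) (map_mat snd x $$ (m, k))) = K"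
    unfolding K_def using x by (intro eq_matI) auto
  then have col: "col_norm (map_mat snd x) = sqrt (mat_norm K)"
    unfolding col_norm_def using x by simp
  have R: "0 \<le> mat_norm R" "0 \<le> b \<Longrightarrow> mat_norm R \<le> b \<longleftrightarrow> (\<forall>v. row_sq n x v \<le> b * vec_norm_sq n v)" for b
    unfolding R_def row_sq_def
    using gram_mat_norm[where w = "\<lambda>m k. fst (x $$ (k, m))" and n = n and p = n] by auto
  have K: "0 \<le> mat_norm K" "0 \<le> b \<Longrightarrow> mat_norm K \<le> b \<longleftrightarrow> (\<forall>v. col_sq n x v \<le> b * vec_norm_sq n v)" for b
    unfolding K_def col_sq_def
    using gram_mat_norm[where w = "\<lambda>m k. snd (x $$ (m, k))" and n = n and p = n] by auto
  show "0 \<le> opsp_norm x"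
    unfolding opsp_norm_def row using R(1) by (simp add: le_max_iff_disj)
  assume "0 \<le> B"
  have "sqrt t \<le> B \<longleftrightarrow> t \<le> B\<^sup>2" for t
    using \<open>0 \<le> B\<close> by (metis real_sqrt_le_iff real_sqrt_abs abs_of_nonneg)
  then show "opsp_norm x \<le> B \<longleftrightarrow>
      (\<forall>v. row_sq n x v \<le> B\<^sup>2 * vec_norm_sq n v) \<and> (\<forall>v. col_sq n x v \<le> B\<^sup>2 * vec_norm_sq n v)"
    unfolding opsp_norm_def row col by (simp add: R K)
qed

section \<open>Averaging over signs\<close>

text \<open>The average over all signs of the first sum is the second sum, so some choice of signs is at most,
and some is at least, the average. Both are found by choosing one sign at a time; \<open>\<sigma>\<close> says which of the
two is wanted.\<close>

lemma exists_signs: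
  fixes h :: "'i \<Rightarrow> 'm \<Rightarrow> 'b::real_inner" and \<sigma> :: real
  assumes "finite F" "\<sigma> = 1 \<or> \<sigma> = - 1"
  shows "\<exists>\<epsilon>. (\<forall>i. \<epsilon> i = 1 \<or> \<epsilon> i = (- 1 :: real)) \<and>
    0 \<le> \<sigma> * ((\<Sum>m\<in>M. (norm (\<Sum>i\<in>F. \<epsilon> i *\<^sub>R h i m))\<^sup>2) - (\<Sum>i\<in>F. \<Sum>m\<in>M. (norm (h i m))\<^sup>2))"
  using assms(1)
proof induction
  case empty
  show ?case by (intro exI[of _ "\<lambda>_. 1"]) simp
next
  case (insert j F)
  define q where "q \<epsilon> = (\<Sum>m\<in>M. (norm (\<Sum>i\<in>F. \<epsilon> i *\<^sub>R h i m))\<^sup>2)" for \<epsilon>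
  obtain \<epsilon> where \<epsilon>: "\<forall>i. \<epsilon> i = 1 \<or> \<epsilon> i = (- 1 :: real)"
    "0 \<le> \<sigma> * (q \<epsilon> - (\<Sum>i\<in>F. \<Sum>m\<in>M. (norm (h i m))\<^sup>2))"
    using insert.IH unfolding q_def by blast
  define b where "b = (\<Sum>m\<in>M. inner (\<Sum>i\<in>F. \<epsilon> i *\<^sub>R h i m) (h j m))"
  define \<tau> :: real where "\<tau> = (if 0 \<le> \<sigma> * b then 1 else - 1)"
  have \<tau>: "\<tau> = 1 \<or> \<tau> = - 1" "0 \<le> \<sigma> * (\<tau> * b)"
    using assms(2) by (auto simp: \<tau>_def)
  have "(\<Sum>m\<in>M. (norm (\<Sum>i\<in>insert j F. (\<epsilon>(j := \<tau>)) i *\<^sub>R h i m))\<^sup>2)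
      = (\<Sum>m\<in>M. (norm ((\<Sum>i\<in>F. \<epsilon> i *\<^sub>R h i m) + \<tau> *\<^sub>R h j m))\<^sup>2)"
  proof (intro sum.cong refl)
    fix m
    have "(\<Sum>i\<in>F. (\<epsilon>(j := \<tau>)) i *\<^sub>R h i m) = (\<Sum>i\<in>F. \<epsilon> i *\<^sub>R h i m)"
      using insert.hyps(2) by (intro sum.cong) auto
    then show "(norm (\<Sum>i\<in>insert j F. (\<epsilon>(j := \<tau>)) i *\<^sub>R h i m))\<^sup>2
        = (norm ((\<Sum>i\<in>F. \<epsilon> i *\<^sub>R h i m) + \<tau> *\<^sub>R h j m))\<^sup>2"
      using insert.hyps by (simp add: add.commute)
  qed
  also have "\<dots> = (\<Sum>m\<in>M. (norm (\<Sum>i\<in>F. \<epsilon> i *\<^sub>R h i m))\<^sup>2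
      + 2 * \<tau> * inner (\<Sum>i\<in>F. \<epsilon> i *\<^sub>R h i m) (h j m) + (norm (h j m))\<^sup>2)"
    using \<tau>(1) by (intro sum.cong refl) (auto simp: power2_norm_eq_inner inner_add_left inner_add_right inner_diff_left inner_diff_right inner_commute)
  also have "\<dots> = q \<epsilon> + 2 * (\<tau> * b) + (\<Sum>m\<in>M. (norm (h j m))\<^sup>2)"
    by (simp add: q_def b_def sum.distrib sum_distrib_left mult.assoc)
  finally have "\<sigma> * ((\<Sum>m\<in>M. (norm (\<Sum>i\<in>insert j F. (\<epsilon>(j := \<tau>)) i *\<^sub>R h i m))\<^sup>2)
      - (\<Sum>i\<in>insert j F. \<Sum>m\<in>M. (norm (h i m))\<^sup>2))
      = \<sigma> * (q \<epsilon> - (\<Sum>i\<in>F. \<Sum>m\<in>M. (norm (h i m))\<^sup>2)) + 2 * (\<sigma> * (\<tau> * b))"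
    using insert.hyps by (simp add: algebra_simps)
  then show ?case
    using \<epsilon> \<tau> by (intro exI[of _ "\<epsilon>(j := \<tau>)"]) auto
qed

lemma exists_signs_le:
  fixes h :: "'i \<Rightarrow> 'm \<Rightarrow> ell2"
  assumes "finite F"
  shows "\<exists>\<epsilon>. (\<forall>i. \<epsilon> i = 1 \<or> \<epsilon> i = (- 1 :: complex)) \<and> (\<Sum>m\<in>M. (norm (\<Sum>i\<in>F. \<epsilon> i *\<^sub>C h i m))\<^sup>2) \<le> (\<Sum>i\<in>F. \<Sum>m\<in>M. (norm (h i m))\<^sup>2)"
proof -
  obtain \<epsilon> where \<epsilon>: "\<forall>i. \<epsilon> i = 1 \<or> \<epsilon> i = (- 1 :: real)"
    "(\<Sum>m\<in>M. (norm (\<Sum>i\<in>F. \<epsilon> i *\<^sub>R h i m))\<^sup>2) \<le> (\<Sum>i\<in>F. \<Sum>m\<in>M. (norm (h i m))\<^sup>2)"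
    using exists_signs[OF assms, of "- 1" h M] by auto
  show ?thesis
    by (rule exI[of _ "\<lambda>i. complex_of_real (\<epsilon> i)"]) (use \<epsilon> in \<open>auto simp: scaleR_scaleC\<close>)
qed

lemma exists_signs_ge:
  fixes h :: "'i \<Rightarrow> 'm \<Rightarrow> ell2"
  assumes "finite F"
  shows "\<exists>\<epsilon>. (\<forall>i. \<epsilon> i = 1 \<or> \<epsilon> i = (- 1 :: complex)) \<and> (\<Sum>i\<in>F. \<Sum>m\<in>M. (norm (h i m))\<^sup>2) \<le> (\<Sum>m\<in>M. (norm (\<Sum>i\<in>F. \<epsilon> i *\<^sub>C h i m))\<^sup>2)"
proof -
  obtain \<epsilon> where \<epsilon>: "\<forall>i. \<epsilon> i = 1 \<or> \<epsilon> i = (- 1 :: real)"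
    "(\<Sum>i\<in>F. \<Sum>m\<in>M. (norm (h i m))\<^sup>2) \<le> (\<Sum>m\<in>M. (norm (\<Sum>i\<in>F. \<epsilon> i *\<^sub>R h i m))\<^sup>2)"
    using exists_signs[OF assms, of 1 h M] by auto
  show ?thesis
    by (rule exI[of _ "\<lambda>i. complex_of_real (\<epsilon> i)"]) (use \<epsilon> in \<open>auto simp: scaleR_scaleC\<close>)
qed

section \<open>Completely unconditional sequences\<close>

definition mat_vec_entry :: "nat \<Rightarrow> complex mat \<Rightarrow> (nat \<Rightarrow> complex) \<Rightarrow> nat \<Rightarrow> complex" where
  "mat_vec_entry n a v m = (\<Sum>k<n. v k * a $$ (m, k))"

definition vec_mat_entry :: "nat \<Rightarrow> complex mat \<Rightarrow> (nat \<Rightarrow> complex) \<Rightarrow> nat \<Rightarrow> complex" where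
  "vec_mat_entry n a v m = (\<Sum>k<n. v k * a $$ (k, m))"

lemma fst_sum: "fst (\<Sum>i\<in>F. f i) = (\<Sum>i\<in>F. fst (f i))"
  by (induction F rule: infinite_finite_induct) auto

lemma snd_sum: "snd (\<Sum>i\<in>F. f i) = (\<Sum>i\<in>F. snd (f i))"
  by (induction F rule: infinite_finite_induct) auto

lemma fst_scaleC: "fst (c *\<^sub>C x) = c *\<^sub>C fst x"
  by (simp add: scaleC_prod_def)

lemma snd_scaleC: "snd (c *\<^sub>C x) = c *\<^sub>C snd x"
  by (simp add: scaleC_prod_def)

lemma tensor_sum_carrier: "tensor_sum n F a x \<in> carrier_mat n n"
  by (simp add: tensor_sum_def)

lemma row_sq_tensor_sum:
  "row_sq n (tensor_sum n F a x) v = (\<Sum>m<n. (norm (\<Sum>i\<in>F. vec_mat_entry n (a i) v m *\<^sub>C fst (x i)))\<^sup>2)"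
proof -
  have "(\<Sum>k<n. v k *\<^sub>C fst (tensor_sum n F a x $$ (k, m))) = (\<Sum>i\<in>F. vec_mat_entry n (a i) v m *\<^sub>C fst (x i))"
    if "m < n" for m
  proof -
    have "(\<Sum>k<n. v k *\<^sub>C fst (tensor_sum n F a x $$ (k, m)))
        = (\<Sum>k<n. \<Sum>i\<in>F. (v k * a i $$ (k, m)) *\<^sub>C fst (x i))"
      using that by (intro sum.cong refl)
        (simp add: tensor_sum_def fst_sum fst_scaleC cvs.scale_sum_right)
    also have "\<dots> = (\<Sum>i\<in>F. vec_mat_entry n (a i) v m *\<^sub>C fst (x i))"
      by (subst sum.swap) (simp add: vec_mat_entry_def cvs.scale_sum_left)
    finally show ?thesis .
  qed
  then show ?thesis by (simp add: row_sq_def)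
qed

lemma col_sq_tensor_sum:
  "col_sq n (tensor_sum n F a x) v = (\<Sum>m<n. (norm (\<Sum>i\<in>F. mat_vec_entry n (a i) v m *\<^sub>C snd (x i)))\<^sup>2)"
proof -
  have "(\<Sum>k<n. v k *\<^sub>C snd (tensor_sum n F a x $$ (m, k))) = (\<Sum>i\<in>F. mat_vec_entry n (a i) v m *\<^sub>C snd (x i))"
    if "m < n" for m
  proof -
    have "(\<Sum>k<n. v k *\<^sub>C snd (tensor_sum n F a x $$ (m, k)))
        = (\<Sum>k<n. \<Sum>i\<in>F. (v k * a i $$ (m, k)) *\<^sub>C snd (x i))"
      using that by (intro sum.cong refl)
        (simp add: tensor_sum_def snd_sum snd_scaleC cvs.scale_sum_right)
    also have "\<dots> = (\<Sum>i\<in>F. mat_vec_entry n (a i) v m *\<^sub>C snd (x i))"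
      by (subst sum.swap) (simp add: mat_vec_entry_def cvs.scale_sum_left)
    finally show ?thesis .
  qed
  then show ?thesis by (simp add: col_sq_def)
qed

lemma mat_vec_entry_smult: "a \<in> carrier_mat n n \<Longrightarrow> m < n \<Longrightarrow> mat_vec_entry n (c \<cdot>\<^sub>m a) v m = c * mat_vec_entry n a v m"
  by (simp add: mat_vec_entry_def sum_distrib_left mult.left_commute)

lemma vec_mat_entry_smult: "a \<in> carrier_mat n n \<Longrightarrow> m < n \<Longrightarrow> vec_mat_entry n (c \<cdot>\<^sub>m a) v m = c * vec_mat_entry n a v m"
  by (simp add: vec_mat_entry_def sum_distrib_left mult.left_commute)

lemma opsp_norm_1x1: "opsp_norm (mat 1 1 (\<lambda>_. z)) = max (norm (fst z)) (norm (snd z))"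
proof -
  have scaled: "(\<forall>v :: nat \<Rightarrow> complex. (cmod (v 0) * t)\<^sup>2 \<le> (B * cmod (v 0))\<^sup>2) \<longleftrightarrow> t \<le> B"
    if "0 \<le> B" "0 \<le> t" for B t
  proof
    assume "\<forall>v :: nat \<Rightarrow> complex. (cmod (v 0) * t)\<^sup>2 \<le> (B * cmod (v 0))\<^sup>2"
    from this[THEN spec, of "\<lambda>_. 1"] show "t \<le> B"
      using that by (simp add: power2_le_iff_abs_le)
  next
    assume "t \<le> B"
    then show "\<forall>v :: nat \<Rightarrow> complex. (cmod (v 0) * t)\<^sup>2 \<le> (B * cmod (v 0))\<^sup>2"
      using that by (intro allI power_mono) (auto simp: mult.commute[of B] mult_left_mono)
  qed
  have iff: "opsp_norm (mat 1 1 (\<lambda>_. z)) \<le> B \<longleftrightarrow> max (norm (fst z)) (norm (snd z)) \<le> B" if "0 \<le> B" for B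
  proof -
    have "opsp_norm (mat 1 1 (\<lambda>_. z)) \<le> B \<longleftrightarrow>
        (\<forall>v :: nat \<Rightarrow> complex. (cmod (v 0) * norm (fst z))\<^sup>2 \<le> (B * cmod (v 0))\<^sup>2) \<and>
        (\<forall>v :: nat \<Rightarrow> complex. (cmod (v 0) * norm (snd z))\<^sup>2 \<le> (B * cmod (v 0))\<^sup>2)"
      using that by (subst opsp_norm_le_iff[where n = 1])
        (simp_all add: row_sq_def col_sq_def vec_norm_sq_def norm_scaleC power_mult_distrib)
    then show ?thesis by (simp only: scaled[OF that norm_ge_zero] max.bounded_iff)
  qed
  have "0 \<le> opsp_norm (mat 1 1 (\<lambda>_. z))" by (rule opsp_norm_nonneg[where n = 1]) simp
  moreover have "0 \<le> max (norm (fst z)) (norm (snd z))" by (simp add: le_max_iff_disj)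
  ultimately show ?thesis
    using iff[THEN iffD1, OF _ order_refl] iff[THEN iffD2, OF _ order_refl] by (simp only: order_antisym)
qed

definition linear_contraction :: "(ell2 \<Rightarrow> ell2) \<Rightarrow> bool" where
  "linear_contraction A \<longleftrightarrow> clinear_on UNIV A \<and> (\<forall>x. norm (A x) \<le> norm x)"

lemma clinear_add: "clinear_on UNIV A \<Longrightarrow> A (x + y) = A x + A y"
  and clinear_scaleC: "clinear_on UNIV A \<Longrightarrow> A (c *\<^sub>C x) = c *\<^sub>C A x"
  by (auto simp: clinear_on_def)

lemma clinear_zero: "clinear_on UNIV A \<Longrightarrow> A 0 = 0"
  by (metis clinear_scaleC cvs.scale_zero_left)

lemma clinear_sum: "clinear_on UNIV A \<Longrightarrow> A (\<Sum>i\<in>F. f i) = (\<Sum>i\<in>F. A (f i))"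
  by (induction F rule: infinite_finite_induct) (simp_all add: clinear_zero clinear_add)

lemma X_space_snd: "z \<in> X_space Y A \<Longrightarrow> snd z = A (fst z)"
  by (auto simp: X_space_def)

lemma graph_combination:
  assumes A: "clinear_on UNIV A" and x: "\<And>i. i \<in> F \<Longrightarrow> x i \<in> X_space UNIV A"
  shows "(\<Sum>i\<in>F. \<alpha> i *\<^sub>C snd (x i)) = A (\<Sum>i\<in>F. \<alpha> i *\<^sub>C fst (x i))"
  unfolding clinear_sum[OF A] clinear_scaleC[OF A]
  by (intro sum.cong refl) (simp add: X_space_snd[OF x])

text \<open>In \<open>M\<^sub>1(X(A))\<close> the row norm dominates, \<open>A\<close> being a contraction, so there complete unconditionality is
unconditionality in the Hilbert space.\<close>

lemma completely_unconditional_norm: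
  assumes A: "linear_contraction A" and cu: "completely_unconditional C I x"
    and x: "\<And>i. i \<in> I \<Longrightarrow> x i \<in> X_space UNIV A"
    and F: "finite F" "F \<subseteq> I" and \<mu>: "\<And>i. i \<in> F \<Longrightarrow> cmod (\<mu> i) \<le> 1"
  shows "norm (\<Sum>i\<in>F. (\<mu> i * \<alpha> i) *\<^sub>C fst (x i)) \<le> C * norm (\<Sum>i\<in>F. \<alpha> i *\<^sub>C fst (x i))"
proof -
  have eq: "opsp_norm (tensor_sum 1 F (\<lambda>i. mat 1 1 (\<lambda>_. \<beta> i)) x) = norm (\<Sum>i\<in>F. \<beta> i *\<^sub>C fst (x i))"
    for \<beta>
  proof -
    have "norm (\<Sum>i\<in>F. \<beta> i *\<^sub>C snd (x i)) \<le> norm (\<Sum>i\<in>F. \<beta> i *\<^sub>C fst (x i))"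
      using A graph_combination[of A F x \<beta>, OF _ x] subsetD[OF F(2)] unfolding linear_contraction_def by auto
    moreover have "tensor_sum 1 F (\<lambda>i. mat 1 1 (\<lambda>_. \<beta> i)) x = mat 1 1 (\<lambda>_. \<Sum>i\<in>F. \<beta> i *\<^sub>C x i)"
      unfolding tensor_sum_def by (intro eq_matI) auto
    ultimately show ?thesis
      by (simp add: opsp_norm_1x1[simplified] max_absorb1 fst_sum snd_sum fst_scaleC snd_scaleC)
  qed
  have "opsp_norm (tensor_sum 1 F (\<lambda>i. \<mu> i \<cdot>\<^sub>m mat 1 1 (\<lambda>_. \<alpha> i)) x)
      \<le> C * opsp_norm (tensor_sum 1 F (\<lambda>i. mat 1 1 (\<lambda>_. \<alpha> i)) x)"
    using cu F \<mu> unfolding completely_unconditional_def by auto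
  moreover have "(\<lambda>i. \<mu> i \<cdot>\<^sub>m mat 1 1 (\<lambda>_. \<alpha> i)) = (\<lambda>i. mat 1 1 (\<lambda>_. \<mu> i * \<alpha> i))"
    by (intro ext eq_matI) auto
  ultimately show ?thesis by (simp only: eq)
qed

text \<open>Normalization is asked of the first components only: in \<open>X(A)\<close> these carry the norm of a vector, as \<open>A\<close>
is a contraction.\<close>

locale cu_family =
  fixes A :: "ell2 \<Rightarrow> ell2" and C :: real and I :: "'i set" and x :: "'i \<Rightarrow> ell2 \<times> ell2"
  assumes A: "linear_contraction A" and C: "1 \<le> C" and cu: "completely_unconditional C I x"
    and x: "\<And>i. i \<in> I \<Longrightarrow> x i \<in> X_space UNIV A"
    and nx: "\<And>i. i \<in> I \<Longrightarrow> norm (fst (x i)) = 1"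
begin

lemma riesz_lower:
  assumes F: "finite F" "F \<subseteq> I"
  shows "(\<Sum>i\<in>F. (cmod (\<alpha> i))\<^sup>2) \<le> C\<^sup>2 * (norm (\<Sum>i\<in>F. \<alpha> i *\<^sub>C fst (x i)))\<^sup>2"
proof -
  obtain \<epsilon> where \<epsilon>: "\<And>i. \<epsilon> i = 1 \<or> \<epsilon> i = (- 1 :: complex)"
    "(\<Sum>i\<in>F. \<Sum>m\<in>{()}. (norm (\<alpha> i *\<^sub>C fst (x i)))\<^sup>2)
      \<le> (\<Sum>m\<in>{()}. (norm (\<Sum>i\<in>F. \<epsilon> i *\<^sub>C \<alpha> i *\<^sub>C fst (x i)))\<^sup>2)"
    using exists_signs_ge[OF F(1), of "\<lambda>i m. \<alpha> i *\<^sub>C fst (x i)" "{()}"] by blast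
  have "(\<Sum>i\<in>F. (cmod (\<alpha> i))\<^sup>2) = (\<Sum>i\<in>F. (norm (\<alpha> i *\<^sub>C fst (x i)))\<^sup>2)"
    using F(2) nx by (intro sum.cong) (auto simp: norm_scaleC)
  also have "\<dots> \<le> (norm (\<Sum>i\<in>F. (\<epsilon> i * \<alpha> i) *\<^sub>C fst (x i)))\<^sup>2"
    using \<epsilon>(2) by (simp add: scaleC_scaleC)
  also have "\<dots> \<le> (C * norm (\<Sum>i\<in>F. \<alpha> i *\<^sub>C fst (x i)))\<^sup>2"
    using \<epsilon>(1) by (intro power_mono completely_unconditional_norm[OF A cu x F])
      (auto, metis norm_minus_cancel norm_one order_refl)
  finally show ?thesis by (simp add: power_mult_distrib)
qed

lemma riesz_upper:
  assumes F: "finite F" "F \<subseteq> I"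
  shows "(norm (\<Sum>i\<in>F. \<alpha> i *\<^sub>C fst (x i)))\<^sup>2 \<le> C\<^sup>2 * (\<Sum>i\<in>F. (cmod (\<alpha> i))\<^sup>2)"
proof -
  obtain \<epsilon> where \<epsilon>: "\<And>i. \<epsilon> i = 1 \<or> \<epsilon> i = (- 1 :: complex)"
    "(\<Sum>m\<in>{()}. (norm (\<Sum>i\<in>F. \<epsilon> i *\<^sub>C \<alpha> i *\<^sub>C fst (x i)))\<^sup>2)
      \<le> (\<Sum>i\<in>F. \<Sum>m\<in>{()}. (norm (\<alpha> i *\<^sub>C fst (x i)))\<^sup>2)"
    using exists_signs_le[OF F(1), of "\<lambda>i m. \<alpha> i *\<^sub>C fst (x i)" "{()}"] by blast
  have "\<epsilon> i * (\<epsilon> i * \<alpha> i) = \<alpha> i" for i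
    using \<epsilon>(1)[of i] by auto
  then have "norm (\<Sum>i\<in>F. \<alpha> i *\<^sub>C fst (x i)) = norm (\<Sum>i\<in>F. (\<epsilon> i * (\<epsilon> i * \<alpha> i)) *\<^sub>C fst (x i))"
    by (simp only:)
  also have "\<dots> \<le> C * norm (\<Sum>i\<in>F. (\<epsilon> i * \<alpha> i) *\<^sub>C fst (x i))"
    using \<epsilon>(1) by (intro completely_unconditional_norm[OF A cu x F])
      (auto, metis norm_minus_cancel norm_one order_refl)
  finally have "(norm (\<Sum>i\<in>F. \<alpha> i *\<^sub>C fst (x i)))\<^sup>2
      \<le> (C * norm (\<Sum>i\<in>F. (\<epsilon> i * \<alpha> i) *\<^sub>C fst (x i)))\<^sup>2"
    by (rule power_mono) simp
  also have "\<dots> \<le> C\<^sup>2 * (\<Sum>i\<in>F. (norm (\<alpha> i *\<^sub>C fst (x i)))\<^sup>2)"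
    unfolding power_mult_distrib using \<epsilon>(2) by (intro mult_left_mono) (simp_all add: scaleC_scaleC)
  also have "(\<Sum>i\<in>F. (norm (\<alpha> i *\<^sub>C fst (x i)))\<^sup>2) = (\<Sum>i\<in>F. (cmod (\<alpha> i))\<^sup>2)"
    using F(2) nx by (intro sum.cong) (auto simp: norm_scaleC)
  finally show ?thesis .
qed

text \<open>Riesz sequences satisfy Bessel's inequality by duality: the bound comes from the coordinate \<open>k\<close> of the
combination whose coefficients are the conjugates of the coordinates in question.\<close>

lemma bessel:
  assumes F: "finite F" "F \<subseteq> I"
  shows "(\<Sum>i\<in>F. (cmod (coord (fst (x i)) k))\<^sup>2) \<le> C\<^sup>2"
proof -
  define q where "q = (\<Sum>i\<in>F. (cmod (coord (fst (x i)) k))\<^sup>2)"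
  define z where "z = (\<Sum>i\<in>F. cnj (coord (fst (x i)) k) *\<^sub>C fst (x i))"
  have "0 \<le> q" by (simp add: q_def sum_nonneg)
  have coord_sum: "coord (sum f F) k = (\<Sum>i\<in>F. coord (f i) k)" for f
    using F(1) by induction auto
  have "coord z k = (\<Sum>i\<in>F. coord (fst (x i)) k * cnj (coord (fst (x i)) k))"
    by (simp add: z_def coord_sum mult.commute)
  also have "\<dots> = complex_of_real q"
    unfolding q_def of_real_sum by (intro sum.cong refl) (simp only: complex_norm_square)
  finally have "q \<le> norm z"
    using norm_coord_le[of z k] \<open>0 \<le> q\<close> by simp
  then have "q\<^sup>2 \<le> (norm z)\<^sup>2" using \<open>0 \<le> q\<close> by (intro power_mono) auto
  also have "\<dots> \<le> C\<^sup>2 * q"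
    using riesz_upper[OF F, of "\<lambda>i. cnj (coord (fst (x i)) k)"] by (simp add: q_def z_def)
  finally have "q * q \<le> C\<^sup>2 * q" by (simp add: power2_eq_square)
  then show ?thesis
    using \<open>0 \<le> q\<close> unfolding q_def[symmetric] by (cases "q = 0") (auto simp: mult_le_cancel_right)
qed

text \<open>The square of the norm of the diagonal model, at a fixed vector \<open>v\<close>, is an average over signs of values
for the given family.\<close>

lemma lower_estimate:
  assumes F: "finite F" "F \<subseteq> I" and a: "\<And>i. i \<in> F \<Longrightarrow> a i \<in> carrier_mat n n"
  defines "\<rho> \<equiv> opsp_norm (tensor_sum n F a x)"
  shows "(\<Sum>m<n. \<Sum>i\<in>F. (cmod (vec_mat_entry n (a i) v m))\<^sup>2) \<le> (C * \<rho>)\<^sup>2 * vec_norm_sq n v"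
    and "(\<Sum>m<n. \<Sum>i\<in>F. (cmod (mat_vec_entry n (a i) v m) * norm (snd (x i)))\<^sup>2) \<le> (C * \<rho>)\<^sup>2 * vec_norm_sq n v"
proof -
  have "0 \<le> \<rho>" unfolding \<rho>_def by (rule opsp_norm_nonneg[OF tensor_sum_carrier])
  have "(\<Sum>m<n. \<Sum>i\<in>F. (cmod (vec_mat_entry n (a i) v m))\<^sup>2)
      \<le> (\<Sum>m<n. C\<^sup>2 * (norm (\<Sum>i\<in>F. vec_mat_entry n (a i) v m *\<^sub>C fst (x i)))\<^sup>2)"
    by (intro sum_mono riesz_lower F)
  also have "\<dots> = C\<^sup>2 * row_sq n (tensor_sum n F a x) v"
    by (simp add: row_sq_tensor_sum sum_distrib_left)
  also have "\<dots> \<le> C\<^sup>2 * (\<rho>\<^sup>2 * vec_norm_sq n v)"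
    using opsp_norm_le_iff[OF tensor_sum_carrier \<open>0 \<le> \<rho>\<close>, of n F a x]
    by (intro mult_left_mono) (auto simp: \<rho>_def)
  finally show "(\<Sum>m<n. \<Sum>i\<in>F. (cmod (vec_mat_entry n (a i) v m))\<^sup>2) \<le> (C * \<rho>)\<^sup>2 * vec_norm_sq n v"
    by (simp add: power_mult_distrib)
  obtain \<epsilon> where \<epsilon>: "\<And>i. \<epsilon> i = 1 \<or> \<epsilon> i = (- 1 :: complex)"
    "(\<Sum>i\<in>F. \<Sum>m<n. (norm (mat_vec_entry n (a i) v m *\<^sub>C snd (x i)))\<^sup>2)
      \<le> (\<Sum>m<n. (norm (\<Sum>i\<in>F. \<epsilon> i *\<^sub>C mat_vec_entry n (a i) v m *\<^sub>C snd (x i)))\<^sup>2)"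
    using exists_signs_ge[OF F(1), of "\<lambda>i m. mat_vec_entry n (a i) v m *\<^sub>C snd (x i)" "{..<n}"] by blast
  have \<epsilon>1: "cmod (\<epsilon> i) \<le> 1" for i using \<epsilon>(1)[of i] by auto
  have "(\<Sum>m<n. \<Sum>i\<in>F. (cmod (mat_vec_entry n (a i) v m) * norm (snd (x i)))\<^sup>2)
      = (\<Sum>i\<in>F. \<Sum>m<n. (norm (mat_vec_entry n (a i) v m *\<^sub>C snd (x i)))\<^sup>2)"
    by (subst sum.swap) (simp add: norm_scaleC)
  also have "\<dots> \<le> col_sq n (tensor_sum n F (\<lambda>i. \<epsilon> i \<cdot>\<^sub>m a i) x) v"
    using \<epsilon>(2) a by (simp add: col_sq_tensor_sum mat_vec_entry_smult scaleC_scaleC)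
  also have "\<dots> \<le> (C * \<rho>)\<^sup>2 * vec_norm_sq n v"
  proof -
    have "opsp_norm (tensor_sum n F (\<lambda>i. \<epsilon> i \<cdot>\<^sub>m a i) x) \<le> C * \<rho>"
      using cu F a \<epsilon>1 unfolding completely_unconditional_def \<rho>_def by auto
    then show ?thesis
      using opsp_norm_le_iff[OF tensor_sum_carrier, of "C * \<rho>" n F "\<lambda>i. \<epsilon> i \<cdot>\<^sub>m a i" x] C \<open>0 \<le> \<rho>\<close> by auto
  qed
  finally show "(\<Sum>m<n. \<Sum>i\<in>F. (cmod (mat_vec_entry n (a i) v m) * norm (snd (x i)))\<^sup>2)
      \<le> (C * \<rho>)\<^sup>2 * vec_norm_sq n v" .
qed

text \<open>The row part is the Riesz inequality. In the column part \<open>v\<close> is fixed and \<open>a i\<close> is replaced by the matrix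
\<open>b i\<close> with the single non-zero column \<open>a i v\<close>. For suitable signs the column norm of
\<open>\<Sum>i. \<epsilon> i b i \<otimes> x i\<close> is at most that of the diagonal model, and its row norm is controlled by the Riesz
inequality; complete unconditionality then removes the signs.\<close>

lemma upper_estimate:
  assumes F: "finite F" "F \<subseteq> I" and a: "\<And>i. i \<in> F \<Longrightarrow> a i \<in> carrier_mat n n" and "0 \<le> \<rho>"
    and row: "\<And>v. (\<Sum>m<n. \<Sum>i\<in>F. (cmod (vec_mat_entry n (a i) v m))\<^sup>2) \<le> \<rho>\<^sup>2 * vec_norm_sq n v"
    and col: "\<And>v. (\<Sum>m<n. \<Sum>i\<in>F. (cmod (mat_vec_entry n (a i) v m) * norm (snd (x i)))\<^sup>2) \<le> \<rho>\<^sup>2 * vec_norm_sq n v"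
  shows "opsp_norm (tensor_sum n F a x) \<le> C\<^sup>2 * \<rho>"
proof -
  have "C \<le> C\<^sup>2" using C by (simp add: self_le_power)
  have "row_sq n (tensor_sum n F a x) v \<le> (C\<^sup>2 * \<rho>)\<^sup>2 * vec_norm_sq n v" for v
  proof -
    have "row_sq n (tensor_sum n F a x) v \<le> (\<Sum>m<n. C\<^sup>2 * (\<Sum>i\<in>F. (cmod (vec_mat_entry n (a i) v m))\<^sup>2))"
      unfolding row_sq_tensor_sum by (intro sum_mono riesz_upper F)
    also have "\<dots> \<le> C\<^sup>2 * (\<rho>\<^sup>2 * vec_norm_sq n v)"
      unfolding sum_distrib_left[symmetric] by (intro mult_left_mono row) simp
    also have "\<dots> \<le> (C\<^sup>2)\<^sup>2 * (\<rho>\<^sup>2 * vec_norm_sq n v)"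
      using C \<open>C \<le> C\<^sup>2\<close> by (intro mult_right_mono power_mono) (auto simp: vec_norm_sq_nonneg)
    finally show ?thesis by (simp add: power_mult_distrib)
  qed
  moreover have "col_sq n (tensor_sum n F a x) v \<le> (C\<^sup>2 * \<rho>)\<^sup>2 * vec_norm_sq n v" for v
  proof (cases "n = 0")
    case True
    then show ?thesis by (simp add: col_sq_def vec_norm_sq_def)
  next
    case False
    then have n: "0 < n" by simp
    define w where "w i m = mat_vec_entry n (a i) v m" for i m
    define b where "b i = mat n n (\<lambda>(k, l). if l = 0 then w i k else 0)" for i
    have b: "b i \<in> carrier_mat n n" for i by (simp add: b_def)
    have mvb: "mat_vec_entry n (b i) u m = u 0 * w i m" if "m < n" for i u m
    proof -
      have "mat_vec_entry n (b i) u m = (\<Sum>k<n. if k = 0 then u k * w i m else 0)"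
        unfolding mat_vec_entry_def b_def using that by (intro sum.cong) auto
      then show ?thesis using n by (simp add: sum.delta)
    qed
    have vmb: "vec_mat_entry n (b i) u m = (if m = 0 then \<Sum>k<n. u k * w i k else 0)" if "m < n" for i u m
      using that by (auto simp: vec_mat_entry_def b_def intro!: sum.neutral)
    obtain \<epsilon> where \<epsilon>: "\<And>i. \<epsilon> i = 1 \<or> \<epsilon> i = (- 1 :: complex)"
      "(\<Sum>m<n. (norm (\<Sum>i\<in>F. \<epsilon> i *\<^sub>C w i m *\<^sub>C snd (x i)))\<^sup>2)
        \<le> (\<Sum>i\<in>F. \<Sum>m<n. (norm (w i m *\<^sub>C snd (x i)))\<^sup>2)"
      using exists_signs_le[OF F(1), of "\<lambda>i m. w i m *\<^sub>C snd (x i)" "{..<n}"] by blast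
    have \<epsilon>1: "cmod (\<epsilon> i) = 1" for i using \<epsilon>(1)[of i] by auto
    have \<epsilon>2: "\<epsilon> i * (\<epsilon> i * z) = z" for i z using \<epsilon>(1)[of i] by auto
    define r where "r = sqrt (vec_norm_sq n v)"
    have r: "0 \<le> r" "r\<^sup>2 = vec_norm_sq n v" by (auto simp: r_def vec_norm_sq_nonneg)
    define t where "t = C * \<rho> * r"
    have t: "0 \<le> t" using C \<open>0 \<le> \<rho>\<close> r by (simp add: t_def)
    have u0: "(cmod (u 0))\<^sup>2 \<le> vec_norm_sq n u" for u
      using n unfolding vec_norm_sq_def by (intro member_le_sum) auto
    have "opsp_norm (tensor_sum n F (\<lambda>i. \<epsilon> i \<cdot>\<^sub>m b i) x) \<le> t"
    proof -
      have "row_sq n (tensor_sum n F (\<lambda>i. \<epsilon> i \<cdot>\<^sub>m b i) x) u \<le> t\<^sup>2 * vec_norm_sq n u" for u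
      proof -
        define p where "p i = (\<Sum>k<n. u k * w i k)" for i
        have "row_sq n (tensor_sum n F (\<lambda>i. \<epsilon> i \<cdot>\<^sub>m b i) x) u
            = (\<Sum>m<n. if m = 0 then (norm (\<Sum>i\<in>F. (\<epsilon> i * p i) *\<^sub>C fst (x i)))\<^sup>2 else 0)"
          unfolding row_sq_tensor_sum p_def by (intro sum.cong) (auto simp: vec_mat_entry_smult[OF b] vmb)
        also have "\<dots> = (norm (\<Sum>i\<in>F. (\<epsilon> i * p i) *\<^sub>C fst (x i)))\<^sup>2"
          using n by (simp add: sum.delta)
        also have "\<dots> \<le> C\<^sup>2 * (\<Sum>i\<in>F. (cmod (p i))\<^sup>2)"
          using riesz_upper[OF F, of "\<lambda>i. \<epsilon> i * p i"] by (simp add: norm_mult \<epsilon>1)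
        also have "\<dots> \<le> C\<^sup>2 * (\<Sum>i\<in>F. vec_norm_sq n v * (\<Sum>l<n. (cmod (vec_mat_entry n (a i) u l))\<^sup>2))"
        proof (intro mult_left_mono sum_mono)
          fix i
          \<comment> \<open>Both sides are \<open>u\<^sup>T a i v\<close>; Cauchy-Schwarz separates \<open>v\<close> from \<open>u\<^sup>T a i\<close>.\<close>
          have "p i = (\<Sum>k<n. \<Sum>l<n. v l * (u k * a i $$ (k, l)))"
            by (simp add: p_def w_def mat_vec_entry_def sum_distrib_left mult.left_commute)
          also have "\<dots> = (\<Sum>l<n. v l * vec_mat_entry n (a i) u l)"
            by (subst sum.swap) (simp add: vec_mat_entry_def sum_distrib_left)
          finally have "cmod (p i) \<le> (\<Sum>l<n. cmod (v l) * cmod (vec_mat_entry n (a i) u l))"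
            by (metis (mono_tags, lifting) norm_mult norm_sum sum.cong)
          also have "\<dots> \<le> sqrt (vec_norm_sq n v) * sqrt (\<Sum>l<n. (cmod (vec_mat_entry n (a i) u l))\<^sup>2)"
            unfolding vec_norm_sq_def by (rule sum_mult_le_sqrt) auto
          finally have "(cmod (p i))\<^sup>2 \<le> (sqrt (vec_norm_sq n v) * sqrt (\<Sum>l<n. (cmod (vec_mat_entry n (a i) u l))\<^sup>2))\<^sup>2"
            by (rule power_mono) simp
          then show "(cmod (p i))\<^sup>2 \<le> vec_norm_sq n v * (\<Sum>l<n. (cmod (vec_mat_entry n (a i) u l))\<^sup>2)"
            by (simp add: power_mult_distrib sum_nonneg vec_norm_sq_nonneg)
        qed simp
        also have "\<dots> = C\<^sup>2 * vec_norm_sq n v * (\<Sum>m<n. \<Sum>i\<in>F. (cmod (vec_mat_entry n (a i) u m))\<^sup>2)"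
          by (subst sum.swap) (simp add: sum_distrib_left[symmetric] mult.assoc)
        also have "\<dots> \<le> C\<^sup>2 * vec_norm_sq n v * (\<rho>\<^sup>2 * vec_norm_sq n u)"
          by (intro mult_left_mono row) (simp add: vec_norm_sq_nonneg)
        finally show ?thesis by (simp add: t_def power_mult_distrib r mult_ac)
      qed
      moreover have "col_sq n (tensor_sum n F (\<lambda>i. \<epsilon> i \<cdot>\<^sub>m b i) x) u \<le> t\<^sup>2 * vec_norm_sq n u" for u
      proof -
        have "col_sq n (tensor_sum n F (\<lambda>i. \<epsilon> i \<cdot>\<^sub>m b i) x) u
            = (\<Sum>m<n. (norm (u 0 *\<^sub>C (\<Sum>i\<in>F. \<epsilon> i *\<^sub>C w i m *\<^sub>C snd (x i))))\<^sup>2)"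
          unfolding col_sq_tensor_sum
          by (intro sum.cong) (auto simp: mat_vec_entry_smult[OF b] mvb cvs.scale_sum_right scaleC_scaleC mult_ac)
        also have "\<dots> = (cmod (u 0))\<^sup>2 * (\<Sum>m<n. (norm (\<Sum>i\<in>F. \<epsilon> i *\<^sub>C w i m *\<^sub>C snd (x i)))\<^sup>2)"
          by (simp add: norm_scaleC power_mult_distrib sum_distrib_left)
        also have "\<dots> \<le> (cmod (u 0))\<^sup>2 * (\<Sum>m<n. \<Sum>i\<in>F. (cmod (w i m) * norm (snd (x i)))\<^sup>2)"
          using \<epsilon>(2) by (subst sum.swap) (simp add: norm_scaleC mult_left_mono)
        also have "\<dots> \<le> (cmod (u 0))\<^sup>2 * (\<rho>\<^sup>2 * vec_norm_sq n v)"
          unfolding w_def by (intro mult_left_mono col) simp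
        also have "\<dots> \<le> vec_norm_sq n u * (\<rho>\<^sup>2 * vec_norm_sq n v)"
          by (intro mult_right_mono u0) (simp add: vec_norm_sq_nonneg)
        also have "\<dots> \<le> C\<^sup>2 * (vec_norm_sq n u * (\<rho>\<^sup>2 * vec_norm_sq n v))"
          using mult_right_mono[OF one_le_power[OF C, of 2], of "vec_norm_sq n u * (\<rho>\<^sup>2 * vec_norm_sq n v)"]
          by (simp add: vec_norm_sq_nonneg)
        finally show ?thesis by (simp add: t_def power_mult_distrib r mult_ac)
      qed
      ultimately show ?thesis
        by (subst opsp_norm_le_iff[OF tensor_sum_carrier t]) blast
    qed
    moreover have "opsp_norm (tensor_sum n F (\<lambda>i. \<epsilon> i \<cdot>\<^sub>m (\<epsilon> i \<cdot>\<^sub>m b i)) x)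
        \<le> C * opsp_norm (tensor_sum n F (\<lambda>i. \<epsilon> i \<cdot>\<^sub>m b i) x)"
      using cu[unfolded completely_unconditional_def, rule_format, of F "\<lambda>i. \<epsilon> i \<cdot>\<^sub>m b i" n \<epsilon>]
        F b \<epsilon>1 by auto
    moreover have "(\<lambda>i. \<epsilon> i \<cdot>\<^sub>m (\<epsilon> i \<cdot>\<^sub>m b i)) = b"
      by (intro ext eq_matI) (auto simp: \<epsilon>2)
    ultimately have "opsp_norm (tensor_sum n F b x) \<le> C * t"
      using C by (smt (verit) mult_left_mono)
    then have "col_sq n (tensor_sum n F b x) u \<le> (C * t)\<^sup>2 * vec_norm_sq n u" for u
      using opsp_norm_le_iff[OF tensor_sum_carrier, of "C * t" n F b x] C t by auto
    moreover have "vec_norm_sq n (\<lambda>k. if k = 0 then 1 else 0) = (\<Sum>k<n. if k = 0 then 1 else 0)"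
      unfolding vec_norm_sq_def by (intro sum.cong) auto
    then have "vec_norm_sq n (\<lambda>k. if k = 0 then 1 else 0) = 1" using n by (simp add: sum.delta)
    ultimately have "col_sq n (tensor_sum n F b x) (\<lambda>k. if k = 0 then 1 else 0) \<le> (C * t)\<^sup>2"
      by (metis mult.right_neutral)
    then have "(\<Sum>m<n. (norm (\<Sum>i\<in>F. w i m *\<^sub>C snd (x i)))\<^sup>2) \<le> (C * t)\<^sup>2"
      by (simp add: col_sq_tensor_sum mvb)
    moreover have "(C * t)\<^sup>2 = (C\<^sup>2 * \<rho>)\<^sup>2 * vec_norm_sq n v"
      unfolding r(2)[symmetric] t_def by (simp add: power2_eq_square mult_ac)
    ultimately show ?thesis
      unfolding col_sq_tensor_sum w_def by simp
  qed
  moreover have "0 \<le> C\<^sup>2 * \<rho>" using \<open>0 \<le> \<rho>\<close> by simp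
  ultimately show ?thesis
    by (subst opsp_norm_le_iff[OF tensor_sum_carrier]) blast+
qed

end

section \<open>Equivalence of families from estimates on finite sums\<close>

text \<open>The entries of \<open>Z\<close> are combinations over different finite sets of indices; extended by zero they have a
common one, and the coefficients form the matrices \<open>a i\<close>.\<close>

lemma mats_over_span:
  fixes f :: "'i \<Rightarrow> 'a::complex_space"
  assumes Z: "Z \<in> mats_over n (cvs.span (f ` I))"
  shows "\<exists>F a. finite F \<and> F \<subseteq> I \<and> (\<forall>i\<in>F. a i \<in> carrier_mat n n) \<and> Z = tensor_sum n F a f"
proof -
  have repr: "\<exists>F c. finite F \<and> F \<subseteq> I \<and> z = (\<Sum>i\<in>F. c i *\<^sub>C f i)" if "z \<in> cvs.span (f ` I)" for z
    using that
  proof (induction rule: cvs.span_induct_alt)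
    case base
    show ?case by (intro exI[of _ "{}"]) simp
  next
    case (step c b z)
    then obtain F d where F: "finite F" "F \<subseteq> I" "z = (\<Sum>i\<in>F. d i *\<^sub>C f i)" by blast
    obtain j where j: "j \<in> I" "b = f j" using step by blast
    define d' where "d' i = (if i \<in> F then d i else 0) + (if i = j then c else 0)" for i
    have "(\<Sum>i\<in>insert j F. d' i *\<^sub>C f i)
        = (\<Sum>i\<in>insert j F. (if i \<in> F then d i else 0) *\<^sub>C f i)
          + (\<Sum>i\<in>insert j F. (if i = j then c else 0) *\<^sub>C f i)"
      unfolding d'_def scaleC_add_left by (rule sum.distrib)
    also have "(\<Sum>i\<in>insert j F. (if i \<in> F then d i else 0) *\<^sub>C f i) = z"
      unfolding F(3) using F(1) by (intro sum.mono_neutral_cong_right) auto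
    also have "(\<Sum>i\<in>insert j F. (if i = j then c else 0) *\<^sub>C f i) = c *\<^sub>C b"
      using F(1) j by (simp add: if_distrib[of "\<lambda>s. s *\<^sub>C _"] sum.delta cong: if_cong)
    finally show ?case
      using F j by (intro exI[of _ "insert j F"] exI[of _ d']) (auto simp: add.commute)
  qed
  define S where "S = cvs.span (f ` I)"
  have "\<forall>z. \<exists>p. z \<in> S \<longrightarrow>
      finite (fst p) \<and> fst p \<subseteq> I \<and> z = (\<Sum>i\<in>fst p. snd p i *\<^sub>C f i)"
    using repr unfolding S_def by fastforce
  from choice[OF this] obtain g where g: "\<And>z. z \<in> S \<Longrightarrow>
      finite (fst (g z)) \<and> fst (g z) \<subseteq> I \<and> z = (\<Sum>i\<in>fst (g z). snd (g z) i *\<^sub>C f i)"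
    by blast
  define F where "F k l = fst (g (Z $$ (k, l)))" for k l
  define c where "c k l = snd (g (Z $$ (k, l)))" for k l
  have Fc: "finite (F k l) \<and> F k l \<subseteq> I \<and> Z $$ (k, l) = (\<Sum>i\<in>F k l. c k l i *\<^sub>C f i)"
    if "k < n" "l < n" for k l
    unfolding F_def c_def using Z that by (intro g) (auto simp: mats_over_def S_def)
  define U where "U = (\<Union>k\<in>{..<n}. \<Union>l\<in>{..<n}. F k l)"
  define a where "a i = mat n n (\<lambda>(k, l). if i \<in> F k l then c k l i else 0)" for i
  have U: "finite U" "U \<subseteq> I" using Fc by (auto simp: U_def)
  have "Z = tensor_sum n U a f"
  proof (rule eq_matI)
    fix k l assume "k < dim_row (tensor_sum n U a f)" "l < dim_col (tensor_sum n U a f)"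
    then have kl: "k < n" "l < n" by (auto simp: tensor_sum_def)
    have "F k l \<subseteq> U" using kl by (auto simp: U_def)
    then show "Z $$ (k, l) = tensor_sum n U a f $$ (k, l)"
      using Fc[OF kl] kl U(1)
      by (auto simp: tensor_sum_def a_def intro!: sum.mono_neutral_cong_left)
  qed (use Z in \<open>auto simp: tensor_sum_def mats_over_def\<close>)
  then show ?thesis
    using U by (intro exI[of _ U] exI[of _ a]) (auto simp: a_def)
qed

lemma norm_fst_snd_le: "norm (fst z) \<le> norm z" "norm (snd z) \<le> norm z"
  for z :: "'a::real_normed_vector \<times> 'b::real_normed_vector"
  by (metis norm_fst_le prod.collapse, metis norm_snd_le prod.collapse)

lemma row_col_sq_triangle:
  assumes "z \<in> carrier_mat n n" "z' \<in> carrier_mat n n"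
    and e: "\<And>k l. k < n \<Longrightarrow> l < n \<Longrightarrow> norm (z' $$ (k, l) - z $$ (k, l)) \<le> e" and "0 \<le> e"
  shows "sqrt (row_sq n z' v) \<le> sqrt (row_sq n z v) + n * e * sqrt (vec_norm_sq n v)"
    and "sqrt (col_sq n z' v) \<le> sqrt (col_sq n z v) + n * e * sqrt (vec_norm_sq n v)"
proof -
  have main: "sqrt (\<Sum>m<n. (norm (\<Sum>k<n. v k *\<^sub>C g' m k))\<^sup>2)
      \<le> sqrt (\<Sum>m<n. (norm (\<Sum>k<n. v k *\<^sub>C g m k))\<^sup>2) + n * e * sqrt (vec_norm_sq n v)"
    if g: "\<And>m k. m < n \<Longrightarrow> k < n \<Longrightarrow> norm (g' m k - g m k) \<le> e" for g g' :: "nat \<Rightarrow> nat \<Rightarrow> ell2"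
  proof -
    define p where "p h m = (\<Sum>k<n. v k *\<^sub>C h m k)" for h :: "nat \<Rightarrow> nat \<Rightarrow> ell2" and m
    define d where "d m k = g' m k - g m k" for m k
    have "p g' m = p g m + p d m" for m
      unfolding p_def d_def sum.distrib[symmetric] scaleC_add_right[symmetric] by simp
    then have "norm (p g' m) \<le> norm (p g m) + norm (p d m)" for m
      by (simp add: norm_triangle_ineq)
    then have "L2_set (\<lambda>m. norm (p g' m)) {..<n} \<le> L2_set (\<lambda>m. norm (p g m) + norm (p d m)) {..<n}"
      by (intro L2_set_mono) auto
    also have "\<dots> \<le> L2_set (\<lambda>m. norm (p g m)) {..<n} + L2_set (\<lambda>m. norm (p d m)) {..<n}"
      by (rule L2_set_triangle_ineq)
    also have "L2_set (\<lambda>m. norm (p d m)) {..<n} \<le> n * e * sqrt (vec_norm_sq n v)"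
    proof -
      have "(\<Sum>m<n. (norm (p d m))\<^sup>2) \<le> (\<Sum>m<n. (\<Sum>k<n. (norm (d m k))\<^sup>2) * vec_norm_sq n v)"
        unfolding p_def by (intro sum_mono norm_combination_sq_le)
      also have "\<dots> \<le> (\<Sum>m<n. (\<Sum>k<n. e\<^sup>2) * vec_norm_sq n v)"
        using g by (intro sum_mono mult_right_mono power_mono) (auto simp: d_def vec_norm_sq_nonneg)
      also have "\<dots> = (n * e)\<^sup>2 * vec_norm_sq n v"
        by (simp add: power2_eq_square)
      finally have "sqrt (\<Sum>m<n. (norm (p d m))\<^sup>2) \<le> sqrt ((n * e)\<^sup>2 * vec_norm_sq n v)"
        by (rule real_sqrt_le_mono)
      then show ?thesis using \<open>0 \<le> e\<close> by (simp add: L2_set_def real_sqrt_mult)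
    qed
    finally show ?thesis by (simp add: L2_set_def p_def)
  qed
  have "norm (fst (z' $$ (k, l)) - fst (z $$ (k, l))) \<le> e"
    "norm (snd (z' $$ (k, l)) - snd (z $$ (k, l))) \<le> e" if "k < n" "l < n" for k l
    using e[OF that] norm_fst_snd_le[of "z' $$ (k, l) - z $$ (k, l)"] by auto
  then show "sqrt (row_sq n z' v) \<le> sqrt (row_sq n z v) + n * e * sqrt (vec_norm_sq n v)"
    "sqrt (col_sq n z' v) \<le> sqrt (col_sq n z v) + n * e * sqrt (vec_norm_sq n v)"
    unfolding row_sq_def col_sq_def by (intro main; simp)+
qed

lemma opsp_norm_close:
  assumes z: "z \<in> carrier_mat n n" "z' \<in> carrier_mat n n"
    and e: "\<And>k l. k < n \<Longrightarrow> l < n \<Longrightarrow> norm (z' $$ (k, l) - z $$ (k, l)) \<le> e" and "0 \<le> e"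
  shows "opsp_norm z' \<le> opsp_norm z + n * e"
proof -
  define B where "B = opsp_norm z"
  have B: "0 \<le> B" unfolding B_def by (rule opsp_norm_nonneg[OF z(1)])
  have le: "t' \<le> (B + n * e)\<^sup>2 * vec_norm_sq n v"
    if "0 \<le> t'" "sqrt t' \<le> sqrt t + n * e * sqrt (vec_norm_sq n v)" "t \<le> B\<^sup>2 * vec_norm_sq n v" for t t' v
  proof -
    have "sqrt t \<le> B * sqrt (vec_norm_sq n v)"
      using real_sqrt_le_mono[OF that(3)] B by (simp add: real_sqrt_mult)
    then have "sqrt t' \<le> (B + n * e) * sqrt (vec_norm_sq n v)"
      using that(2) by (simp add: algebra_simps)
    then have "(sqrt t')\<^sup>2 \<le> ((B + n * e) * sqrt (vec_norm_sq n v))\<^sup>2"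
      using \<open>0 \<le> t'\<close> by (intro power_mono) auto
    then show ?thesis using \<open>0 \<le> t'\<close> by (simp add: power_mult_distrib vec_norm_sq_nonneg)
  qed
  have zB: "row_sq n z v \<le> B\<^sup>2 * vec_norm_sq n v" "col_sq n z v \<le> B\<^sup>2 * vec_norm_sq n v" for v
    using opsp_norm_le_iff[OF z(1) B] by (auto simp: B_def)
  have "opsp_norm z' \<le> B + n * e"
    using B \<open>0 \<le> e\<close> le[OF _ row_col_sq_triangle(1)[OF z e \<open>0 \<le> e\<close>] zB(1)]
      le[OF _ row_col_sq_triangle(2)[OF z e \<open>0 \<le> e\<close>] zB(2)]
    by (subst opsp_norm_le_iff[OF z(2)]) (auto simp: row_sq_def col_sq_def sum_nonneg)
  then show ?thesis by (simp add: B_def)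
qed

text \<open>A matrix over pairs is a matrix together with its image under the linear relation \<open>G\<close>, so this
says that a completely bounded relation stays so on the closure.\<close>

lemma opsp_norm_le_closure:
  fixes G :: "((ell2 \<times> ell2) \<times> (ell2 \<times> ell2)) set"
  assumes "0 \<le> c"
    and G: "\<And>n Z. Z \<in> mats_over n G \<Longrightarrow> opsp_norm (map_mat snd Z) \<le> c * opsp_norm (map_mat fst Z)"
    and Z: "Z \<in> mats_over n (closure G)"
  shows "opsp_norm (map_mat snd Z) \<le> c * opsp_norm (map_mat fst Z)"
proof (rule field_le_epsilon)
  fix \<delta> :: real assume "0 < \<delta>"
  define e where "e = \<delta> / (n * (c + 1) + 1)"
  have d: "0 < n * (c + 1) + 1" using \<open>0 \<le> c\<close> by (simp add: add_nonneg_pos)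
  have e: "0 < e" using \<open>0 < \<delta>\<close> d by (simp add: e_def)
  have "\<forall>k l. \<exists>g. k < n \<longrightarrow> l < n \<longrightarrow> g \<in> G \<and> dist g (Z $$ (k, l)) < e"
    using Z e unfolding mats_over_def closure_approachable by fastforce
  then obtain g where g: "\<And>k l. k < n \<Longrightarrow> l < n \<Longrightarrow> g k l \<in> G \<and> dist (g k l) (Z $$ (k, l)) < e"
    by metis
  define W where "W = mat n n (\<lambda>(k, l). g k l)"
  have W: "W \<in> mats_over n G" using g by (simp add: W_def mats_over_def)
  have car: "Z \<in> carrier_mat n n" "W \<in> carrier_mat n n" using Z by (auto simp: mats_over_def W_def)
  have near: "norm (fst (W $$ (k, l)) - fst (Z $$ (k, l))) \<le> e"
    "norm (snd (W $$ (k, l)) - snd (Z $$ (k, l))) \<le> e" if "k < n" "l < n" for k l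
  proof -
    have "norm (W $$ (k, l) - Z $$ (k, l)) < e"
      using g[OF that] that by (simp add: W_def dist_norm)
    then show "norm (fst (W $$ (k, l)) - fst (Z $$ (k, l))) \<le> e"
      "norm (snd (W $$ (k, l)) - snd (Z $$ (k, l))) \<le> e"
      using norm_fst_snd_le[of "W $$ (k, l) - Z $$ (k, l)"] by auto
  qed
  have 1: "opsp_norm (map_mat snd Z) \<le> opsp_norm (map_mat snd W) + n * e"
    using car near e by (intro opsp_norm_close) (auto simp: norm_minus_commute)
  have 2: "opsp_norm (map_mat snd W) \<le> c * opsp_norm (map_mat fst W)"
    by (rule G[OF W])
  have 3: "opsp_norm (map_mat fst W) \<le> opsp_norm (map_mat fst Z) + n * e"
    using car near e by (intro opsp_norm_close) auto
  have "opsp_norm (map_mat snd Z) \<le> c * opsp_norm (map_mat fst Z) + n * (c + 1) * e"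
    using 1 2 mult_left_mono[OF 3 \<open>0 \<le> c\<close>] by (simp add: algebra_simps)
  also have "n * (c + 1) * e \<le> \<delta>"
    using \<open>0 < \<delta>\<close> d by (simp add: e_def divide_simps)
  finally show "opsp_norm (map_mat snd Z) \<le> c * opsp_norm (map_mat fst Z) + \<delta>" by simp
qed

lemma norm_le_opsp_norm:
  assumes "opsp_norm (mat 1 1 (\<lambda>_. w)) \<le> c * opsp_norm (mat 1 1 (\<lambda>_. z))" "0 \<le> c"
  shows "norm w \<le> 2 * c * norm (z :: ell2 \<times> ell2)"
proof -
  have "norm w \<le> norm (fst w) + norm (snd w)"
    by (metis norm_Pair_le prod.collapse)
  also have "\<dots> \<le> 2 * max (norm (fst w)) (norm (snd w))" by linarith
  also have "\<dots> \<le> 2 * (c * max (norm (fst z)) (norm (snd z)))"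
    using assms(1) unfolding opsp_norm_1x1 by simp
  also have "max (norm (fst z)) (norm (snd z)) \<le> norm z"
    by (metis max.bounded_iff norm_fst_le norm_snd_le prod.collapse)
  finally show ?thesis using assms(2) by (simp add: mult_left_mono)
qed

lemma continuous_scaleC_ell2: "continuous_on S (\<lambda>x. c *\<^sub>C f x)" if "continuous_on S f"
  for f :: "'t::topological_space \<Rightarrow> ell2"
proof -
  have "bounded_linear (\<lambda>x :: ell2. c *\<^sub>C x)"
    by (rule bounded_linear_intro[of _ "cmod c"])
      (simp_all add: scaleC_add_right norm_scaleC scaleR_scaleC scaleC_scaleC mult.commute)
  then show ?thesis using that by (rule bounded_linear.continuous_on)
qed

lemma continuous_scaleC_pair: "continuous_on S (\<lambda>x. c *\<^sub>C f x)" if "continuous_on S f"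
  for f :: "'t::topological_space \<Rightarrow> ell2 \<times> ell2"
  unfolding scaleC_prod_def using that
  by (intro continuous_on_Pair continuous_scaleC_ell2 continuous_on_fst continuous_on_snd)

lemma subspace_closure:
  fixes S :: "('a::{complex_space, real_normed_vector}) set"
  assumes S: "cvs.subspace S" and cont: "\<And>c. continuous_on UNIV (\<lambda>x :: 'a. c *\<^sub>C x)"
  shows "cvs.subspace (closure S)"
proof (rule cvs.subspaceI)
  show "0 \<in> closure S"
    using cvs.subspace_0[OF S] closure_subset by blast
  fix x y assume xy: "x \<in> closure S" "y \<in> closure S"
  have "(\<lambda>p. fst p + snd p) ` closure (S \<times> S) \<subseteq> closure S"
  proof (rule image_closure_subset)
    show "(\<lambda>p. fst p + snd p) ` (S \<times> S) \<subseteq> closure S"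
      using cvs.subspace_add[OF S] closure_subset by fastforce
  qed (auto intro!: continuous_intros)
  then show "x + y \<in> closure S"
    using xy unfolding closure_Times by force
  fix c
  have "(\<lambda>x. c *\<^sub>C x) ` closure S \<subseteq> closure S"
    using cvs.subspace_scale[OF S] closure_subset
    by (intro image_closure_subset continuous_on_subset[OF cont]) auto
  then show "c *\<^sub>C x \<in> closure S"
    using xy by blast
qed

text \<open>The map between closed spans that sends \<open>x i\<close> to \<open>y i\<close> is defined by its graph, the closed span of the
pairs: this makes well-definedness, extension to the closure and inversion symmetric matters.\<close>

definition pair_graph ::
  "'i set \<Rightarrow> ('i \<Rightarrow> ell2 \<times> ell2) \<Rightarrow> ('i \<Rightarrow> ell2 \<times> ell2) \<Rightarrow> ((ell2 \<times> ell2) \<times> (ell2 \<times> ell2)) set" where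
  "pair_graph I x y = closure (cvs.span ((\<lambda>i. (x i, y i)) ` I))"

definition dominates :: "real \<Rightarrow> 'i set \<Rightarrow> ('i \<Rightarrow> ell2 \<times> ell2) \<Rightarrow> ('i \<Rightarrow> ell2 \<times> ell2) \<Rightarrow> bool" where
  "dominates c I x y \<longleftrightarrow> (\<forall>n F a. finite F \<and> F \<subseteq> I \<and> (\<forall>i\<in>F. a i \<in> carrier_mat n n) \<longrightarrow>
     opsp_norm (tensor_sum n F a y) \<le> c * opsp_norm (tensor_sum n F a x))"

lemma subspace_pair_graph: "cvs.subspace (pair_graph I x y)"
  unfolding pair_graph_def
proof (rule subspace_closure)
  fix c :: complex
  have "continuous_on UNIV (\<lambda>z :: (ell2 \<times> ell2) \<times> (ell2 \<times> ell2). (c *\<^sub>C fst z, c *\<^sub>C snd z))"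
    by (intro continuous_on_Pair continuous_scaleC_pair continuous_intros)
  then show "continuous_on UNIV (\<lambda>z :: (ell2 \<times> ell2) \<times> (ell2 \<times> ell2). c *\<^sub>C z)"
    by (simp add: scaleC_prod_def[where 'a = "ell2 \<times> ell2" and 'b = "ell2 \<times> ell2"])
qed simp

lemma tensor_sum_pair:
  "map_mat fst (tensor_sum n F a (\<lambda>i. (x i, y i))) = tensor_sum n F a x"
  "map_mat snd (tensor_sum n F a (\<lambda>i. (x i, y i))) = tensor_sum n F a y"
  by (auto intro!: eq_matI simp: tensor_sum_def fst_sum snd_sum fst_scaleC snd_scaleC)

lemma pair_graph_opsp_norm:
  assumes "dominates c I x y" "0 \<le> c" and Z: "Z \<in> mats_over n (pair_graph I x y)"
  shows "opsp_norm (map_mat snd Z) \<le> c * opsp_norm (map_mat fst Z)"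
proof (rule opsp_norm_le_closure[OF \<open>0 \<le> c\<close> _ Z[unfolded pair_graph_def]])
  fix n and Z :: "((ell2 \<times> ell2) \<times> (ell2 \<times> ell2)) mat"
  assume "Z \<in> mats_over n (cvs.span ((\<lambda>i. (x i, y i)) ` I))"
  from mats_over_span[OF this] obtain F a where "finite F" "F \<subseteq> I"
    "\<forall>i\<in>F. a i \<in> carrier_mat n n" "Z = tensor_sum n F a (\<lambda>i. (x i, y i))"
    by blast
  then show "opsp_norm (map_mat snd Z) \<le> c * opsp_norm (map_mat fst Z)"
    using assms(1) by (simp add: tensor_sum_pair dominates_def)
qed

lemma pair_graph_norm:
  assumes "dominates c I x y" "0 \<le> c" "(z, w) \<in> pair_graph I x y"
  shows "norm w \<le> 2 * c * norm z"
proof (rule norm_le_opsp_norm[OF _ \<open>0 \<le> c\<close>])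
  have "mat 1 1 (\<lambda>_. (z, w)) \<in> mats_over 1 (pair_graph I x y)"
    using assms(3) by (simp add: mats_over_def)
  moreover have "map_mat snd (mat 1 1 (\<lambda>_. (z, w))) = mat 1 1 (\<lambda>_. w)"
    "map_mat fst (mat 1 1 (\<lambda>_. (z, w))) = mat 1 1 (\<lambda>_. z)" by (auto intro!: eq_matI)
  ultimately show "opsp_norm (mat 1 1 (\<lambda>_. w)) \<le> c * opsp_norm (mat 1 1 (\<lambda>_. z))"
    using pair_graph_opsp_norm[OF assms(1,2)] by metis
qed

lemma fst_span_pair: "fst ` cvs.span ((\<lambda>i. (x i, y i)) ` I) = cvs.span (x ` I)"
proof (intro equalityI subsetI)
  fix z assume "z \<in> fst ` cvs.span ((\<lambda>i. (x i, y i)) ` I)"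
  then obtain p where p: "p \<in> cvs.span ((\<lambda>i. (x i, y i)) ` I)" "z = fst p" by blast
  from p(1) have "fst p \<in> cvs.span (x ` I)"
    by (induction rule: cvs.span_induct_alt)
      (auto simp: fst_scaleC cvs.span_zero intro!: cvs.span_add[OF cvs.span_scale[OF cvs.span_base]])
  then show "z \<in> cvs.span (x ` I)" using p by simp
next
  fix z assume "z \<in> cvs.span (x ` I)"
  then show "z \<in> fst ` cvs.span ((\<lambda>i. (x i, y i)) ` I)"
  proof (induction rule: cvs.span_induct_alt)
    case base
    show ?case using cvs.span_zero by force
  next
    case (step c b z)
    then obtain p i where "p \<in> cvs.span ((\<lambda>i. (x i, y i)) ` I)" "z = fst p" "i \<in> I" "b = x i" by blast
    then have "c *\<^sub>C (x i, y i) + p \<in> cvs.span ((\<lambda>i. (x i, y i)) ` I)"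
      "fst (c *\<^sub>C (x i, y i) + p) = c *\<^sub>C b + z"
      by (auto simp: fst_scaleC intro!: cvs.span_add[OF cvs.span_scale[OF cvs.span_base]])
    then show ?case by (intro image_eqI[of _ fst "c *\<^sub>C (x i, y i) + p"]) (simp_all only:)
  qed
qed

text \<open>The inclusion that is not formal uses completeness: if \<open>s k\<close> converges, the domination makes the
partners \<open>t k\<close> a Cauchy sequence.\<close>

lemma fst_pair_graph:
  assumes "dominates c I x y" "0 \<le> c"
  shows "fst ` pair_graph I x y = closed_cspan I x"
proof (intro equalityI)
  show "fst ` pair_graph I x y \<subseteq> closed_cspan I x"
    unfolding pair_graph_def closed_cspan_def
    using closure_subset fst_span_pair[of x y I]
    by (intro image_closure_subset continuous_intros) auto
  show "closed_cspan I x \<subseteq> fst ` pair_graph I x y"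
  proof
    fix z assume "z \<in> closed_cspan I x"
    then obtain s where s: "\<And>k. s k \<in> cvs.span (x ` I)" "s \<longlonglongrightarrow> z"
      unfolding closed_cspan_def closure_sequential by blast
    have "\<forall>k. \<exists>t. (s k, t) \<in> cvs.span ((\<lambda>i. (x i, y i)) ` I)"
    proof
      fix k
      have "s k \<in> fst ` cvs.span ((\<lambda>i. (x i, y i)) ` I)"
        using s(1) by (simp only: fst_span_pair)
      then show "\<exists>t. (s k, t) \<in> cvs.span ((\<lambda>i. (x i, y i)) ` I)" by force
    qed
    from choice[OF this] obtain t where t: "\<And>k. (s k, t k) \<in> cvs.span ((\<lambda>i. (x i, y i)) ` I)"
      by blast
    have st: "norm (t k - t j) \<le> 2 * c * norm (s k - s j)" for k j
    proof (rule pair_graph_norm[OF assms])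
      have "(s k, t k) - (s j, t j) \<in> cvs.span ((\<lambda>i. (x i, y i)) ` I)"
        by (intro cvs.span_diff t)
      then show "(s k - s j, t k - t j) \<in> pair_graph I x y"
        unfolding pair_graph_def using closure_subset by fastforce
    qed
    have "Cauchy t"
    proof (rule metric_CauchyI)
      fix e :: real assume "0 < e"
      then have "0 < e / (2 * c + 1)" using \<open>0 \<le> c\<close> by simp
      moreover have "Cauchy s" using s(2) by (rule LIMSEQ_imp_Cauchy)
      ultimately obtain M where M: "\<And>k j. k \<ge> M \<Longrightarrow> j \<ge> M \<Longrightarrow> dist (s k) (s j) < e / (2 * c + 1)"
        using metric_CauchyD by blast
      have "dist (t k) (t j) < e" if "k \<ge> M" "j \<ge> M" for k j
      proof -
        have "dist (t k) (t j) \<le> (2 * c + 1) * dist (s k) (s j)"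
          using st[of k j] by (simp add: dist_norm algebra_simps add_increasing)
        also have "\<dots> < (2 * c + 1) * (e / (2 * c + 1))"
          using M[OF that] \<open>0 \<le> c\<close> by (intro mult_strict_left_mono) auto
        also have "\<dots> = e" using \<open>0 \<le> c\<close> by simp
        finally show ?thesis .
      qed
      then show "\<exists>M. \<forall>k\<ge>M. \<forall>j\<ge>M. dist (t k) (t j) < e" by blast
    qed
    then obtain w where "t \<longlonglongrightarrow> w"
      using Cauchy_convergent convergent_def by blast
    then have "(\<lambda>k. (s k, t k)) \<longlonglongrightarrow> (z, w)"
      using s(2) by (intro tendsto_Pair)
    then have "(z, w) \<in> pair_graph I x y"
      unfolding pair_graph_def closure_sequential
      by (intro exI[of _ "\<lambda>k. (s k, t k)"]) (simp add: t)
    then show "z \<in> fst ` pair_graph I x y" by force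
  qed
qed

lemma pair_graph_swap:
  assumes "(z, w) \<in> pair_graph I x y"
  shows "(w, z) \<in> pair_graph I y x"
proof -
  have span: "prod.swap p \<in> cvs.span ((\<lambda>i. (y i, x i)) ` I)"
    if "p \<in> cvs.span ((\<lambda>i. (x i, y i)) ` I)" for p
    using that
  proof (induction rule: cvs.span_induct_alt)
    case base
    show ?case by (simp add: prod.swap_def cvs.span_zero flip: zero_prod_def)
  next
    case (step c b z)
    then obtain i where i: "i \<in> I" "b = (x i, y i)" by blast
    have "prod.swap (c *\<^sub>C b + z) = c *\<^sub>C (y i, x i) + prod.swap z"
      by (cases z) (simp add: i scaleC_prod_def)
    then show ?case
      using step i by (auto intro!: cvs.span_add[OF cvs.span_scale[OF cvs.span_base]])
  qed
  have "prod.swap ` closure (cvs.span ((\<lambda>i. (x i, y i)) ` I)) \<subseteq> pair_graph I y x"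
    unfolding pair_graph_def
  proof (rule image_closure_subset)
    show "prod.swap ` cvs.span ((\<lambda>i. (x i, y i)) ` I) \<subseteq> closure (cvs.span ((\<lambda>i. (y i, x i)) ` I))"
      using span closure_subset by blast
  qed (auto intro: continuous_on_swap)
  then show ?thesis using assms unfolding pair_graph_def by force
qed

lemma dominates_imp_equivalent:
  assumes xy: "dominates c I x y" and yx: "dominates d I y x" and c: "0 \<le> c" and d: "0 \<le> d"
  shows "equivalent_families (c * d) I x y"
proof -
  define Gr where "Gr = pair_graph I x y"
  have sub: "cvs.subspace Gr" unfolding Gr_def by (rule subspace_pair_graph)
  have swap: "(w, z) \<in> pair_graph I y x \<longleftrightarrow> (z, w) \<in> Gr" for z w
    unfolding Gr_def using pair_graph_swap by blast
  have right_unique: "w = w'" if "(z, w) \<in> Gr" "(z, w') \<in> Gr" for z w w'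
  proof -
    have "(z, w) - (z, w') \<in> Gr" using that by (intro cvs.subspace_diff[OF sub])
    then have "norm (w - w') \<le> 2 * c * norm (0 :: ell2 \<times> ell2)"
      using pair_graph_norm[OF xy c, of "z - z" "w - w'"] by (simp add: Gr_def)
    then show ?thesis by simp
  qed
  have left_unique: "z = z'" if "(z, w) \<in> Gr" "(z', w) \<in> Gr" for z z' w
  proof -
    have "(z, w) - (z', w) \<in> Gr" using that by (intro cvs.subspace_diff[OF sub])
    then have "norm (z - z') \<le> 2 * d * norm (0 :: ell2 \<times> ell2)"
      using pair_graph_norm[OF yx d, of "w - w" "z - z'"] by (simp add: swap)
    then show ?thesis by simp
  qed
  have left_total: "z \<in> closed_cspan I x \<longleftrightarrow> (\<exists>w. (z, w) \<in> Gr)" for z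
    unfolding fst_pair_graph[OF xy c, symmetric] Gr_def by force
  have right_total: "w \<in> closed_cspan I y \<longleftrightarrow> (\<exists>z. (z, w) \<in> Gr)" for w
    unfolding fst_pair_graph[OF yx d, symmetric] swap[symmetric] by force
  define u where "u z = (THE w. (z, w) \<in> Gr)" for z
  have u_eq: "u z = w" if "(z, w) \<in> Gr" for z w
    unfolding u_def using that right_unique by blast
  have u: "(z, u z) \<in> Gr" if "z \<in> closed_cspan I x" for z
    using that u_eq left_total by metis
  have inj: "inj_on u (closed_cspan I x)"
    using u left_unique by (intro inj_onI) metis
  have inv: "inv_into (closed_cspan I x) u w = z" if "(z, w) \<in> Gr" for z w
    using inv_into_f_eq[OF inj] u_eq[OF that] left_total that by metis
  have "clinear_on (closed_cspan I x) u"
    unfolding clinear_on_def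
  proof (intro conjI ballI allI)
    fix z z' assume "z \<in> closed_cspan I x" "z' \<in> closed_cspan I x"
    then have "(z, u z) + (z', u z') \<in> Gr" by (intro cvs.subspace_add[OF sub] u)
    then show "u (z + z') = u z + u z'" by (intro u_eq) simp
  next
    fix c z assume "z \<in> closed_cspan I x"
    then have "c *\<^sub>C (z, u z) \<in> Gr" by (intro cvs.subspace_scale[OF sub] u)
    then show "u (c *\<^sub>C z) = c *\<^sub>C u z" by (intro u_eq) (simp add: scaleC_prod_def)
  qed
  moreover have "bij_betw u (closed_cspan I x) (closed_cspan I y)"
    unfolding bij_betw_def
  proof (intro conjI inj equalityI subsetI)
    fix w assume "w \<in> u ` closed_cspan I x"
    then show "w \<in> closed_cspan I y" using u right_total by blast
  next
    fix w assume "w \<in> closed_cspan I y"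
    then show "w \<in> u ` closed_cspan I x" using right_total left_total u_eq by (metis image_eqI)
  qed
  moreover have "u (x i) = y i" if "i \<in> I" for i
  proof (rule u_eq)
    have "(x i, y i) \<in> cvs.span ((\<lambda>i. (x i, y i)) ` I)" using that by (intro cvs.span_base) auto
    then show "(x i, y i) \<in> Gr" unfolding Gr_def pair_graph_def using closure_subset by blast
  qed
  moreover have "cb_norm (closed_cspan I x) u \<le> ennreal c"
    unfolding cb_norm_def
  proof (intro SUP_least)
    fix n z assume "z \<in> {z \<in> mats_over n (closed_cspan I x). opsp_norm z \<le> 1}"
    then have z: "z \<in> mats_over n (closed_cspan I x)" "opsp_norm z \<le> 1" by auto
    define Z where "Z = map_mat (\<lambda>v. (v, u v)) z"
    have "Z $$ (k, l) = (z $$ (k, l), u (z $$ (k, l)))" if "k < n" "l < n" for k l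
      using z(1) that by (auto simp: mats_over_def Z_def)
    moreover have "Z \<in> carrier_mat n n" using z(1) by (simp add: mats_over_def Z_def)
    ultimately have "Z \<in> mats_over n Gr" using z(1) u by (simp add: mats_over_def)
    moreover have "map_mat fst Z = z" "map_mat snd Z = map_mat u z"
      by (auto simp: Z_def intro!: eq_matI)
    ultimately have "opsp_norm (map_mat u z) \<le> c * opsp_norm z"
      using pair_graph_opsp_norm[OF xy c, of Z n] by (simp add: Gr_def)
    also have "\<dots> \<le> c" using z(2) c by (simp add: mult_left_le)
    finally show "ennreal (opsp_norm (map_mat u z)) \<le> ennreal c" by (rule ennreal_leI)
  qed
  moreover have "cb_norm (closed_cspan I y) (inv_into (closed_cspan I x) u) \<le> ennreal d"
    unfolding cb_norm_def
  proof (intro SUP_least)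
    fix n w assume "w \<in> {w \<in> mats_over n (closed_cspan I y). opsp_norm w \<le> 1}"
    then have w: "w \<in> mats_over n (closed_cspan I y)" "opsp_norm w \<le> 1" by auto
    let ?v = "inv_into (closed_cspan I x) u"
    define Z where "Z = map_mat (\<lambda>t. (t, ?v t)) w"
    have "(t, ?v t) \<in> pair_graph I y x" if "t \<in> closed_cspan I y" for t
      using that right_total inv swap by metis
    moreover have "Z $$ (k, l) = (w $$ (k, l), ?v (w $$ (k, l)))" if "k < n" "l < n" for k l
      using w(1) that by (auto simp: mats_over_def Z_def)
    moreover have "Z \<in> carrier_mat n n" using w(1) by (simp add: mats_over_def Z_def)
    ultimately have "Z \<in> mats_over n (pair_graph I y x)" using w(1) by (simp add: mats_over_def)
    moreover have "map_mat fst Z = w" "map_mat snd Z = map_mat ?v w"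
      by (auto simp: Z_def intro!: eq_matI)
    ultimately have "opsp_norm (map_mat ?v w) \<le> d * opsp_norm w"
      using pair_graph_opsp_norm[OF yx d, of Z n] by simp
    also have "\<dots> \<le> d" using w(2) d by (simp add: mult_left_le)
    finally show "ennreal (opsp_norm (map_mat ?v w)) \<le> ennreal d" by (rule ennreal_leI)
  qed
  ultimately show ?thesis
    unfolding equivalent_families_def
    using c d by (intro exI[of _ u]) (auto simp: ennreal_mult intro!: mult_mono)
qed

section \<open>The diagonal operator\<close>

definition weight :: "real \<Rightarrow> nat \<Rightarrow> real" where
  "weight \<alpha> j = real (Suc j) powr (- \<alpha>)"

definition diag_op :: "real \<Rightarrow> ell2 \<Rightarrow> ell2" where
  "diag_op \<alpha> x = Abs_ell2 (\<lambda>k. complex_of_real (weight \<alpha> k) * coord x k)"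

lemma weight_pos: "0 < weight \<alpha> j"
  by (simp add: weight_def)

lemma weight_mono: "0 \<le> \<alpha> \<Longrightarrow> i \<le> j \<Longrightarrow> weight \<alpha> j \<le> weight \<alpha> i"
  unfolding weight_def by (rule powr_mono2') auto

lemma weight_le_1: "0 \<le> \<alpha> \<Longrightarrow> weight \<alpha> j \<le> 1"
  using weight_mono[of \<alpha> 0 j] by (simp add: weight_def)

lemma weight_strict: "0 < \<alpha> \<Longrightarrow> i < j \<Longrightarrow> weight \<alpha> j < weight \<alpha> i"
  unfolding weight_def by (rule powr_less_mono2_neg) auto

lemma weight_inject: "0 < \<alpha> \<Longrightarrow> weight \<alpha> i = weight \<alpha> j \<longleftrightarrow> i = j"
  by (metis less_irrefl linorder_neqE_nat weight_strict)

lemma weight_tendsto_0: "0 < \<alpha> \<Longrightarrow> weight \<alpha> \<longlonglongrightarrow> 0"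
  unfolding weight_def
  by (intro tendsto_neg_powr filterlim_compose[OF filterlim_real_sequentially] filterlim_Suc) simp

lemma norm_sq_ell2: "(norm x)\<^sup>2 = (\<Sum>k. (cmod (coord x k))\<^sup>2)"
  by (simp add: norm_ell2_def suminf_nonneg[OF summable_coord])

context
  fixes \<alpha> :: real
  assumes \<alpha>: "0 < \<alpha>"
begin

lemma coord_diag_op: "coord (diag_op \<alpha> x) k = complex_of_real (weight \<alpha> k) * coord x k"
proof -
  have "summable (\<lambda>k. (cmod (complex_of_real (weight \<alpha> k) * coord x k))\<^sup>2)"
  proof (rule summable_comparison_test'[where N = 0, OF summable_coord[of x]])
    fix k
    have "(weight \<alpha> k * cmod (coord x k))\<^sup>2 \<le> (1 * cmod (coord x k))\<^sup>2"
      using weight_le_1[of \<alpha> k] weight_pos[of \<alpha> k] \<alpha> by (intro power_mono mult_right_mono) auto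
    then show "norm ((cmod (complex_of_real (weight \<alpha> k) * coord x k))\<^sup>2) \<le> (cmod (coord x k))\<^sup>2"
      using weight_pos[of \<alpha> k] by (simp add: norm_mult)
  qed
  then show ?thesis by (simp add: diag_op_def Abs_ell2_inverse)
qed

lemma clinear_diag_op: "clinear_on UNIV (diag_op \<alpha>)"
  unfolding clinear_on_def by (auto intro!: ell2_eqI simp: coord_diag_op algebra_simps)

lemma norm_sq_diag_op: "(norm (diag_op \<alpha> x))\<^sup>2 = (\<Sum>k. (weight \<alpha> k)\<^sup>2 * (cmod (coord x k))\<^sup>2)"
  by (simp add: norm_sq_ell2 coord_diag_op norm_mult power_mult_distrib)

lemma summable_diag_op: "summable (\<lambda>k. (weight \<alpha> k)\<^sup>2 * (cmod (coord x k))\<^sup>2)"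
  using summable_coord[of "diag_op \<alpha> x"] by (simp add: coord_diag_op norm_mult power_mult_distrib)

lemma norm_diag_op_tail:
  assumes "\<And>k. coord x k \<noteq> 0 \<Longrightarrow> weight \<alpha> k \<le> e" "0 \<le> e"
  shows "norm (diag_op \<alpha> x) \<le> e * norm x"
proof -
  have "(norm (diag_op \<alpha> x))\<^sup>2 \<le> (\<Sum>k. e\<^sup>2 * (cmod (coord x k))\<^sup>2)"
    unfolding norm_sq_diag_op
  proof (intro suminf_le summable_diag_op summable_mult summable_coord)
    fix k
    show "(weight \<alpha> k)\<^sup>2 * (cmod (coord x k))\<^sup>2 \<le> e\<^sup>2 * (cmod (coord x k))\<^sup>2"
      using assms(1)[of k] weight_pos[of \<alpha> k]
      by (cases "coord x k = 0") (auto intro!: mult_right_mono power_mono)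
  qed
  also have "\<dots> = (e * norm x)\<^sup>2"
    by (simp add: suminf_mult summable_coord norm_sq_ell2 power_mult_distrib)
  finally show ?thesis
    by (rule power2_le_imp_le) (simp add: \<open>0 \<le> e\<close>)
qed

lemma norm_diag_op_le: "norm (diag_op \<alpha> x) \<le> norm x"
  using norm_diag_op_tail[of x 1, OF weight_le_1] \<alpha> by simp

lemma diag_op_eq_0_iff: "diag_op \<alpha> x = 0 \<longleftrightarrow> x = 0"
proof
  assume "diag_op \<alpha> x = 0"
  then have "complex_of_real (weight \<alpha> k) * coord x k = 0" for k
    by (simp flip: coord_diag_op)
  then show "x = 0"
    using weight_pos[of \<alpha>] by (intro ell2_eqI) (simp add: less_le)
qed (auto intro!: ell2_eqI simp: coord_diag_op)

lemma linear_contraction_diag_op: "linear_contraction (diag_op \<alpha>)"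
  by (simp add: linear_contraction_def clinear_diag_op norm_diag_op_le)

lemma diag_op_symmetric: "cinner (diag_op \<alpha> x) y = cinner x (diag_op \<alpha> y)"
  by (simp add: cinner_def coord_diag_op mult_ac)

lemma coord_unit_vec2: "coord (unit_vec2 j) k = (if k = j then 1 else 0)"
proof -
  have "summable (\<lambda>k. (cmod (if k = j then 1 else 0))\<^sup>2)"
    by (rule summable_finite[of "{j}"]) auto
  then show ?thesis by (simp add: unit_vec2_def Abs_ell2_inverse)
qed

lemma norm_unit_vec2: "norm (unit_vec2 j) = 1"
proof -
  have "(norm (unit_vec2 j))\<^sup>2 = (\<Sum>k\<in>{j}. (cmod (coord (unit_vec2 j) k))\<^sup>2)"
    unfolding norm_sq_ell2 by (rule suminf_finite) (auto simp: coord_unit_vec2)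
  then have "(norm (unit_vec2 j))\<^sup>2 = 1\<^sup>2" by (simp add: coord_unit_vec2)
  then show ?thesis by (rule power2_eq_imp_eq) auto
qed

lemma diag_op_unit_vec2: "diag_op \<alpha> (unit_vec2 j) = complex_of_real (weight \<alpha> j) *\<^sub>C unit_vec2 j"
  by (rule ell2_eqI) (simp add: coord_diag_op coord_unit_vec2)

lemma not_hilbert_schmidt_diag_op:
  assumes "\<alpha> \<le> 1 / 2"
  shows "\<not> hilbert_schmidt (diag_op \<alpha>)"
proof
  assume "hilbert_schmidt (diag_op \<alpha>)"
  then have "summable (\<lambda>k. (weight \<alpha> k)\<^sup>2)"
    using weight_pos[of \<alpha>]
    by (simp add: hilbert_schmidt_def diag_op_unit_vec2 norm_scaleC norm_unit_vec2)
  moreover have "(weight \<alpha> k)\<^sup>2 = real (Suc k) powr (- 2 * \<alpha>)" for k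
    by (simp add: weight_def power2_eq_square flip: powr_add)
  ultimately have "summable (\<lambda>k. real k powr (- 2 * \<alpha>))"
    by (subst summable_Suc_iff[symmetric]) simp
  then show False
    using assms by (simp add: summable_real_powr_iff)
qed

text \<open>Up to \<open>\<epsilon>\<close> the image of the unit ball lies in the compact set \<open>K N\<close> of truncated vectors, because the
weights tend to zero; so it is totally bounded.\<close>

lemma compact_contraction_diag_op: "compact_contraction UNIV (diag_op \<alpha>)"
proof -
  define S where "S = diag_op \<alpha> ` cball 0 1"
  define K where "K N = {x. (\<forall>k<N. cmod (coord x k) \<le> 1) \<and> (\<forall>k\<ge>N. coord x k = 0)}" for N
  have "compact (K N)" for N
  proof (induction N)
    case 0
    have "K 0 = {0}" by (auto simp: K_def intro: ell2_eqI)
    then show ?case by simp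
  next
    case (Suc N)
    \<comment> \<open>The set for \<open>N + 1\<close> is the sum of the one for \<open>N\<close> and of a compact disc.\<close>
    have "continuous_on (cball 0 1) (\<lambda>z. z *\<^sub>C unit_vec2 N)"
    proof -
      have "bounded_linear (\<lambda>z. z *\<^sub>C unit_vec2 N)"
        by (rule bounded_linear_intro[of _ 1])
          (simp_all add: scaleC_add_left norm_scaleC norm_unit_vec2 scaleR_scaleC scaleC_scaleC
            scaleR_conv_of_real)
      then show ?thesis by (rule linear_continuous_on)
    qed
    then have "compact ((\<lambda>z. z *\<^sub>C unit_vec2 N) ` cball 0 1)"
      by (rule compact_continuous_image) simp
    then have "compact {x + y |x y. x \<in> K N \<and> y \<in> (\<lambda>z. z *\<^sub>C unit_vec2 N) ` cball 0 1}"
      using Suc by (rule compact_sums[rotated])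
    also have "{x + y |x y. x \<in> K N \<and> y \<in> (\<lambda>z. z *\<^sub>C unit_vec2 N) ` cball 0 1} = K (Suc N)"
    proof (intro equalityI subsetI)
      fix w assume "w \<in> {x + y |x y. x \<in> K N \<and> y \<in> (\<lambda>z. z *\<^sub>C unit_vec2 N) ` cball 0 1}"
      then obtain x z where "x \<in> K N" "cmod z \<le> 1" "w = x + z *\<^sub>C unit_vec2 N" by auto
      then show "w \<in> K (Suc N)" by (auto simp: K_def coord_unit_vec2 less_Suc_eq)
    next
      fix w assume w: "w \<in> K (Suc N)"
      define z where "z = coord w N"
      have "w - z *\<^sub>C unit_vec2 N \<in> K N"
        using w by (auto simp: K_def coord_unit_vec2 z_def Suc_le_eq)
      moreover have "cmod z \<le> 1" using w by (auto simp: K_def z_def)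
      moreover have "w = (w - z *\<^sub>C unit_vec2 N) + z *\<^sub>C unit_vec2 N" by simp
      ultimately show "w \<in> {x + y |x y. x \<in> K N \<and> y \<in> (\<lambda>z. z *\<^sub>C unit_vec2 N) ` cball 0 1}"
        by (metis (mono_tags, lifting) imageI mem_Collect_eq mem_cball_0)
    qed
    finally show ?case .
  qed
  have "\<exists>k. finite k \<and> closure S \<subseteq> (\<Union>x\<in>k. ball x e)" if "0 < e" for e
  proof -
    obtain N where N: "\<And>k. k \<ge> N \<Longrightarrow> weight \<alpha> k < e / 4"
      using order_tendstoD(2)[OF weight_tendsto_0[OF \<alpha>], of "e / 4"] \<open>0 < e\<close>
      by (auto simp: eventually_sequentially)
    obtain k where k: "finite k" "K N \<subseteq> (\<Union>x\<in>k. ball x (e / 4))"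
      using \<open>compact (K N)\<close>[unfolded compact_eq_totally_bounded] \<open>0 < e\<close>
      by (metis divide_pos_pos zero_less_numeral)
    have "S \<subseteq> (\<Union>x\<in>k. cball x (e / 2))"
    proof
      fix w assume "w \<in> S"
      then obtain x where x: "norm x \<le> 1" "w = diag_op \<alpha> x" by (auto simp: S_def)
      have trunc: "summable (\<lambda>j. (cmod (if j < N then coord w j else 0))\<^sup>2)"
        by (rule summable_finite[of "{..<N}"]) auto
      define h where "h = Abs_ell2 (\<lambda>j. if j < N then coord w j else 0)"
      have h: "coord h j = (if j < N then coord w j else 0)" for j
        using trunc by (simp add: h_def Abs_ell2_inverse)
      have "norm w \<le> 1" using x norm_diag_op_le[of x] by simp
      then have "h \<in> K N"
        using norm_coord_le[of w] by (auto simp: K_def h intro: order_trans)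
      have tail: "summable (\<lambda>j. (cmod (if j < N then 0 else coord x j))\<^sup>2)"
        by (rule summable_comparison_test'[where N = 0, OF summable_coord[of x]]) auto
      define g where "g = Abs_ell2 (\<lambda>j. if j < N then 0 else coord x j)"
      have g: "coord g j = (if j < N then 0 else coord x j)" for j
        using tail by (simp add: g_def Abs_ell2_inverse)
      have "(norm g)\<^sup>2 \<le> (norm x)\<^sup>2"
        unfolding norm_sq_ell2 using summable_coord[of g] summable_coord[of x]
        by (intro suminf_le) (auto simp: g)
      then have "norm g \<le> 1" using x(1) power2_le_imp_le[OF _ norm_ge_zero, of "norm g" x] by linarith
      have "w - h = diag_op \<alpha> g"
        by (rule ell2_eqI) (auto simp: h g coord_diag_op x(2))
      also have "norm (diag_op \<alpha> g) \<le> e / 4 * norm g"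
        using N \<open>0 < e\<close> by (intro norm_diag_op_tail) (auto simp: g less_imp_le split: if_splits)
      also have "\<dots> \<le> e / 4 * 1"
        using \<open>norm g \<le> 1\<close> \<open>0 < e\<close> by (intro mult_left_mono) auto
      finally have "dist h w \<le> e / 4" by (simp add: dist_norm norm_minus_commute)
      moreover obtain c where "c \<in> k" "dist c h < e / 4" using k \<open>h \<in> K N\<close> by auto
      ultimately have "dist c w \<le> e / 2" using dist_triangle[of c w h] by linarith
      then show "w \<in> (\<Union>x\<in>k. cball x (e / 2))" using \<open>c \<in> k\<close> by auto
    qed
    moreover have "closed (\<Union>x\<in>k. cball x (e / 2))"
      using k(1) by (intro closed_UN) auto
    ultimately have "closure S \<subseteq> (\<Union>x\<in>k. cball x (e / 2))"
      by (rule closure_minimal)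
    also have "\<dots> \<subseteq> (\<Union>x\<in>k. ball x e)"
      using \<open>0 < e\<close> by (intro UN_mono) auto
    finally show ?thesis using k(1) by blast
  qed
  moreover have "complete (closure S)" by (simp add: complete_eq_closed)
  ultimately have "compact (closure S)"
    unfolding compact_eq_totally_bounded by blast
  then show ?thesis
    by (simp add: compact_contraction_def clinear_diag_op norm_diag_op_le S_def)
qed

end

section \<open>Matching the images with the weights\<close>

text \<open>Comparison with the integral of \<open>t powr (- \<beta>)\<close>, one interval at a time by the mean value theorem.\<close>

lemma sum_powr_le:
  fixes \<beta> :: real
  assumes "0 \<le> \<beta>" "\<beta> < 1"
  shows "(\<Sum>j<N. real (Suc j) powr (- \<beta>)) \<le> real N powr (1 - \<beta>) / (1 - \<beta>)"
proof (induction N)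
  case (Suc N)
  have step: "real N powr (1 - \<beta>) + (1 - \<beta>) * real (Suc N) powr (- \<beta>) \<le> real (Suc N) powr (1 - \<beta>)"
  proof (cases "N = 0")
    case False
    then have N: "0 < real N" by simp
    have "\<exists>z. real N < z \<and> z < real (Suc N) \<and>
        real (Suc N) powr (1 - \<beta>) - real N powr (1 - \<beta>)
          = (real (Suc N) - real N) * ((1 - \<beta>) * z powr (1 - \<beta> - 1))"
      using N by (intro MVT2 has_real_derivative_powr) auto
    then obtain z where z: "real N < z" "z < real (Suc N)"
      "real (Suc N) powr (1 - \<beta>) - real N powr (1 - \<beta>) = (1 - \<beta>) * z powr (- \<beta>)"
      by auto
    have "real (Suc N) powr (- \<beta>) \<le> z powr (- \<beta>)"
      using z N assms by (intro powr_mono2') auto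
    then have "(1 - \<beta>) * real (Suc N) powr (- \<beta>) \<le> (1 - \<beta>) * z powr (- \<beta>)"
      using assms by (intro mult_left_mono) auto
    then show ?thesis using z(3) by linarith
  qed (use assms in auto)
  have "(\<Sum>j<Suc N. real (Suc j) powr (- \<beta>))
      \<le> real N powr (1 - \<beta>) / (1 - \<beta>) + real (Suc N) powr (- \<beta>)"
    using Suc by simp
  also have "\<dots> = (real N powr (1 - \<beta>) + (1 - \<beta>) * real (Suc N) powr (- \<beta>)) / (1 - \<beta>)"
    using assms by (simp add: field_simps)
  also have "\<dots> \<le> real (Suc N) powr (1 - \<beta>) / (1 - \<beta>)"
    using step assms by (intro divide_right_mono) auto
  finally show ?case .
qed simp

text \<open>With \<open>q k = \<Sum>i\<in>F. \<bar>coord (\<zeta> i) k\<bar>\<^sup>2\<close> the left-hand side is \<open>\<Sum>k. (weight \<alpha> k)\<^sup>2 * q k\<close>. Here \<open>q k \<le> C\<^sup>2\<close>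
by Bessel and \<open>\<Sum>k. q k = card F\<close>, so the sum is largest when the mass sits on the largest weights.\<close>

lemma (in cu_family) sum_diag_op_le:
  assumes A_eq: "A = diag_op \<alpha>" and \<alpha>: "0 < \<alpha>" and F: "finite F" "F \<subseteq> I"
  shows "(\<Sum>i\<in>F. (norm (snd (x i)))\<^sup>2) \<le> C\<^sup>2 * (\<Sum>j<card F. (weight \<alpha> j)\<^sup>2)"
proof -
  define N where "N = card F"
  define q where "q k = (\<Sum>i\<in>F. (cmod (coord (fst (x i)) k))\<^sup>2)" for k
  have q: "q k \<le> C\<^sup>2" "0 \<le> q k" for k
    unfolding q_def by (rule bessel[OF F]) (simp add: sum_nonneg)
  have sumq: "summable q"
    unfolding q_def by (intro summable_sum summable_coord)
  have "suminf q = (\<Sum>i\<in>F. (norm (fst (x i)))\<^sup>2)"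
    unfolding q_def norm_sq_ell2 by (rule suminf_sum) (rule summable_coord)
  also have "\<dots> = N" using F nx by (simp add: N_def subset_eq)
  finally have total: "suminf q = real N" .
  have "(\<Sum>i\<in>F. (norm (snd (x i)))\<^sup>2) = (\<Sum>i\<in>F. (norm (diag_op \<alpha> (fst (x i))))\<^sup>2)"
    using X_space_snd[OF x] F(2) A_eq by (intro sum.cong) auto
  also have "\<dots> = (\<Sum>k. (weight \<alpha> k)\<^sup>2 * q k)"
    unfolding norm_sq_diag_op[OF \<alpha>] q_def sum_distrib_left
    by (rule suminf_sum[symmetric]) (rule summable_diag_op[OF \<alpha>])
  \<comment> \<open>Subtracting the square of the weight at \<open>N\<close> gives each term with \<open>k \<ge> N\<close> the favourable sign.\<close>
  also have "\<dots> \<le> (\<Sum>k. (if k < N then ((weight \<alpha> k)\<^sup>2 - (weight \<alpha> N)\<^sup>2) * C\<^sup>2 else 0)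
      + (weight \<alpha> N)\<^sup>2 * q k)"
  proof (intro suminf_le summable_add summable_mult sumq)
    show "summable (\<lambda>k. (weight \<alpha> k)\<^sup>2 * q k)"
      unfolding q_def sum_distrib_left by (intro summable_sum summable_diag_op[OF \<alpha>])
    show "summable (\<lambda>k. if k < N then ((weight \<alpha> k)\<^sup>2 - (weight \<alpha> N)\<^sup>2) * C\<^sup>2 else 0)"
      by (rule summable_finite[of "{..<N}"]) auto
    fix k
    show "(weight \<alpha> k)\<^sup>2 * q k
        \<le> (if k < N then ((weight \<alpha> k)\<^sup>2 - (weight \<alpha> N)\<^sup>2) * C\<^sup>2 else 0) + (weight \<alpha> N)\<^sup>2 * q k"
    proof (cases "k < N")
      case True
      then have "(weight \<alpha> N)\<^sup>2 \<le> (weight \<alpha> k)\<^sup>2"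
        using \<alpha> weight_pos[of \<alpha> N] weight_mono[of \<alpha> k N] by (intro power_mono) auto
      then have "((weight \<alpha> k)\<^sup>2 - (weight \<alpha> N)\<^sup>2) * q k \<le> ((weight \<alpha> k)\<^sup>2 - (weight \<alpha> N)\<^sup>2) * C\<^sup>2"
        using q(1) by (intro mult_left_mono) auto
      then show ?thesis using True by (simp add: algebra_simps)
    next
      case False
      then have "(weight \<alpha> k)\<^sup>2 \<le> (weight \<alpha> N)\<^sup>2"
        using \<alpha> weight_pos[of \<alpha> k] weight_mono[of \<alpha> N k] by (intro power_mono) auto
      then show ?thesis using False q(2) by (simp add: mult_right_mono)
    qed
  qed
  also have "\<dots> = (\<Sum>k<N. ((weight \<alpha> k)\<^sup>2 - (weight \<alpha> N)\<^sup>2) * C\<^sup>2) + (weight \<alpha> N)\<^sup>2 * N"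
  proof -
    have fin: "(\<lambda>k. if k < N then ((weight \<alpha> k)\<^sup>2 - (weight \<alpha> N)\<^sup>2) * C\<^sup>2 else 0)
        sums (\<Sum>k<N. ((weight \<alpha> k)\<^sup>2 - (weight \<alpha> N)\<^sup>2) * C\<^sup>2)"
      using sums_If_finite_set[of "{..<N}" "\<lambda>k. ((weight \<alpha> k)\<^sup>2 - (weight \<alpha> N)\<^sup>2) * C\<^sup>2"] by simp
    have "(\<lambda>k. (weight \<alpha> N)\<^sup>2 * q k) sums ((weight \<alpha> N)\<^sup>2 * N)"
      using sums_mult[OF summable_sums[OF sumq]] total by simp
    from sums_unique[OF sums_add[OF fin this]] show ?thesis by simp
  qed
  also have "\<dots> = C\<^sup>2 * (\<Sum>k<N. (weight \<alpha> k)\<^sup>2) - (C\<^sup>2 - 1) * ((weight \<alpha> N)\<^sup>2 * N)"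
    by (simp only: sum_distrib_right[symmetric] sum_subtractf) (simp add: algebra_simps)
  also have "\<dots> \<le> C\<^sup>2 * (\<Sum>k<N. (weight \<alpha> k)\<^sup>2)"
    using C by (simp add: one_le_power)
  finally show ?thesis by (simp add: N_def)
qed

text \<open>If all images were larger, the sum of their squares would exceed \<open>sum_diag_op_le\<close>.\<close>

lemma (in cu_family) exists_small_image:
  assumes A_eq: "A = diag_op \<alpha>" and \<alpha>: "0 < \<alpha>" "\<alpha> < 1 / 2" and F: "finite F" "F \<subseteq> I" "F \<noteq> {}"
  shows "\<exists>i\<in>F. norm (snd (x i)) \<le> C / sqrt (1 - 2 * \<alpha>) * real (card F) powr (- \<alpha>)"
proof (rule ccontr)
  assume "\<not> ?thesis"
  then have large: "C / sqrt (1 - 2 * \<alpha>) * real (card F) powr (- \<alpha>) < norm (snd (x i))" if "i \<in> F" for i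
    using that by force
  define N where "N = card F"
  have N: "0 < real N" using F by (simp add: N_def card_gt_0_iff)
  have sq: "(real j powr (- \<alpha>))\<^sup>2 = real j powr (- (2 * \<alpha>))" for j
    by (simp add: power2_eq_square flip: powr_add)
  have "C\<^sup>2 / (1 - 2 * \<alpha>) * real N powr (1 - 2 * \<alpha>)
      = (\<Sum>i\<in>F. (C / sqrt (1 - 2 * \<alpha>) * real N powr (- \<alpha>))\<^sup>2)"
  proof -
    have "real N powr (1 - 2 * \<alpha>) = real N * (real N powr (- \<alpha>))\<^sup>2"
      unfolding sq using N by (simp add: powr_diff powr_minus divide_inverse)
    then show ?thesis
      using \<alpha> by (simp add: power_mult_distrib power_divide N_def)
  qed
  also have "\<dots> < (\<Sum>i\<in>F. (norm (snd (x i)))\<^sup>2)"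
    using F(1,3) large C \<alpha> unfolding N_def by (intro sum_strict_mono power_strict_mono) auto
  also have "\<dots> \<le> C\<^sup>2 * (\<Sum>j<N. (weight \<alpha> j)\<^sup>2)"
    unfolding N_def by (rule sum_diag_op_le[OF A_eq \<alpha>(1) F(1,2)])
  also have "\<dots> \<le> C\<^sup>2 * (real N powr (1 - 2 * \<alpha>) / (1 - 2 * \<alpha>))"
    using sum_powr_le[of "2 * \<alpha>" N] \<alpha>
    by (intro mult_left_mono) (simp_all add: weight_def sq del: of_nat_Suc)
  finally show False by simp
qed

text \<open>The hypothesis says that fewer than \<open>N\<close> of the \<open>p i\<close> are below \<open>N\<close>. In particular fewer than \<open>2 ^ Suc m\<close>
of them lie in \<open>[2 ^ m, 2 ^ Suc m)\<close>, so these fit into the \<open>2 ^ Suc m\<close> integers of the next block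
\<open>[2 ^ Suc m, 2 ^ Suc (Suc m))\<close>, which costs a factor of at most 4. The successor of \<open>\<pi> i\<close> appears because
\<open>weight\<close> counts from zero.\<close>

lemma dyadic_matching:
  fixes p :: "'i \<Rightarrow> real"
  assumes p: "\<And>F. finite F \<Longrightarrow> F \<subseteq> I \<Longrightarrow> F \<noteq> {} \<Longrightarrow> \<exists>i\<in>F. real (card F) \<le> p i"
  shows "\<exists>\<pi>. inj_on \<pi> I \<and> (\<forall>i\<in>I. p i \<le> real (Suc (\<pi> i)) \<and> real (Suc (\<pi> i)) \<le> 4 * p i)"
proof -
  define L where "L m = {i \<in> I. 2 ^ m \<le> p i \<and> p i < 2 ^ Suc m}" for m :: nat
  define S where "S m = {2 ^ Suc m - 1..<2 ^ Suc (Suc m) - 1 :: nat}" for m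
  have cardS: "card (S m) = 2 ^ Suc m" for m by (simp add: S_def)
  have small: "card F < 2 ^ Suc m" if "finite F" "F \<subseteq> L m" for F m
  proof (cases "F = {}")
    case False
    then obtain i where "i \<in> F" "real (card F) \<le> p i"
      using p[of F] \<open>finite F\<close> \<open>F \<subseteq> L m\<close> by (auto simp: L_def)
    then have "real (card F) < 2 ^ Suc m" using \<open>F \<subseteq> L m\<close> by (auto simp: L_def)
    then show ?thesis by (metis of_nat_less_iff of_nat_numeral of_nat_power)
  qed simp
  have "finite (L m)" for m
  proof (rule ccontr)
    assume "infinite (L m)"
    then obtain F where "finite F" "card F = 2 ^ Suc m" "F \<subseteq> L m"
      using infinite_arbitrarily_large by blast
    then show False using small[of F m] by simp
  qed
  then have "\<exists>f. f ` L m \<subseteq> S m \<and> inj_on f (L m)" for m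
    using small[of "L m" m] cardS[of m] by (intro card_le_inj) (auto simp: S_def)
  then have "\<forall>m. \<exists>f. f ` L m \<subseteq> S m \<and> inj_on f (L m)" by blast
  from choice[OF this] obtain f where f: "\<And>m. f m ` L m \<subseteq> S m" "\<And>m. inj_on (f m) (L m)" by blast
  define lev where "lev i = (LEAST m. p i < 2 ^ Suc m)" for i
  have lev: "i \<in> L (lev i)" if "i \<in> I" for i
  proof -
    obtain m where "p i < 2 ^ m" using real_arch_pow[of 2 "p i"] by auto
    then have "p i < 2 ^ Suc m" by (rule less_le_trans) simp
    then have less: "p i < 2 ^ Suc (lev i)" unfolding lev_def by (rule LeastI)
    have "2 ^ lev i \<le> p i"
    proof (cases "lev i")
      case 0
      then show ?thesis using p[of "{i}"] that by simp
    next
      case (Suc k)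
      then have "\<not> p i < 2 ^ Suc k"
        using not_less_Least[of k "\<lambda>m. p i < 2 ^ Suc m"] unfolding lev_def by simp
      then show ?thesis by (simp only: Suc not_less)
    qed
    then show ?thesis using less that by (simp add: L_def)
  qed
  define \<pi> where "\<pi> i = f (lev i) i" for i
  have \<pi>: "\<pi> i \<in> S (lev i)" if "i \<in> I" for i
    using f(1)[of "lev i"] lev[OF that] by (auto simp: \<pi>_def)
  have lt: "\<pi> i < \<pi> j" if "i \<in> I" "j \<in> I" "lev i < lev j" for i j
  proof -
    have "(2 :: nat) ^ Suc (Suc (lev i)) \<le> 2 ^ Suc (lev j)"
      using that(3) by (intro power_increasing) auto
    then show ?thesis using \<pi>[OF that(1)] \<pi>[OF that(2)] unfolding S_def atLeastLessThan_iff by linarith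
  qed
  have "inj_on \<pi> I"
  proof (rule inj_onI)
    fix i j assume ij: "i \<in> I" "j \<in> I" "\<pi> i = \<pi> j"
    then have "lev i = lev j" using lt by (metis less_irrefl linorder_neqE_nat)
    then show "i = j"
      using ij lev f(2)[of "lev i"] unfolding \<pi>_def by (metis inj_onD)
  qed
  moreover have "p i \<le> real (Suc (\<pi> i)) \<and> real (Suc (\<pi> i)) \<le> 4 * p i" if "i \<in> I" for i
  proof -
    have "(2 :: nat) ^ Suc (lev i) \<le> Suc (\<pi> i)" "Suc (\<pi> i) \<le> 2 ^ Suc (Suc (lev i))"
      using \<pi>[OF that] by (auto simp: S_def)
    then have "real (2 ^ Suc (lev i)) \<le> real (Suc (\<pi> i))" "real (Suc (\<pi> i)) \<le> real (2 ^ Suc (Suc (lev i)))"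
      by (simp_all only: of_nat_le_iff)
    then show ?thesis using lev[OF that] by (simp add: L_def)
  qed
  ultimately show ?thesis by blast
qed

lemma (in cu_family) weight_matching:
  assumes A_eq: "A = diag_op \<alpha>" and \<alpha>: "0 < \<alpha>" "\<alpha> < 1 / 2"
  shows "\<exists>\<pi>. inj_on \<pi> I \<and> (\<forall>i\<in>I. weight \<alpha> (\<pi> i) \<le> norm (snd (x i)) \<and>
    norm (snd (x i)) \<le> 4 powr \<alpha> * (C / sqrt (1 - 2 * \<alpha>)) * weight \<alpha> (\<pi> i))"
proof -
  define K where "K = C / sqrt (1 - 2 * \<alpha>)"
  have "sqrt (1 - 2 * \<alpha>) \<le> 1" using \<alpha> by simp
  then have "sqrt (1 - 2 * \<alpha>) \<le> C" using C by linarith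
  then have K: "1 \<le> K" using \<alpha> by (simp add: K_def)
  \<comment> \<open>The number \<open>p i\<close> is the real position at which the weights reach \<open>t i / K\<close>.\<close>
  define t where "t i = norm (snd (x i))" for i
  define p where "p i = (t i / K) powr (- (1 / \<alpha>))" for i
  have t: "0 < t i" if "i \<in> I" for i
  proof -
    have "fst (x i) \<noteq> 0" using nx[OF that] by auto
    then show ?thesis
      using X_space_snd[OF x[OF that]] \<alpha> by (simp add: t_def A_eq diag_op_eq_0_iff)
  qed
  have tp: "t i / K = p i powr (- \<alpha>)" if "i \<in> I" for i
    using t[OF that] K \<alpha> by (simp add: p_def powr_powr)
  have "\<exists>i\<in>F. real (card F) \<le> p i" if F: "finite F" "F \<subseteq> I" "F \<noteq> {}" for F
  proof -
    obtain i where i: "i \<in> F" "t i \<le> K * real (card F) powr (- \<alpha>)"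
      using exists_small_image[OF A_eq \<alpha> F] unfolding t_def K_def by blast
    have N: "0 < real (card F)" using F by (simp add: card_gt_0_iff)
    have "(real (card F) powr (- \<alpha>)) powr (- (1 / \<alpha>)) \<le> p i"
      unfolding p_def using i K t F(2) \<alpha>
      by (intro powr_mono2') (auto simp: divide_simps mult.commute)
    then show ?thesis using i(1) N \<alpha> by (auto simp: powr_powr)
  qed
  from dyadic_matching[of I p, OF this] obtain \<pi> where \<pi>: "inj_on \<pi> I"
    "\<And>i. i \<in> I \<Longrightarrow> p i \<le> real (Suc (\<pi> i)) \<and> real (Suc (\<pi> i)) \<le> 4 * p i" by blast
  have "weight \<alpha> (\<pi> i) \<le> t i \<and> t i \<le> 4 powr \<alpha> * K * weight \<alpha> (\<pi> i)" if "i \<in> I" for i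
  proof
    have p0: "0 < p i" using t[OF that] K by (simp add: p_def)
    have "weight \<alpha> (\<pi> i) \<le> p i powr (- \<alpha>)"
      unfolding weight_def using \<pi>(2)[OF that] p0 \<alpha> by (intro powr_mono2') auto
    also have "\<dots> = t i / K" using tp[OF that] by simp
    also have "\<dots> \<le> t i" using K t[OF that] by (simp add: divide_simps)
    finally show "weight \<alpha> (\<pi> i) \<le> t i" .
    have "(4 * p i) powr (- \<alpha>) \<le> weight \<alpha> (\<pi> i)"
      unfolding weight_def using \<pi>(2)[OF that] p0 \<alpha> by (intro powr_mono2') auto
    then have "4 powr \<alpha> * (4 * p i) powr (- \<alpha>) \<le> 4 powr \<alpha> * weight \<alpha> (\<pi> i)"
      by (intro mult_left_mono) auto
    moreover have "4 powr \<alpha> * (4 * p i) powr (- \<alpha>) = t i / K"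
      using p0 by (simp add: powr_mult tp[OF that] powr_minus)
    ultimately have "t i / K \<le> 4 powr \<alpha> * weight \<alpha> (\<pi> i)" by linarith
    then show "t i \<le> 4 powr \<alpha> * K * weight \<alpha> (\<pi> i)"
      using K by (simp add: pos_divide_le_eq mult_ac)
  qed
  then show ?thesis using \<pi>(1) unfolding t_def K_def by blast
qed

section \<open>Canonical bases\<close>

lemma cinner_diff_right: "cinner x (y - z) = cinner x y - cinner x z"
  using cinner_add_right[of x "y - z" z] by simp

text \<open>The representing vector minimizes \<open>\<parallel>w\<parallel>\<^sup>2 - 2 Re (f w)\<close> over \<open>Y\<close>: minimizing sequences are Cauchy by the
parallelogram law, and the first variation at the minimum gives the real part of the claim. It is
needed because \<open>adjoint_on\<close> has its meaning only where the adjoint exists.\<close>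

lemma riesz_representation:
  fixes f :: "ell2 \<Rightarrow> complex"
  assumes Y: "closed Y" "cvs.subspace Y"
    and add: "\<And>x y. x \<in> Y \<Longrightarrow> y \<in> Y \<Longrightarrow> f (x + y) = f x + f y"
    and scale: "\<And>c x. x \<in> Y \<Longrightarrow> f (c *\<^sub>C x) = c * f x"
    and bound: "\<And>x. x \<in> Y \<Longrightarrow> cmod (f x) \<le> norm x * B"
  shows "\<exists>w\<in>Y. \<forall>y\<in>Y. f y = cinner y w"
proof -
  define J where "J w = (norm w)\<^sup>2 - 2 * Re (f w)" for w
  define m where "m = Inf (J ` Y)"
  have Y_add: "x + y \<in> Y" and Y_scale: "c *\<^sub>C x \<in> Y" if "x \<in> Y" "y \<in> Y" for x y c
    using that by (auto intro: cvs.subspace_add[OF Y(2)] cvs.subspace_scale[OF Y(2)])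
  have Y_scaleR: "r *\<^sub>R x \<in> Y" if "x \<in> Y" for x and r :: real
    using that by (simp add: scaleR_scaleC Y_scale)
  have Y_diff: "x - y \<in> Y" if "x \<in> Y" "y \<in> Y" for x y
    using that by (rule cvs.subspace_diff[OF Y(2)])
  have scaleR: "f (r *\<^sub>R x) = of_real r * f x" if "x \<in> Y" for x and r :: real
    using that by (simp add: scaleR_scaleC scale)
  have diff: "f (x - y) = f x - f y" if "x \<in> Y" "y \<in> Y" for x y
    using add[OF Y_diff[OF that] that(2)] by simp
  have J_lower: "- (B\<^sup>2) \<le> J x" if "x \<in> Y" for x
  proof -
    have "Re (f x) \<le> norm x * B"
      using bound[OF that] complex_Re_le_cmod[of "f x"] by linarith
    then show ?thesis
      using sum_squares_bound[of "norm x" B] by (simp add: J_def)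
  qed
  then have bdd: "bdd_below (J ` Y)" by (intro bdd_belowI[of _ "- (B\<^sup>2)"]) auto
  have J_ge: "m \<le> J x" if "x \<in> Y" for x
    unfolding m_def using that by (intro cInf_lower bdd) auto
  have "Y \<noteq> {}" using cvs.subspace_0[OF Y(2)] by auto
  have "\<exists>x\<in>Y. J x < m + e" if "0 < e" for e
  proof -
    have "Inf (J ` Y) < m + e" using that by (simp add: m_def)
    then show ?thesis using cInf_less_iff[of "J ` Y" "m + e"] \<open>Y \<noteq> {}\<close> bdd by auto
  qed
  then have "\<forall>n. \<exists>x. x \<in> Y \<and> J x < m + inverse (real (Suc n))"
    by (meson inverse_positive_iff_positive of_nat_0_less_iff zero_less_Suc)
  from choice[OF this] obtain s where s: "\<And>n. s n \<in> Y" "\<And>n. J (s n) < m + inverse (real (Suc n))"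
    by blast
  have arith: "2 * a + 2 * b - 4 * c \<le> 2 * (m + p) + 2 * (m + q) - 4 * m"
    if "a < m + p" "b < m + q" "m \<le> c" for a b c p q :: real
    using that by simp
  have s_diff: "(norm (s n - s k))\<^sup>2 \<le> 2 * inverse (real (Suc n)) + 2 * inverse (real (Suc k))" for n k
  proof -
    have "f ((1/2) *\<^sub>R (s n + s k)) = (1/2) * (f (s n) + f (s k))"
      using scaleR[OF Y_add[OF s(1) s(1)], of "1/2"] by (simp add: add s(1))
    then have "(norm (s n - s k))\<^sup>2 = 2 * J (s n) + 2 * J (s k) - 4 * J ((1/2) *\<^sub>R (s n + s k))"
      unfolding J_def by (simp add: power2_norm_eq_inner inner_add_left inner_add_right
          inner_diff_left inner_diff_right inner_commute algebra_simps)
    also have "\<dots> \<le> 2 * (m + inverse (real (Suc n))) + 2 * (m + inverse (real (Suc k))) - 4 * m"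
      by (rule arith[OF s(2) s(2) J_ge[OF Y_scaleR[OF Y_add[OF s(1) s(1)]]]])
    finally show ?thesis by simp
  qed
  have "Cauchy s"
  proof (rule metric_CauchyI)
    fix e :: real assume "0 < e"
    then obtain M where M: "inverse (real (Suc M)) < e\<^sup>2 / 4"
      using reals_Archimedean[of "e\<^sup>2 / 4"] by auto
    have "dist (s n) (s k) < e" if "n \<ge> M" "k \<ge> M" for n k
    proof -
      have "inverse (real (Suc n)) \<le> inverse (real (Suc M))"
        "inverse (real (Suc k)) \<le> inverse (real (Suc M))" using that by auto
      then have "(norm (s n - s k))\<^sup>2 < e\<^sup>2" using s_diff[of n k] M by linarith
      then show ?thesis using \<open>0 < e\<close> by (simp add: dist_norm power2_less_imp_less)
    qed
    then show "\<exists>M. \<forall>n\<ge>M. \<forall>k\<ge>M. dist (s n) (s k) < e" by blast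
  qed
  then obtain w where w: "s \<longlonglongrightarrow> w" using Cauchy_convergent convergent_def by blast
  have "w \<in> Y" using Y(1) s(1) w by (rule closed_sequentially)
  have "(\<lambda>n. f (s n)) \<longlonglongrightarrow> f w"
  proof (rule LIM_zero_cancel, rule Lim_null_comparison)
    show "\<forall>\<^sub>F n in sequentially. norm (f (s n) - f w) \<le> norm (s n - w) * B"
      using bound[OF Y_diff[OF s(1) \<open>w \<in> Y\<close>]] by (simp add: diff s(1) \<open>w \<in> Y\<close>)
    show "(\<lambda>n. norm (s n - w) * B) \<longlonglongrightarrow> 0"
      using w by (intro tendsto_mult_left_zero tendsto_norm_zero LIM_zero)
  qed
  then have "(\<lambda>n. J (s n)) \<longlonglongrightarrow> J w"
    unfolding J_def by (intro tendsto_intros w)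
  moreover have "(\<lambda>n. m + inverse (real (Suc n))) \<longlonglongrightarrow> m + 0"
    by (intro tendsto_intros LIMSEQ_inverse_real_of_nat)
  ultimately have "J w \<le> m + 0"
    by (rule LIMSEQ_le) (use s(2) less_imp_le in blast)
  have Re_eq: "Re (f y) = Re (cinner y w)" if "y \<in> Y" for y
  proof -
    define g where "g = inner w y - Re (f y)"
    \<comment> \<open>A step against the gradient \<open>g\<close>, with the length normalized to avoid the case \<open>y = 0\<close>.\<close>
    define t where "t = - g / ((norm y)\<^sup>2 + 1)"
    have pos: "0 < (norm y)\<^sup>2 + 1" by (simp add: add_nonneg_pos)
    have "J w \<le> J (w + t *\<^sub>R y)"
      using J_ge[OF Y_add[OF \<open>w \<in> Y\<close> Y_scaleR[OF that]], of t] \<open>J w \<le> m + 0\<close> by linarith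
    also have "J (w + t *\<^sub>R y) = J w + (t * t * (norm y)\<^sup>2 + 2 * t * g)"
      using that \<open>w \<in> Y\<close> unfolding J_def g_def
      by (simp add: add Y_scaleR scaleR power2_norm_eq_inner inner_add_left inner_add_right
          inner_commute algebra_simps)
    finally have "0 \<le> t * t * (norm y)\<^sup>2 + 2 * t * g" by simp
    also have "\<dots> = - (g\<^sup>2 * ((norm y)\<^sup>2 + 2)) / ((norm y)\<^sup>2 + 1)\<^sup>2"
      using pos by (simp add: t_def divide_simps power2_eq_square) (simp add: algebra_simps)
    finally have "g\<^sup>2 * ((norm y)\<^sup>2 + 2) \<le> 0"
      using pos by (simp add: divide_simps)
    then have "g = 0"
      by (smt (verit) mult_pos_pos zero_less_power2 zero_le_power2)
    then show ?thesis by (simp add: g_def inner_ell2_def inner_commute flip: inner_ell2_def)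
  qed
  have "f y = cinner y w" if "y \<in> Y" for y
  proof (rule complex_eqI)
    show "Re (f y) = Re (cinner y w)" by (rule Re_eq[OF that])
    have "Re (\<i> * f y) = Re (\<i> * cinner y w)"
      using Re_eq[OF Y_scale[OF that that], of \<i>] by (simp add: scale that cinner_scaleC_left)
    then show "Im (f y) = Im (cinner y w)" by simp
  qed
  then show ?thesis using \<open>w \<in> Y\<close> by blast
qed

lemma clinear_on_diff:
  fixes T :: "ell2 \<Rightarrow> ell2"
  assumes "clinear_on Y T" "cvs.subspace Y" "x \<in> Y" "y \<in> Y"
  shows "T (x - y) = T x - T y"
proof -
  have "x - y \<in> Y" using assms by (intro cvs.subspace_diff)
  then have "T ((x - y) + y) = T (x - y) + T y"
    using assms unfolding clinear_on_def by blast
  then show ?thesis by simp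
qed

lemma adjoint_on:
  assumes Y: "closed Y" "cvs.subspace Y" and A: "compact_contraction Y A"
  shows "adjoint_on Y A z \<in> Y" "y \<in> Y \<Longrightarrow> cinner (A y) z = cinner y (adjoint_on Y A z)"
    and adjoint_on_unique: "v \<in> Y \<Longrightarrow> (\<And>y. y \<in> Y \<Longrightarrow> cinner (A y) z = cinner y v) \<Longrightarrow> adjoint_on Y A z = v"
proof -
  have A': "clinear_on Y A" "\<And>y. y \<in> Y \<Longrightarrow> norm (A y) \<le> norm y"
    using A by (auto simp: compact_contraction_def)
  have "\<exists>w\<in>Y. \<forall>y\<in>Y. cinner (A y) z = cinner y w"
  proof (rule riesz_representation[OF Y, where B = "norm z"])
    fix x assume "x \<in> Y"
    then show "cmod (cinner (A x) z) \<le> norm x * norm z"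
      by (intro order_trans[OF cinner_Cauchy_Schwarz] mult_right_mono A') auto
  qed (use A'(1) in \<open>auto simp: clinear_on_def cinner_add_left cinner_scaleC_left\<close>)
  moreover have unique: "w = w'"
    if "w \<in> Y" "w' \<in> Y" "\<And>y. y \<in> Y \<Longrightarrow> cinner (A y) z = cinner y w" "\<And>y. y \<in> Y \<Longrightarrow> cinner (A y) z = cinner y w'"
    for w w'
  proof -
    have "w - w' \<in> Y" using that by (intro cvs.subspace_diff Y)
    then have "cinner (w - w') (w - w') = 0"
      using that(3,4)[of "w - w'"] by (simp add: cinner_diff_right)
    then show ?thesis by (simp add: cinner_norm_sq)
  qed
  ultimately have "\<exists>!w. w \<in> Y \<and> (\<forall>y\<in>Y. cinner (A y) z = cinner y w)" by blast
  from theI'[OF this] have *: "adjoint_on Y A z \<in> Y \<and> (\<forall>y\<in>Y. cinner (A y) z = cinner y (adjoint_on Y A z))"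
    unfolding adjoint_on_def .
  then show "adjoint_on Y A z \<in> Y" "y \<in> Y \<Longrightarrow> cinner (A y) z = cinner y (adjoint_on Y A z)" by blast+
  show "adjoint_on Y A z = v" if "v \<in> Y" "\<And>y. y \<in> Y \<Longrightarrow> cinner (A y) z = cinner y v"
    using * that unique by blast
qed

text \<open>From \<open>(T + s) (T - s) f = 0\<close> the vector \<open>g = (T - s) f\<close> satisfies \<open>T g = - s g\<close>, so \<open>g = 0\<close> by
positivity. This identifies eigenvectors of \<open>T = |A|\<close> without uniqueness of square roots.\<close>

lemma modulus_on_eigenvector:
  assumes Y: "cvs.subspace Y" and T: "modulus_on Y A T"
    and f: "f \<in> Y" "adjoint_on Y A (A f) = complex_of_real (s\<^sup>2) *\<^sub>C f" and "0 < s"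
  shows "T f = s *\<^sub>R f"
proof -
  have T': "clinear_on Y T" "\<And>y. y \<in> Y \<Longrightarrow> T y \<in> Y" "\<And>y. y \<in> Y \<Longrightarrow> cinner (T y) y \<in> \<real>\<^sub>\<ge>\<^sub>0"
    "\<And>y. y \<in> Y \<Longrightarrow> T (T y) = adjoint_on Y A (A y)"
    using T by (auto simp: modulus_on_def)
  define c where "c = complex_of_real s"
  define g where "g = T f - c *\<^sub>C f"
  have cf: "c *\<^sub>C f \<in> Y" using f(1) by (rule cvs.subspace_scale[OF Y])
  have g: "g \<in> Y" unfolding g_def using T'(2)[OF f(1)] cf by (rule cvs.subspace_diff[OF Y])
  have "T g = T (T f) - T (c *\<^sub>C f)"
    unfolding g_def by (rule clinear_on_diff[OF T'(1) Y T'(2)[OF f(1)] cf])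
  also have "T (T f) = (c * c) *\<^sub>C f"
    using T'(4)[OF f(1)] f(2) by (simp add: c_def power2_eq_square)
  also have "T (c *\<^sub>C f) = c *\<^sub>C T f"
    using T'(1) f(1) by (simp add: clinear_on_def)
  also have "(c * c) *\<^sub>C f - c *\<^sub>C T f = (- c) *\<^sub>C g"
    by (simp add: g_def cvs.scale_right_diff_distrib scaleC_scaleC)
  finally have "cinner (T g) g = - c * cinner g g" by (simp only: cinner_scaleC_left)
  also have "\<dots> = complex_of_real (- (s * (norm g)\<^sup>2))" by (simp add: c_def cinner_norm_sq)
  finally have "0 \<le> - (s * (norm g)\<^sup>2)"
    using T'(3)[OF g] by (metis nonneg_Reals_of_real_iff)
  then have "(norm g)\<^sup>2 \<le> 0"
    using \<open>0 < s\<close> by (simp add: mult_le_0_iff)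
  then have "g = 0" by simp
  then show ?thesis by (simp add: g_def c_def scaleR_scaleC)
qed

text \<open>The eigenvectors satisfy \<open>A\<^sup>* A (\<xi> i) = s\<^sup>2 \<xi> i\<close>, hence \<open>\<langle>A (\<xi> j), A (\<xi> i)\<rangle> = s\<^sup>2 \<langle>\<xi> j, \<xi> i\<rangle>\<close>. Injectivity of \<open>A\<close>
rules out the part of the system that spans the kernel.\<close>

lemma eigen_system_orthogonal:
  assumes Y: "closed Y" "cvs.subspace Y" and A: "compact_contraction Y A"
    and inj: "\<forall>y\<in>Y. A y = 0 \<longrightarrow> y = 0" and E: "eigen_system Y A I \<xi>"
  shows "\<exists>T. (modulus_on Y A T) \<and>
    (orthonormal_family I \<xi>) \<and>
    (\<forall>i\<in>I. \<xi> i \<in> Y) \<and>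
    (\<forall>i\<in>I. \<forall>j\<in>I. i \<noteq> j \<longrightarrow> cinner (A (\<xi> i)) (A (\<xi> j)) = 0) \<and>
    (\<forall>i\<in>I. \<forall>s>0. T (\<xi> i) = s *\<^sub>R \<xi> i \<longrightarrow> norm (A (\<xi> i)) = s) \<and>
    (\<forall>s>0. closure (cvs.span (\<xi> ` {i \<in> I. T (\<xi> i) = s *\<^sub>R \<xi> i})) = {y \<in> Y. T y = s *\<^sub>R y})"
proof -
  obtain T I0 I1 where T: "modulus_on Y A T" and I: "I = I0 \<union> I1"
    and on: "orthonormal_family I1 \<xi>" "orthonormal_family I0 \<xi>"
    and ev: "\<forall>i\<in>I1. \<xi> i \<in> Y \<and> (\<exists>s>0. T (\<xi> i) = s *\<^sub>R \<xi> i)"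
    and full: "\<forall>s>0. closure (cvs.span (\<xi> ` {i \<in> I1. T (\<xi> i) = s *\<^sub>R \<xi> i})) = {y \<in> Y. T y = s *\<^sub>R y}"
    and ker: "closure (cvs.span (\<xi> ` I0)) = {y \<in> Y. A y = 0}"
    using E unfolding eigen_system_def by (elim exE conjE) (rule that; assumption)
  have "I0 = {}"
  proof (rule ccontr)
    assume "I0 \<noteq> {}"
    then obtain i where i: "i \<in> I0" by blast
    then have "\<xi> i \<in> closure (cvs.span (\<xi> ` I0))"
      by (intro subsetD[OF closure_subset] cvs.span_base imageI)
    then have "\<xi> i = 0" unfolding ker using inj by simp
    moreover have "cinner (\<xi> i) (\<xi> i) = 1" using on(2) i by (simp add: orthonormal_family_def)
    ultimately show False by simp
  qed
  then have I1: "I1 = I" using I by simp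
  have adj: "adjoint_on Y A (A (\<xi> i)) = complex_of_real (s\<^sup>2) *\<^sub>C \<xi> i"
    if "i \<in> I" "T (\<xi> i) = s *\<^sub>R \<xi> i" for i s
  proof -
    have "\<xi> i \<in> Y" using ev that I1 by blast
    then have "adjoint_on Y A (A (\<xi> i)) = T (T (\<xi> i))" using T by (simp add: modulus_on_def)
    also have "\<dots> = T (s *\<^sub>R \<xi> i)" by (simp only: that(2))
    also have "\<dots> = complex_of_real s *\<^sub>C T (\<xi> i)"
      using T \<open>\<xi> i \<in> Y\<close> by (simp add: modulus_on_def clinear_on_def scaleR_scaleC)
    finally show ?thesis by (simp add: that(2) scaleR_scaleC scaleC_scaleC power2_eq_square)
  qed
  have cin: "cinner (A (\<xi> j)) (A (\<xi> i)) = complex_of_real (s\<^sup>2) * (if i = j then 1 else 0)"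
    if "i \<in> I" "j \<in> I" "T (\<xi> i) = s *\<^sub>R \<xi> i" for i j s
  proof -
    have "\<xi> j \<in> Y" using ev that I1 by blast
    then have "cinner (A (\<xi> j)) (A (\<xi> i)) = cinner (\<xi> j) (adjoint_on Y A (A (\<xi> i)))"
      by (rule adjoint_on(2)[OF Y A])
    also have "\<dots> = complex_of_real (s\<^sup>2) * cinner (\<xi> j) (\<xi> i)"
      unfolding adj[OF that(1,3)] by (simp add: cinner_scaleC_right)
    finally show ?thesis using on(1) that by (auto simp: orthonormal_family_def I1)
  qed
  show ?thesis
  proof (intro exI[of _ T] conjI ballI allI impI T)
    show "orthonormal_family I \<xi>" using on(1) I1 by simp
    show "\<xi> i \<in> Y" if "i \<in> I" for i using ev that I1 by blast
    show "cinner (A (\<xi> i)) (A (\<xi> j)) = 0" if ij: "i \<in> I" "j \<in> I" "i \<noteq> j" for i j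
    proof -
      obtain s where "T (\<xi> j) = s *\<^sub>R \<xi> j" using ev ij(2) I1 by blast
      from cin[OF ij(2,1) this] show ?thesis using ij(3) by simp
    qed
    show "norm (A (\<xi> i)) = s" if "i \<in> I" "0 < s" "T (\<xi> i) = s *\<^sub>R \<xi> i" for i s
    proof -
      have "complex_of_real ((norm (A (\<xi> i)))\<^sup>2) = complex_of_real (s\<^sup>2)"
        using cin[OF that(1,1,3)] by (simp only: cinner_norm_sq) simp
      then have "(norm (A (\<xi> i)))\<^sup>2 = s\<^sup>2" by (simp only: of_real_eq_iff)
      then show ?thesis by (rule power2_eq_imp_eq) (simp_all add: less_imp_le[OF that(2)])
    qed
    show "closure (cvs.span (\<xi> ` {i \<in> I. T (\<xi> i) = s *\<^sub>R \<xi> i})) = {y \<in> Y. T y = s *\<^sub>R y}"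
      if "0 < s" for s using full[rule_format, OF that] I1 by simp
  qed
qed

text \<open>The families for which the norm of a finite sum is that of the diagonal model.\<close>

definition diagonal_family :: "'i set \<Rightarrow> ('i \<Rightarrow> ell2 \<times> ell2) \<Rightarrow> bool" where
  "diagonal_family I x \<longleftrightarrow> (\<forall>i\<in>I. norm (fst (x i)) = 1) \<and>
     (\<forall>i\<in>I. \<forall>j\<in>I. i \<noteq> j \<longrightarrow> cinner (fst (x i)) (fst (x j)) = 0 \<and> cinner (snd (x i)) (snd (x j)) = 0)"

lemma orthonormal_family_norm: "orthonormal_family I \<xi> \<Longrightarrow> i \<in> I \<Longrightarrow> norm (\<xi> i) = 1"
proof -
  assume "orthonormal_family I \<xi>" "i \<in> I"
  then have "cinner (\<xi> i) (\<xi> i) = 1" by (simp add: orthonormal_family_def)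
  then have "complex_of_real ((norm (\<xi> i))\<^sup>2) = complex_of_real 1"
    by (simp only: cinner_norm_sq of_real_1)
  then have "(norm (\<xi> i))\<^sup>2 = 1\<^sup>2" by (simp only: of_real_eq_iff one_power2)
  then show "norm (\<xi> i) = 1" by (rule power2_eq_imp_eq) auto
qed

lemma canonical_basis_diagonal:
  assumes \<alpha>: "0 < \<alpha>" and Z: "Z \<subseteq> X_space UNIV (diag_op \<alpha>)" and x: "canonical_basis Z I x"
  shows "diagonal_family I x" "\<And>i. i \<in> I \<Longrightarrow> x i \<in> X_space UNIV (diag_op \<alpha>)"
proof -
  obtain Y A \<xi> where Y: "closed Y" "cvs.subspace Y" and A: "compact_contraction Y A"
    and Z': "Z = X_space Y A" and E: "eigen_system Y A I \<xi>" and x': "\<And>i. i \<in> I \<Longrightarrow> x i = (\<xi> i, A (\<xi> i))"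
    using x unfolding canonical_basis_def by blast
  have AD: "A y = diag_op \<alpha> y" if "y \<in> Y" for y
    using Z that unfolding Z' X_space_def by blast
  then have inj: "\<forall>y\<in>Y. A y = 0 \<longrightarrow> y = 0"
    by (simp add: diag_op_eq_0_iff[OF \<alpha>])
  obtain T where T: "modulus_on Y A T"
    "orthonormal_family I \<xi>"
    "\<forall>i\<in>I. \<xi> i \<in> Y"
    "\<forall>i\<in>I. \<forall>j\<in>I. i \<noteq> j \<longrightarrow> cinner (A (\<xi> i)) (A (\<xi> j)) = 0"
    "\<forall>i\<in>I. \<forall>s>0. T (\<xi> i) = s *\<^sub>R \<xi> i \<longrightarrow> norm (A (\<xi> i)) = s"
    "\<forall>s>0. closure (cvs.span (\<xi> ` {i \<in> I. T (\<xi> i) = s *\<^sub>R \<xi> i})) = {y \<in> Y. T y = s *\<^sub>R y}"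
    using eigen_system_orthogonal[OF Y A inj E] by (elim exE conjE) (rule that; assumption)
  show "diagonal_family I x"
    using T(2,4) orthonormal_family_norm[OF T(2)] x'
    by (simp add: diagonal_family_def orthonormal_family_def)
  show "x i \<in> X_space UNIV (diag_op \<alpha>)" if "i \<in> I" for i
    using x'[OF that] T(3) that AD by (simp add: X_space_def)
qed

text \<open>The \<open>k\<close>-th unit vector is an eigenvector of \<open>A\<^sup>* A\<close>, hence of \<open>|A|\<close> with eigenvalue \<open>weight \<alpha> k\<close>. So the
eigenspace is not zero, and some vector of the basis must span part of it. Distinct weights have
distinct vectors.\<close>

lemma canonical_basis_weights:
  assumes \<alpha>: "0 < \<alpha>" and y: "canonical_basis (X_space UNIV (diag_op \<alpha>)) J y"
  shows "\<exists>\<sigma>. inj \<sigma> \<and> range \<sigma> \<subseteq> J \<and> (\<forall>k. norm (snd (y (\<sigma> k))) = weight \<alpha> k)"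
proof -
  obtain Y A \<xi> where Y: "closed Y" "cvs.subspace Y" and A: "compact_contraction Y A"
    and Z: "X_space UNIV (diag_op \<alpha>) = X_space Y A" and E: "eigen_system Y A J \<xi>"
    and y': "\<And>i. i \<in> J \<Longrightarrow> y i = (\<xi> i, A (\<xi> i))"
    using y unfolding canonical_basis_def by blast
  have "(v, diag_op \<alpha> v) \<in> X_space Y A" for v
    unfolding Z[symmetric] by (simp add: X_space_def)
  then have YA: "v \<in> Y" "A v = diag_op \<alpha> v" for v
    by (auto simp: X_space_def)
  have inj: "\<forall>v\<in>Y. A v = 0 \<longrightarrow> v = 0"
    by (simp add: YA diag_op_eq_0_iff[OF \<alpha>])
  obtain T where T: "modulus_on Y A T"
    "orthonormal_family J \<xi>"
    "\<forall>i\<in>J. \<xi> i \<in> Y"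
    "\<forall>i\<in>J. \<forall>j\<in>J. i \<noteq> j \<longrightarrow> cinner (A (\<xi> i)) (A (\<xi> j)) = 0"
    "\<forall>i\<in>J. \<forall>s>0. T (\<xi> i) = s *\<^sub>R \<xi> i \<longrightarrow> norm (A (\<xi> i)) = s"
    "\<forall>s>0. closure (cvs.span (\<xi> ` {i \<in> J. T (\<xi> i) = s *\<^sub>R \<xi> i})) = {y \<in> Y. T y = s *\<^sub>R y}"
    using eigen_system_orthogonal[OF Y A inj E] by (elim exE conjE) (rule that; assumption)
  have "\<exists>i\<in>J. norm (A (\<xi> i)) = weight \<alpha> k" for k
  proof -
    define f where "f = unit_vec2 k"
    define w where "w = weight \<alpha> k"
    have "f \<noteq> 0" unfolding f_def using norm_unit_vec2[OF \<alpha>, of k] by auto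
    have w: "0 < w" by (simp add: w_def weight_pos)
    have "adjoint_on Y A (A f) = complex_of_real (w\<^sup>2) *\<^sub>C f"
    proof (rule adjoint_on_unique[OF Y A])
      fix u
      have "cinner (diag_op \<alpha> u) (complex_of_real w *\<^sub>C f) = complex_of_real w * cinner u (complex_of_real w *\<^sub>C f)"
        using diag_op_symmetric[OF \<alpha>, of u f]
        by (simp add: cinner_scaleC_right f_def w_def diag_op_unit_vec2[OF \<alpha>])
      then show "cinner (A u) (A f) = cinner u (complex_of_real (w\<^sup>2) *\<^sub>C f)"
        unfolding YA(2) f_def diag_op_unit_vec2[OF \<alpha>] w_def[symmetric]
        by (simp add: cinner_scaleC_right power2_eq_square)
    qed (rule YA)
    then have "T f = w *\<^sub>R f"
      by (rule modulus_on_eigenvector[OF Y(2) T(1) YA(1) _ w])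
    then have mem: "f \<in> closure (cvs.span (\<xi> ` {i \<in> J. T (\<xi> i) = w *\<^sub>R \<xi> i}))"
      unfolding T(6)[rule_format, OF w] using YA(1) by blast
    have "{i \<in> J. T (\<xi> i) = w *\<^sub>R \<xi> i} \<noteq> {}"
    proof
      assume none: "{i \<in> J. T (\<xi> i) = w *\<^sub>R \<xi> i} = {}"
      have "f \<in> closure {0}" using mem unfolding none by simp
      then show False using \<open>f \<noteq> 0\<close> by simp
    qed
    then show ?thesis using T(5) w unfolding w_def by blast
  qed
  then have "\<forall>k. \<exists>i. i \<in> J \<and> norm (A (\<xi> i)) = weight \<alpha> k" by blast
  from choice[OF this] obtain \<sigma> where \<sigma>: "\<And>k. \<sigma> k \<in> J" "\<And>k. norm (A (\<xi> (\<sigma> k))) = weight \<alpha> k" by blast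
  have "inj \<sigma>"
  proof (rule injI)
    fix k l assume "\<sigma> k = \<sigma> l"
    then have "weight \<alpha> k = weight \<alpha> l" using \<sigma>(2) by metis
    then show "k = l" using weight_inject[OF \<alpha>] by simp
  qed
  then show ?thesis using \<sigma> y' by (intro exI[of _ \<sigma>]) auto
qed

lemma norm_sq_orthogonal_sum:
  fixes z :: "'i \<Rightarrow> ell2"
  assumes "finite F" "\<And>i j. i \<in> F \<Longrightarrow> j \<in> F \<Longrightarrow> i \<noteq> j \<Longrightarrow> cinner (z i) (z j) = 0"
  shows "(norm (\<Sum>i\<in>F. c i *\<^sub>C z i))\<^sup>2 = (\<Sum>i\<in>F. (cmod (c i) * norm (z i))\<^sup>2)"
  using assms
proof (induction F)
  case (insert j F)
  have "cinner (c j *\<^sub>C z j) (\<Sum>i\<in>F. c i *\<^sub>C z i) = (\<Sum>i\<in>F. c j * (cnj (c i) * cinner (z j) (z i)))"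
    by (simp add: cinner_sum_right cinner_scaleC_left cinner_scaleC_right mult.left_commute)
  also have "\<dots> = 0" using insert.prems insert.hyps by (intro sum.neutral) auto
  finally have "inner (c j *\<^sub>C z j) (\<Sum>i\<in>F. c i *\<^sub>C z i) = 0" by (simp add: inner_ell2_def)
  then have "(norm (c j *\<^sub>C z j + (\<Sum>i\<in>F. c i *\<^sub>C z i)))\<^sup>2
      = (norm (c j *\<^sub>C z j))\<^sup>2 + (norm (\<Sum>i\<in>F. c i *\<^sub>C z i))\<^sup>2"
    by (simp add: power2_norm_eq_inner inner_add_left inner_add_right inner_commute)
  also have "(norm (\<Sum>i\<in>F. c i *\<^sub>C z i))\<^sup>2 = (\<Sum>i\<in>F. (cmod (c i) * norm (z i))\<^sup>2)"
    using insert by blast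
  finally show ?case using insert.hyps by (simp add: norm_scaleC)
qed simp

lemma diagonal_family_sq:
  assumes "diagonal_family I x" "finite F" "F \<subseteq> I"
  shows "row_sq n (tensor_sum n F a x) v = (\<Sum>m<n. \<Sum>i\<in>F. (cmod (vec_mat_entry n (a i) v m))\<^sup>2)"
    and "col_sq n (tensor_sum n F a x) v = (\<Sum>m<n. \<Sum>i\<in>F. (cmod (mat_vec_entry n (a i) v m) * norm (snd (x i)))\<^sup>2)"
proof -
  have "(\<Sum>i\<in>F. (cmod (c i) * norm (fst (x i)))\<^sup>2) = (\<Sum>i\<in>F. (cmod (c i))\<^sup>2)" for c
    using assms by (intro sum.cong) (auto simp: diagonal_family_def)
  moreover have "(norm (\<Sum>i\<in>F. c i *\<^sub>C fst (x i)))\<^sup>2 = (\<Sum>i\<in>F. (cmod (c i) * norm (fst (x i)))\<^sup>2)" for c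
    using assms by (intro norm_sq_orthogonal_sum) (auto simp: diagonal_family_def subset_eq)
  ultimately show "row_sq n (tensor_sum n F a x) v = (\<Sum>m<n. \<Sum>i\<in>F. (cmod (vec_mat_entry n (a i) v m))\<^sup>2)"
    unfolding row_sq_tensor_sum by simp
  have "(norm (\<Sum>i\<in>F. c i *\<^sub>C snd (x i)))\<^sup>2 = (\<Sum>i\<in>F. (cmod (c i) * norm (snd (x i)))\<^sup>2)" for c
    using assms by (intro norm_sq_orthogonal_sum) (auto simp: diagonal_family_def subset_eq)
  then show "col_sq n (tensor_sum n F a x) v
      = (\<Sum>m<n. \<Sum>i\<in>F. (cmod (mat_vec_entry n (a i) v m) * norm (snd (x i)))\<^sup>2)"
    unfolding col_sq_tensor_sum by simp
qed

lemma diagonal_family_unconditional: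
  assumes x: "diagonal_family I x"
  shows "completely_unconditional 1 I x"
  unfolding completely_unconditional_def
proof (intro allI impI, elim conjE)
  fix n F and a :: "'a \<Rightarrow> complex mat" and \<mu> :: "'a \<Rightarrow> complex"
  assume F: "finite F" "F \<subseteq> I" and a\<mu>: "\<forall>i\<in>F. a i \<in> carrier_mat n n \<and> cmod (\<mu> i) \<le> 1"
  define \<rho> where "\<rho> = opsp_norm (tensor_sum n F a x)"
  have \<rho>: "0 \<le> \<rho>" unfolding \<rho>_def by (rule opsp_norm_nonneg[OF tensor_sum_carrier])
  have est: "row_sq n (tensor_sum n F a x) v \<le> \<rho>\<^sup>2 * vec_norm_sq n v" "col_sq n (tensor_sum n F a x) v \<le> \<rho>\<^sup>2 * vec_norm_sq n v" for v
    using opsp_norm_le_iff[OF tensor_sum_carrier \<rho>, of n F a x] by (auto simp: \<rho>_def)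
  have contract: "(cmod (\<mu> i * z) * t)\<^sup>2 \<le> (cmod z * t)\<^sup>2" if "i \<in> F" "0 \<le> t" for i z t
    using a\<mu> that unfolding norm_mult
    by (intro power_mono mult_right_mono mult_left_le_one_le) auto
  have "row_sq n (tensor_sum n F (\<lambda>i. \<mu> i \<cdot>\<^sub>m a i) x) v \<le> row_sq n (tensor_sum n F a x) v" for v
    unfolding diagonal_family_sq(1)[OF x F]
    using a\<mu> contract[of _ 1] by (intro sum_mono) (auto simp: vec_mat_entry_smult)
  moreover have "col_sq n (tensor_sum n F (\<lambda>i. \<mu> i \<cdot>\<^sub>m a i) x) v \<le> col_sq n (tensor_sum n F a x) v" for v
    unfolding diagonal_family_sq(2)[OF x F]
    using a\<mu> contract by (intro sum_mono) (auto simp: mat_vec_entry_smult)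
  ultimately have "opsp_norm (tensor_sum n F (\<lambda>i. \<mu> i \<cdot>\<^sub>m a i) x) \<le> \<rho>"
    using est by (subst opsp_norm_le_iff[OF tensor_sum_carrier \<rho>]) (meson order_trans)
  then show "opsp_norm (tensor_sum n F (\<lambda>i. \<mu> i \<cdot>\<^sub>m a i) x) \<le> 1 * opsp_norm (tensor_sum n F a x)"
    by (simp add: \<rho>_def)
qed

section \<open>Unconditional families and the canonical basis\<close>

text \<open>The diagonal model of \<open>x\<close> has the numbers \<open>norm (snd (x i))\<close>, and the family \<open>z\<close> of matched canonical
basis vectors is its own diagonal model with the matched weights; comparing the two families reduces to
comparing these numbers.\<close>

lemma cu_family_equivalent:
  assumes x: "cu_family (diag_op \<alpha>) C I x" and \<alpha>: "0 < \<alpha>" "\<alpha> < 1 / 2"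
    and a: "4 powr \<alpha> / sqrt (1 - 2 * \<alpha>) \<le> a"
    and y: "canonical_basis (X_space UNIV (diag_op \<alpha>)) J y"
  shows "equivalent_to_subfamily (a * C ^ 4) I x J y"
proof -
  interpret cu_family "diag_op \<alpha>" C I x by (rule x)
  obtain \<pi> where \<pi>: "inj_on \<pi> I" "\<forall>i\<in>I. weight \<alpha> (\<pi> i) \<le> norm (snd (x i)) \<and>
      norm (snd (x i)) \<le> 4 powr \<alpha> * (C / sqrt (1 - 2 * \<alpha>)) * weight \<alpha> (\<pi> i)"
    using weight_matching[OF refl \<alpha>] by blast
  obtain \<sigma> where \<sigma>: "inj \<sigma>" "range \<sigma> \<subseteq> J" "\<forall>k. norm (snd (y (\<sigma> k))) = weight \<alpha> k"
    using canonical_basis_weights[OF \<alpha>(1) y] by blast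
  define \<tau> where "\<tau> i = \<sigma> (\<pi> i)" for i
  define z where "z i = y (\<tau> i)" for i
  \<comment> \<open>\<open>\<kappa>\<close> bounds the loss in \<open>weight_matching\<close>; the diagonal model of \<open>x\<close> costs another \<open>C ^ 3\<close>.\<close>
  define \<kappa> where "\<kappa> = a * C"
  have inj: "inj_on \<tau> I"
    using \<pi>(1) \<sigma>(1) by (auto simp: inj_on_def \<tau>_def)
  have \<tau>J: "\<tau> ` I \<subseteq> J" using \<sigma>(2) by (auto simp: \<tau>_def)
  have diag: "diagonal_family I z"
  proof -
    have dy: "diagonal_family J y" by (rule canonical_basis_diagonal(1)[OF \<alpha>(1) subset_refl y])
    have "\<tau> i \<in> J" if "i \<in> I" for i using \<tau>J that by blast
    moreover have "\<tau> i \<noteq> \<tau> j" if "i \<in> I" "j \<in> I" "i \<noteq> j" for i j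
      using inj_onD[OF inj _ that(1,2)] that(3) by blast
    ultimately show ?thesis using dy by (simp add: diagonal_family_def z_def)
  qed
  have lower: "norm (snd (z i)) \<le> norm (snd (x i))" if "i \<in> I" for i
    using \<pi>(2) \<sigma>(3) that by (simp add: z_def \<tau>_def)
  have upper: "norm (snd (x i)) \<le> \<kappa> * norm (snd (z i))" if "i \<in> I" for i
  proof -
    have "4 powr \<alpha> * (C / sqrt (1 - 2 * \<alpha>)) \<le> \<kappa>"
      using mult_right_mono[OF a, of C] C by (simp add: \<kappa>_def)
    then have "4 powr \<alpha> * (C / sqrt (1 - 2 * \<alpha>)) * weight \<alpha> (\<pi> i) \<le> \<kappa> * weight \<alpha> (\<pi> i)"
      using weight_pos[of \<alpha> "\<pi> i"] by (intro mult_right_mono) auto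
    then show ?thesis
      using \<pi>(2) \<sigma>(3) that by (fastforce simp: z_def \<tau>_def)
  qed
  have "1 \<le> 4 powr \<alpha> / sqrt (1 - 2 * \<alpha>)"
  proof -
    have "sqrt (1 - 2 * \<alpha>) \<le> 1" using \<alpha> by simp
    also have "1 \<le> 4 powr \<alpha>" using \<alpha> by (simp add: ge_one_powr_ge_zero)
    finally show ?thesis using \<alpha> by (simp add: le_divide_eq)
  qed
  then have "1 \<le> a" using a by linarith
  then have \<kappa>: "1 \<le> \<kappa>" using C mult_mono[of 1 a 1 C] by (simp add: \<kappa>_def)
  have "dominates C I x z"
    unfolding dominates_def
  proof (intro allI impI, elim conjE)
    fix n F and b :: "'a \<Rightarrow> complex mat"
    assume F: "finite F" "F \<subseteq> I" and b: "\<forall>i\<in>F. b i \<in> carrier_mat n n"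
    define \<rho> where "\<rho> = opsp_norm (tensor_sum n F b x)"
    have \<rho>: "0 \<le> C * \<rho>"
      using C opsp_norm_nonneg[OF tensor_sum_carrier[of n F b x]] by (simp add: \<rho>_def)
    have "row_sq n (tensor_sum n F b z) v \<le> (C * \<rho>)\<^sup>2 * vec_norm_sq n v" for v
      unfolding diagonal_family_sq(1)[OF diag F] \<rho>_def
      using b by (intro lower_estimate(1) F) auto
    moreover have "col_sq n (tensor_sum n F b z) v \<le> (C * \<rho>)\<^sup>2 * vec_norm_sq n v" for v
    proof -
      have "col_sq n (tensor_sum n F b z) v
          \<le> (\<Sum>m<n. \<Sum>i\<in>F. (cmod (mat_vec_entry n (b i) v m) * norm (snd (x i)))\<^sup>2)"
        unfolding diagonal_family_sq(2)[OF diag F]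
        using lower F(2) by (intro sum_mono power_mono mult_left_mono) auto
      also have "\<dots> \<le> (C * \<rho>)\<^sup>2 * vec_norm_sq n v"
        unfolding \<rho>_def using b by (intro lower_estimate(2) F) auto
      finally show ?thesis .
    qed
    ultimately show "opsp_norm (tensor_sum n F b z) \<le> C * opsp_norm (tensor_sum n F b x)"
      unfolding \<rho>_def[symmetric] by (subst opsp_norm_le_iff[OF tensor_sum_carrier \<rho>]) blast
  qed
  moreover have "dominates (C\<^sup>2 * \<kappa>) I z x"
    unfolding dominates_def
  proof (intro allI impI, elim conjE)
    fix n F and b :: "'a \<Rightarrow> complex mat"
    assume F: "finite F" "F \<subseteq> I" and b: "\<forall>i\<in>F. b i \<in> carrier_mat n n"
    define \<rho> where "\<rho> = opsp_norm (tensor_sum n F b z)"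
    have \<rho>: "0 \<le> \<rho>" unfolding \<rho>_def by (rule opsp_norm_nonneg[OF tensor_sum_carrier])
    have est: "row_sq n (tensor_sum n F b z) v \<le> \<rho>\<^sup>2 * vec_norm_sq n v"
      "col_sq n (tensor_sum n F b z) v \<le> \<rho>\<^sup>2 * vec_norm_sq n v" for v
      using opsp_norm_le_iff[OF tensor_sum_carrier \<rho>, of n F b z] by (auto simp: \<rho>_def)
    have "opsp_norm (tensor_sum n F b x) \<le> C\<^sup>2 * (\<kappa> * \<rho>)"
    proof (rule upper_estimate[OF F])
      show "b i \<in> carrier_mat n n" if "i \<in> F" for i using b that by blast
      show "0 \<le> \<kappa> * \<rho>" using \<kappa> \<rho> by simp
      fix v
      have "\<rho>\<^sup>2 \<le> (\<kappa> * \<rho>)\<^sup>2"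
        using \<kappa> \<rho> by (intro power_mono) (auto simp: mult_le_cancel_right1)
      then have "\<rho>\<^sup>2 * vec_norm_sq n v \<le> (\<kappa> * \<rho>)\<^sup>2 * vec_norm_sq n v"
        by (intro mult_right_mono vec_norm_sq_nonneg)
      then show "(\<Sum>m<n. \<Sum>i\<in>F. (cmod (vec_mat_entry n (b i) v m))\<^sup>2) \<le> (\<kappa> * \<rho>)\<^sup>2 * vec_norm_sq n v"
        using est(1)[of v] unfolding diagonal_family_sq(1)[OF diag F] by linarith
      have "(\<Sum>m<n. \<Sum>i\<in>F. (cmod (mat_vec_entry n (b i) v m) * norm (snd (x i)))\<^sup>2)
          \<le> (\<Sum>m<n. \<Sum>i\<in>F. (cmod (mat_vec_entry n (b i) v m) * (\<kappa> * norm (snd (z i))))\<^sup>2)"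
        using upper F(2) by (intro sum_mono power_mono mult_left_mono) auto
      also have "\<dots> = \<kappa>\<^sup>2 * col_sq n (tensor_sum n F b z) v"
        unfolding diagonal_family_sq(2)[OF diag F] sum_distrib_left
        by (intro sum.cong refl) (simp add: power_mult_distrib mult_ac)
      also have "\<dots> \<le> \<kappa>\<^sup>2 * (\<rho>\<^sup>2 * vec_norm_sq n v)"
        by (intro mult_left_mono est) simp
      finally show "(\<Sum>m<n. \<Sum>i\<in>F. (cmod (mat_vec_entry n (b i) v m) * norm (snd (x i)))\<^sup>2)
          \<le> (\<kappa> * \<rho>)\<^sup>2 * vec_norm_sq n v"
        by (simp add: power_mult_distrib)
    qed
    then show "opsp_norm (tensor_sum n F b x) \<le> C\<^sup>2 * \<kappa> * opsp_norm (tensor_sum n F b z)"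
      by (simp add: \<rho>_def mult.assoc)
  qed
  ultimately have "equivalent_families (C * (C\<^sup>2 * \<kappa>)) I x z"
    using C \<kappa> by (intro dominates_imp_equivalent) auto
  moreover have "C * (C\<^sup>2 * \<kappa>) = a * C ^ 4"
    by (simp add: \<kappa>_def power2_eq_square power4_eq_xxxx mult_ac)
  moreover have "z = (\<lambda>i. y (\<tau> i))"
    by (simp add: z_def fun_eq_iff)
  ultimately have "equivalent_families (a * C ^ 4) I x (\<lambda>i. y (\<tau> i))"
    by simp
  then show ?thesis
    unfolding equivalent_to_subfamily_def using inj \<tau>J by blast
qed

text \<open>The left-hand side tends to 1 as \<open>\<alpha>\<close> tends to 0.\<close>

lemma exists_exponent:
  fixes a :: real
  assumes "1 < a"
  shows "\<exists>\<alpha>. 0 < \<alpha> \<and> \<alpha> < 1 / 2 \<and> 4 powr \<alpha> / sqrt (1 - 2 * \<alpha>) \<le> a"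
proof -
  have "((\<lambda>\<alpha> :: real. 4 powr \<alpha> / sqrt (1 - 2 * \<alpha>)) \<longlongrightarrow> 4 powr 0 / sqrt (1 - 2 * 0)) (at_right 0)"
    by (intro tendsto_intros) auto
  then have "((\<lambda>\<alpha> :: real. 4 powr \<alpha> / sqrt (1 - 2 * \<alpha>)) \<longlongrightarrow> 1) (at_right 0)" by simp
  then have "\<forall>\<^sub>F \<alpha> in at_right (0 :: real). 4 powr \<alpha> / sqrt (1 - 2 * \<alpha>) < a"
    using assms by (rule order_tendstoD(2))
  moreover have "\<forall>\<^sub>F \<alpha> in at_right (0 :: real). \<alpha> \<in> {0<..<1 / 2}"
    by (rule eventually_at_right_real) simp
  ultimately have "\<forall>\<^sub>F \<alpha> in at_right (0 :: real). 4 powr \<alpha> / sqrt (1 - 2 * \<alpha>) < a \<and> \<alpha> \<in> {0<..<1 / 2}"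
    by (rule eventually_conj)
  then obtain \<alpha> :: real where "4 powr \<alpha> / sqrt (1 - 2 * \<alpha>) < a" "\<alpha> \<in> {0<..<1 / 2}"
    using eventually_happens' trivial_limit_at_right_real by blast
  then show ?thesis by (intro exI[of _ \<alpha>]) auto
qed

theorem theorem1p3:
  fixes a :: real
  assumes "a > 1"
  shows "\<exists>X\<in>\<FF>.
    (\<forall>Z (I :: nat set) x (J :: nat set) y.
       closed Z \<and> cvs.subspace Z \<and> Z \<subseteq> X \<and> canonical_basis Z I x \<and> canonical_basis X J y \<longrightarrow>
       equivalent_to_subfamily a I x J y) \<and>
    (\<exists>\<phi> :: real poly. \<forall>C\<ge>1. \<forall>(I :: nat set) x (J :: nat set) y.
       (\<forall>i\<in>I. x i \<in> X) \<and> normalized_family I x \<and> completely_unconditional C I x \<and>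
       canonical_basis X J y \<longrightarrow>
       equivalent_to_subfamily (poly \<phi> C) I x J y)"
proof -
  obtain \<alpha> where \<alpha>: "0 < \<alpha>" "\<alpha> < 1 / 2" and a: "4 powr \<alpha> / sqrt (1 - 2 * \<alpha>) \<le> a"
    using exists_exponent[OF assms] by blast
  define X where "X = X_space UNIV (diag_op \<alpha>)"
  have "X \<in> \<FF>"
    using compact_contraction_diag_op[OF \<alpha>(1)] not_hilbert_schmidt_diag_op[OF \<alpha>(1)] \<alpha>(2)
    unfolding \<FF>_def X_def by auto
  moreover have "equivalent_to_subfamily a I x J y"
    if Z: "Z \<subseteq> X" and x: "canonical_basis Z I x" and y: "canonical_basis X J y"
    for Z and I :: "nat set" and x and J :: "nat set" and y
  proof -
    note diag = canonical_basis_diagonal[OF \<alpha>(1) Z[unfolded X_def] x]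
    have "cu_family (diag_op \<alpha>) 1 I x"
      using diag linear_contraction_diag_op[OF \<alpha>(1)] diagonal_family_unconditional[OF diag(1)]
      by unfold_locales (auto simp: diagonal_family_def)
    from cu_family_equivalent[OF this \<alpha> a y[unfolded X_def]] show ?thesis by simp
  qed
  moreover have "equivalent_to_subfamily (poly (monom a 4) C) I x J y"
    if C: "1 \<le> C" and x: "\<forall>i\<in>I. x i \<in> X" "normalized_family I x" "completely_unconditional C I x"
      and y: "canonical_basis X J y"
    for C and I :: "nat set" and x and J :: "nat set" and y
  proof -
    have "norm (fst (x i)) = 1" if "i \<in> I" for i
    proof -
      have "norm (snd (x i)) \<le> norm (fst (x i))"
        using X_space_snd[of "x i" UNIV "diag_op \<alpha>"] x(1) that norm_diag_op_le[OF \<alpha>(1)]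
        by (simp add: X_def)
      moreover have "max (norm (fst (x i))) (norm (snd (x i))) = 1"
        using x(2) that unfolding normalized_family_def opsp_norm_1x1 by blast
      ultimately show ?thesis by simp
    qed
    then have "cu_family (diag_op \<alpha>) C I x"
      using linear_contraction_diag_op[OF \<alpha>(1)] C x unfolding X_def by unfold_locales auto
    from cu_family_equivalent[OF this \<alpha> a y[unfolded X_def]] show ?thesis
      by (simp add: poly_monom)
  qed
  ultimately show ?thesis by blast
qed

end
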